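(* Let $T$ be a consistent primitive recursively axiomatized theory in the language $\mathcal{L}_A$ of first-order arithmetic containing Peano Arithmetic $\mathsf{PA}$. Then there exists a $\Sigma_1$ provability predicate $\mathrm{Pr}_T(x)$ of $T$ such that (1) for any modal formula $A$ and any arithmetical interpretation $f$ based on $\mathrm{Pr}_T(x)$, if $\mathbf{N} \vdash A$, then $\mathsf{PA} \vdash f(A)$; and (2) there exists an arithmetical interpretation $f$ based on $\mathrm{Pr}_T(x)$ such that for any modal formula $A$, $\mathbf{N} \vdash A$ if and only if $T \vdash f(A)$.
   Context: An $\mathcal{L}_A$-formula $\mathrm{Pr}_T(x)$ is a provability predicate of $T$ if for every $\mathcal{L}_A$-formula $\varphi$, $T \vdash \varphi$ iff $\mathsf{PA} \vdash \mathrm{Pr}_T(\ulcorner \varphi \urcorner)$, where $\ulcorner\varphi\urcorner$ is the numeral of the Gödel number of $\varphi$. Modal formulas are built from propositional variables and $\bot$ using $\neg,\land,\lor,\to$ and the unary operator $\Box$. An arithmetical interpretation based on $\mathrm{Pr}_T(x)$ is a map $f$ from modal formulas to $\mathcal{L}_A$-sentences with $f(p)$ an arbitrary sentence for each variable $p$, $f(\bot)$ being $0=1$, $f$ commuting with $\neg,\land,\lor,\to$, and $f(\Box A)$ being $\mathrm{Pr}_T(\ulcorner f(A)\urcorner)$. The logic $\mathbf{N}$ (pure logic of necessitation) has as axioms all propositional tautologies in the modal language and as rules Modus Ponens and Necessitation $A/\Box A$. *)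

theory Defs
  imports Main "HOL-Library.Nat_Bijection"
begin

section \<open>First-order arithmetic\<close>

datatype tm = Var nat | Zero | Succ tm | Add tm tm | Mult tm tm

text \<open>All of \<open>\<not>, \<and>, \<or>, \<rightarrow>\<close> have to be primitive: if one of them were an abbreviation,
  syntactically different modal formulas could be interpreted by one and the same sentence,
  and the arithmetical completeness of \<open>N\<close> would fail.\<close>

datatype fm =
    Eq tm tm | Lt tm tm
  | Neg fm | And fm fm | Or fm fm | Imp fm fm
  | All nat fm | Ex nat fm

fun fv_tm :: "tm \<Rightarrow> nat set" where
  "fv_tm (Var x) = {x}"
| "fv_tm Zero = {}"
| "fv_tm (Succ t) = fv_tm t"
| "fv_tm (Add s t) = fv_tm s \<union> fv_tm t"
| "fv_tm (Mult s t) = fv_tm s \<union> fv_tm t"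

fun fv :: "fm \<Rightarrow> nat set" where
  "fv (Eq s t) = fv_tm s \<union> fv_tm t"
| "fv (Lt s t) = fv_tm s \<union> fv_tm t"
| "fv (Neg \<phi>) = fv \<phi>"
| "fv (And \<phi> \<psi>) = fv \<phi> \<union> fv \<psi>"
| "fv (Or \<phi> \<psi>) = fv \<phi> \<union> fv \<psi>"
| "fv (Imp \<phi> \<psi>) = fv \<phi> \<union> fv \<psi>"
| "fv (All x \<phi>) = fv \<phi> - {x}"
| "fv (Ex x \<phi>) = fv \<phi> - {x}"

definition sentence :: "fm \<Rightarrow> bool" where
  "sentence \<phi> \<longleftrightarrow> fv \<phi> = {}"

fun subst_tm :: "nat \<Rightarrow> tm \<Rightarrow> tm \<Rightarrow> tm" where
  "subst_tm x u (Var y) = (if y = x then u else Var y)"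
| "subst_tm x u Zero = Zero"
| "subst_tm x u (Succ t) = Succ (subst_tm x u t)"
| "subst_tm x u (Add s t) = Add (subst_tm x u s) (subst_tm x u t)"
| "subst_tm x u (Mult s t) = Mult (subst_tm x u s) (subst_tm x u t)"

text \<open>\<open>subst x u \<phi>\<close> replaces the free occurrences of \<open>x\<close> in \<open>\<phi>\<close> by \<open>u\<close> without renaming bound
  variables. Where capture is possible, \<open>substitutable x u \<phi>\<close> is required.\<close>

fun subst :: "nat \<Rightarrow> tm \<Rightarrow> fm \<Rightarrow> fm" where
  "subst x u (Eq s t) = Eq (subst_tm x u s) (subst_tm x u t)"
| "subst x u (Lt s t) = Lt (subst_tm x u s) (subst_tm x u t)"
| "subst x u (Neg \<phi>) = Neg (subst x u \<phi>)"
| "subst x u (And \<phi> \<psi>) = And (subst x u \<phi>) (subst x u \<psi>)"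
| "subst x u (Or \<phi> \<psi>) = Or (subst x u \<phi>) (subst x u \<psi>)"
| "subst x u (Imp \<phi> \<psi>) = Imp (subst x u \<phi>) (subst x u \<psi>)"
| "subst x u (All y \<phi>) = (if y = x then All y \<phi> else All y (subst x u \<phi>))"
| "subst x u (Ex y \<phi>) = (if y = x then Ex y \<phi> else Ex y (subst x u \<phi>))"

fun substitutable :: "nat \<Rightarrow> tm \<Rightarrow> fm \<Rightarrow> bool" where
  "substitutable x u (Eq s t) \<longleftrightarrow> True"
| "substitutable x u (Lt s t) \<longleftrightarrow> True"
| "substitutable x u (Neg \<phi>) \<longleftrightarrow> substitutable x u \<phi>"
| "substitutable x u (And \<phi> \<psi>) \<longleftrightarrow> substitutable x u \<phi> \<and> substitutable x u \<psi>"
| "substitutable x u (Or \<phi> \<psi>) \<longleftrightarrow> substitutable x u \<phi> \<and> substitutable x u \<psi>"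
| "substitutable x u (Imp \<phi> \<psi>) \<longleftrightarrow> substitutable x u \<phi> \<and> substitutable x u \<psi>"
| "substitutable x u (All y \<phi>) \<longleftrightarrow> x \<notin> fv (All y \<phi>) \<or> (y \<notin> fv_tm u \<and> substitutable x u \<phi>)"
| "substitutable x u (Ex y \<phi>) \<longleftrightarrow> x \<notin> fv (Ex y \<phi>) \<or> (y \<notin> fv_tm u \<and> substitutable x u \<phi>)"

text \<open>A Hilbert calculus for classical first-order logic with equality. A theory is given by its
  set \<open>T\<close> of axioms; as generalization is unrestricted, an axiom with free variables amounts to its
  universal closure.\<close>

inductive proves :: "fm set \<Rightarrow> fm \<Rightarrow> bool"  (infix \<open>\<turnstile>\<close> 50) for T :: "fm set" where
  ax: "\<phi> \<in> T \<Longrightarrow> T \<turnstile> \<phi>"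
| mp: "T \<turnstile> Imp \<phi> \<psi> \<Longrightarrow> T \<turnstile> \<phi> \<Longrightarrow> T \<turnstile> \<psi>"
| gen: "T \<turnstile> \<phi> \<Longrightarrow> T \<turnstile> All x \<phi>"
| imp1: "T \<turnstile> Imp \<phi> (Imp \<psi> \<phi>)"
| imp2: "T \<turnstile> Imp (Imp \<phi> (Imp \<psi> \<chi>)) (Imp (Imp \<phi> \<psi>) (Imp \<phi> \<chi>))"
| and1: "T \<turnstile> Imp (And \<phi> \<psi>) \<phi>"
| and2: "T \<turnstile> Imp (And \<phi> \<psi>) \<psi>"
| and3: "T \<turnstile> Imp \<phi> (Imp \<psi> (And \<phi> \<psi>))"
| or1: "T \<turnstile> Imp \<phi> (Or \<phi> \<psi>)"
| or2: "T \<turnstile> Imp \<psi> (Or \<phi> \<psi>)"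
| or3: "T \<turnstile> Imp (Imp \<phi> \<chi>) (Imp (Imp \<psi> \<chi>) (Imp (Or \<phi> \<psi>) \<chi>))"
| neg1: "T \<turnstile> Imp (Imp \<phi> \<psi>) (Imp (Imp \<phi> (Neg \<psi>)) (Neg \<phi>))"
| neg2: "T \<turnstile> Imp (Neg (Neg \<phi>)) \<phi>"
| all1: "substitutable x t \<phi> \<Longrightarrow> T \<turnstile> Imp (All x \<phi>) (subst x t \<phi>)"
| all2: "x \<notin> fv \<phi> \<Longrightarrow> T \<turnstile> Imp (All x (Imp \<phi> \<psi>)) (Imp \<phi> (All x \<psi>))"
| ex1: "substitutable x t \<phi> \<Longrightarrow> T \<turnstile> Imp (subst x t \<phi>) (Ex x \<phi>)"
| ex2: "x \<notin> fv \<psi> \<Longrightarrow> T \<turnstile> Imp (All x (Imp \<phi> \<psi>)) (Imp (Ex x \<phi>) \<psi>)"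
| eq1: "T \<turnstile> Eq t t"
| eq2: "substitutable x s \<phi> \<Longrightarrow> substitutable x t \<phi> \<Longrightarrow>
    T \<turnstile> Imp (Eq s t) (Imp (subst x s \<phi>) (subst x t \<phi>))"

definition consistent :: "fm set \<Rightarrow> bool" where
  "consistent T \<longleftrightarrow> \<not> (\<exists>\<phi>. T \<turnstile> \<phi> \<and> T \<turnstile> Neg \<phi>)"

definition extends :: "fm set \<Rightarrow> fm set \<Rightarrow> bool" where
  "extends T U \<longleftrightarrow> (\<forall>\<phi>. U \<turnstile> \<phi> \<longrightarrow> T \<turnstile> \<phi>)"

text \<open>Substituting \<open>Succ (Var x)\<close> for \<open>x\<close> cannot lead to capture, so the induction scheme needs no
  side condition; the other free variables of \<open>\<phi>\<close> are parameters.\<close>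

inductive_set PA :: "fm set" where
  "Neg (Eq (Succ (Var 0)) Zero) \<in> PA"
| "Imp (Eq (Succ (Var 0)) (Succ (Var 1))) (Eq (Var 0) (Var 1)) \<in> PA"
| "Eq (Add (Var 0) Zero) (Var 0) \<in> PA"
| "Eq (Add (Var 0) (Succ (Var 1))) (Succ (Add (Var 0) (Var 1))) \<in> PA"
| "Eq (Mult (Var 0) Zero) Zero \<in> PA"
| "Eq (Mult (Var 0) (Succ (Var 1))) (Add (Mult (Var 0) (Var 1)) (Var 0)) \<in> PA"
| "Neg (Lt (Var 0) Zero) \<in> PA"
| "Imp (Lt (Var 0) (Succ (Var 1))) (Or (Lt (Var 0) (Var 1)) (Eq (Var 0) (Var 1))) \<in> PA"
| "Imp (Or (Lt (Var 0) (Var 1)) (Eq (Var 0) (Var 1))) (Lt (Var 0) (Succ (Var 1))) \<in> PA"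
| "Imp (And (subst x Zero \<phi>) (All x (Imp \<phi> (subst x (Succ (Var x)) \<phi>)))) (All x \<phi>) \<in> PA"

inductive Delta0 :: "fm \<Rightarrow> bool" where
  "Delta0 (Eq s t)"
| "Delta0 (Lt s t)"
| "Delta0 \<phi> \<Longrightarrow> Delta0 (Neg \<phi>)"
| "Delta0 \<phi> \<Longrightarrow> Delta0 \<psi> \<Longrightarrow> Delta0 (And \<phi> \<psi>)"
| "Delta0 \<phi> \<Longrightarrow> Delta0 \<psi> \<Longrightarrow> Delta0 (Or \<phi> \<psi>)"
| "Delta0 \<phi> \<Longrightarrow> Delta0 \<psi> \<Longrightarrow> Delta0 (Imp \<phi> \<psi>)"
| "Delta0 \<phi> \<Longrightarrow> x \<notin> fv_tm t \<Longrightarrow> Delta0 (All x (Imp (Lt (Var x) t) \<phi>))"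
| "Delta0 \<phi> \<Longrightarrow> x \<notin> fv_tm t \<Longrightarrow> Delta0 (Ex x (And (Lt (Var x) t) \<phi>))"

inductive Sigma1 :: "fm \<Rightarrow> bool" where
  "Delta0 \<phi> \<Longrightarrow> Sigma1 \<phi>"
| "Sigma1 \<phi> \<Longrightarrow> Sigma1 (Ex x \<phi>)"

section \<open>Goedel numbers and primitive recursive axiomatizations\<close>

fun num :: "nat \<Rightarrow> tm" where
  "num 0 = Zero"
| "num (Suc n) = Succ (num n)"

fun gn_tm :: "tm \<Rightarrow> nat" where
  "gn_tm (Var x) = prod_encode (0, x)"
| "gn_tm Zero = prod_encode (1, 0)"
| "gn_tm (Succ t) = prod_encode (2, gn_tm t)"
| "gn_tm (Add s t) = prod_encode (3, prod_encode (gn_tm s, gn_tm t))"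
| "gn_tm (Mult s t) = prod_encode (4, prod_encode (gn_tm s, gn_tm t))"

fun gn :: "fm \<Rightarrow> nat" where
  "gn (Eq s t) = prod_encode (0, prod_encode (gn_tm s, gn_tm t))"
| "gn (Lt s t) = prod_encode (1, prod_encode (gn_tm s, gn_tm t))"
| "gn (Neg \<phi>) = prod_encode (2, gn \<phi>)"
| "gn (And \<phi> \<psi>) = prod_encode (3, prod_encode (gn \<phi>, gn \<psi>))"
| "gn (Or \<phi> \<psi>) = prod_encode (4, prod_encode (gn \<phi>, gn \<psi>))"
| "gn (Imp \<phi> \<psi>) = prod_encode (5, prod_encode (gn \<phi>, gn \<psi>))"
| "gn (All x \<phi>) = prod_encode (6, prod_encode (x, gn \<phi>))"
| "gn (Ex x \<phi>) = prod_encode (7, prod_encode (x, gn \<phi>))"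

lemma gn_tm_inject: "gn_tm s = gn_tm t \<Longrightarrow> s = t"
proof (induction s arbitrary: t)
  case (Var x) then show ?case by (cases t) auto
next
  case Zero then show ?case by (cases t) auto
next
  case (Succ s) then show ?case by (cases t) auto
next
  case (Add s1 s2) then show ?case by (cases t) auto
next
  case (Mult s1 s2) then show ?case by (cases t) auto
qed

lemma gn_inject: "gn \<phi> = gn \<psi> \<Longrightarrow> \<phi> = \<psi>"
proof (induction \<phi> arbitrary: \<psi>)
  case (Eq s t) then show ?case by (cases \<psi>) (auto dest: gn_tm_inject)
next
  case (Lt s t) then show ?case by (cases \<psi>) (auto dest: gn_tm_inject)
next
  case (Neg \<phi>) then show ?case by (cases \<psi>) auto
next
  case (And \<phi>1 \<phi>2) then show ?case by (cases \<psi>) auto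
next
  case (Or \<phi>1 \<phi>2) then show ?case by (cases \<psi>) auto
next
  case (Imp \<phi>1 \<phi>2) then show ?case by (cases \<psi>) auto
next
  case (All x \<phi>) then show ?case by (cases \<psi>) auto
next
  case (Ex x \<phi>) then show ?case by (cases \<psi>) auto
qed

text \<open>\<open>primrec_fun n f\<close>: \<open>f\<close> is an \<open>n\<close>-ary primitive recursive function; only its values on lists
  of length \<open>n\<close> matter.\<close>

inductive primrec_fun :: "nat \<Rightarrow> (nat list \<Rightarrow> nat) \<Rightarrow> bool" where
  zero: "primrec_fun n (\<lambda>xs. 0)"
| succ: "primrec_fun 1 (\<lambda>xs. Suc (xs ! 0))"
| proj: "i < n \<Longrightarrow> primrec_fun n (\<lambda>xs. xs ! i)"
| comp: "primrec_fun (length gs) h \<Longrightarrow> \<forall>g\<in>set gs. primrec_fun n g \<Longrightarrow>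
    primrec_fun n (\<lambda>xs. h (map (\<lambda>g. g xs) gs))"
| prec: "primrec_fun n g \<Longrightarrow> primrec_fun (Suc (Suc n)) h \<Longrightarrow>
    primrec_fun (Suc n) (\<lambda>xs. rec_nat (g (tl xs)) (\<lambda>k r. h (k # r # tl xs)) (hd xs))"

definition primrec_set :: "nat set \<Rightarrow> bool" where
  "primrec_set X \<longleftrightarrow> (\<exists>f. primrec_fun 1 f \<and> (\<forall>n. f [n] = (if n \<in> X then 1 else 0)))"

definition primrec_axiomatized :: "fm set \<Rightarrow> bool" where
  "primrec_axiomatized T \<longleftrightarrow> primrec_set (gn ` T)"

section \<open>Provability predicates\<close>

text \<open>The distinguished variable of a formula \<open>P(x)\<close> is \<open>Var 0\<close>. Numerals are closed, so the
  substitution below is always capture-free.\<close>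

definition at_code :: "fm \<Rightarrow> fm \<Rightarrow> fm" where
  "at_code P \<phi> = subst 0 (num (gn \<phi>)) P"

definition provability_predicate :: "fm set \<Rightarrow> fm \<Rightarrow> bool" where
  "provability_predicate T P \<longleftrightarrow>
     fv P \<subseteq> {0} \<and> (\<forall>\<phi>. T \<turnstile> \<phi> \<longleftrightarrow> PA \<turnstile> at_code P \<phi>)"

section \<open>The pure logic of necessitation\<close>

datatype mfm =
  PVar nat | MBot | MNeg mfm | MAnd mfm mfm | MOr mfm mfm | MImp mfm mfm | Box mfm

text \<open>Variables and boxed formulas are the propositional atoms.\<close>

fun peval :: "(nat \<Rightarrow> bool) \<Rightarrow> (mfm \<Rightarrow> bool) \<Rightarrow> mfm \<Rightarrow> bool" where
  "peval v b (PVar p) \<longleftrightarrow> v p"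
| "peval v b MBot \<longleftrightarrow> False"
| "peval v b (MNeg A) \<longleftrightarrow> \<not> peval v b A"
| "peval v b (MAnd A B) \<longleftrightarrow> peval v b A \<and> peval v b B"
| "peval v b (MOr A B) \<longleftrightarrow> peval v b A \<or> peval v b B"
| "peval v b (MImp A B) \<longleftrightarrow> (peval v b A \<longrightarrow> peval v b B)"
| "peval v b (Box A) \<longleftrightarrow> b A"

definition tautology :: "mfm \<Rightarrow> bool" where
  "tautology A \<longleftrightarrow> (\<forall>v b. peval v b A)"

inductive N_proves :: "mfm \<Rightarrow> bool" where
  taut: "tautology A \<Longrightarrow> N_proves A"
| mp: "N_proves (MImp A B) \<Longrightarrow> N_proves A \<Longrightarrow> N_proves B"
| nec: "N_proves A \<Longrightarrow> N_proves (Box A)"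

definition arith_interpretation :: "fm \<Rightarrow> (mfm \<Rightarrow> fm) \<Rightarrow> bool" where
  "arith_interpretation P f \<longleftrightarrow>
     (\<forall>p. sentence (f (PVar p))) \<and>
     f MBot = Eq Zero (num 1) \<and>
     (\<forall>A. f (MNeg A) = Neg (f A)) \<and>
     (\<forall>A B. f (MAnd A B) = And (f A) (f B)) \<and>
     (\<forall>A B. f (MOr A B) = Or (f A) (f B)) \<and>
     (\<forall>A B. f (MImp A B) = Imp (f A) (f B)) \<and>
     (\<forall>A. f (Box A) = at_code P (f A))"

end

theory Submission
  imports Defs
begin

text \<open>A formula is unprovable in \<open>N\<close> iff some assignment to its propositional atoms, true at every boxed
  theorem of \<open>N\<close>, falsifies it. So it suffices to find a \<open>\<Sigma>\<^sub>1\<close> formula \<open>P\<close> that defines the theorems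
  of \<open>T\<close> in the standard model and whose instances at non-theorems are propositionally independent
  over \<open>T\<close>: then atoms can be interpreted by instances of \<open>P\<close>, and induction on the modal formula shows
  that \<open>T\<close> proves no interpretation of an unprovable one.

  \<open>P\<close> is obtained by a Rosser-style self-reference. It enumerates the theorems of \<open>T\<close> until a \<open>T\<close>-proof
  shows up that excludes some pattern ``\<open>P\<close> fails on \<open>Y\<close> and holds elsewhere below \<open>d\<close>'', where no element
  of \<open>Y\<close> has been enumerated so far; from then on \<open>P\<close> realizes exactly this pattern. If that ever happened,
  it would happen at a standard stage, PA would verify the pattern, and \<open>T\<close> would be inconsistent. Hence
  it never happens, so \<open>P\<close> defines the theorems and no such pattern is refutable.

  Only the \<open>\<Sigma>\<^sub>1\<close>-completeness of PA is proved inside the calculus; everything else about syntax only needs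
  to be \<open>\<Sigma>\<^sub>1\<close>-definable in the standard model.\<close>

section \<open>Truth in the standard model\<close>

text \<open>\<open>T\<close> need not be sound: truth in the standard model is transferred to
  provability by \<Sigma>1-completeness, back to truth only from PA, and the impossibility of a stop
  is a contradiction derived inside \<open>T\<close>. An assignment refuting a modal formula may
  make boxes of unprovable formulas true, so it is not enough that \<open>P\<close> can fail at
  non-theorems: arbitrary finite patterns are required, and the stopping rule only asks that the
  excluded numbers are not yet recognized. The obstacle is to prove negative instances of
  \<open>P\<close>, whose witnessing stage may be nonstandard. A stop at a standard stage
  \<open>s\<close> removes it: stages up to \<open>s\<close> are checked one by one, later ones are
  forbidden by a clause of \<open>P\<close>. Self-reference needs no diagonal lemma: the matrix
  \<open>M\<close> refers to a code only through \<open>Var 1\<close>, and \<open>P\<close> adds the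
  equation of \<open>Var 1\<close> with the code of \<open>M\<close>, so the code of
  \<open>P\<close> arises from that of \<open>M\<close> by pairing and one numeral. All relations on
  codes come from one theorem: the least fixed point of a finitary \<Sigma>1 operator is \<Sigma>1.
  It covers primitive recursion, substitution and provability alike.\<close>

fun eval_tm :: "(nat \<Rightarrow> nat) \<Rightarrow> tm \<Rightarrow> nat" where
  "eval_tm e (Var x) = e x"
| "eval_tm e Zero = 0"
| "eval_tm e (Succ t) = Suc (eval_tm e t)"
| "eval_tm e (Add s t) = eval_tm e s + eval_tm e t"
| "eval_tm e (Mult s t) = eval_tm e s * eval_tm e t"

fun sat :: "(nat \<Rightarrow> nat) \<Rightarrow> fm \<Rightarrow> bool" where
  "sat e (Eq s t) \<longleftrightarrow> eval_tm e s = eval_tm e t"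
| "sat e (Lt s t) \<longleftrightarrow> eval_tm e s < eval_tm e t"
| "sat e (Neg \<phi>) \<longleftrightarrow> \<not> sat e \<phi>"
| "sat e (And \<phi> \<psi>) \<longleftrightarrow> sat e \<phi> \<and> sat e \<psi>"
| "sat e (Or \<phi> \<psi>) \<longleftrightarrow> sat e \<phi> \<or> sat e \<psi>"
| "sat e (Imp \<phi> \<psi>) \<longleftrightarrow> (sat e \<phi> \<longrightarrow> sat e \<psi>)"
| "sat e (All x \<phi>) \<longleftrightarrow> (\<forall>v. sat (e(x := v)) \<phi>)"
| "sat e (Ex x \<phi>) \<longleftrightarrow> (\<exists>v. sat (e(x := v)) \<phi>)"

lemma eval_tm_cong: "(\<And>x. x \<in> fv_tm t \<Longrightarrow> e x = e' x) \<Longrightarrow> eval_tm e t = eval_tm e' t"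
  by (induction t) auto

lemma sat_cong: "(\<And>x. x \<in> fv \<phi> \<Longrightarrow> e x = e' x) \<Longrightarrow> sat e \<phi> = sat e' \<phi>"
proof (induction \<phi> arbitrary: e e')
  case (Eq s t)
  then show ?case using eval_tm_cong[of s e e'] eval_tm_cong[of t e e'] by auto
next
  case (Lt s t)
  then show ?case using eval_tm_cong[of s e e'] eval_tm_cong[of t e e'] by auto
next
  case (All x \<phi>)
  have "sat (e(x := v)) \<phi> = sat (e'(x := v)) \<phi>" for v
    by (rule All.IH) (use All.prems in auto)
  then show ?case by simp
next
  case (Ex x \<phi>)
  have "sat (e(x := v)) \<phi> = sat (e'(x := v)) \<phi>" for v
    by (rule Ex.IH) (use Ex.prems in auto)
  then show ?case by simp
next
  case (Neg \<phi>)
  show ?case using Neg.IH[of e e'] Neg.prems by auto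
next
  case (And \<phi> \<psi>)
  show ?case using And.IH(1)[of e e'] And.IH(2)[of e e'] And.prems by auto
next
  case (Or \<phi> \<psi>)
  show ?case using Or.IH(1)[of e e'] Or.IH(2)[of e e'] Or.prems by auto
next
  case (Imp \<phi> \<psi>)
  show ?case using Imp.IH(1)[of e e'] Imp.IH(2)[of e e'] Imp.prems by auto
qed

section \<open>Substitution and its semantics\<close>

lemma subst_tm_id: "x \<notin> fv_tm t \<Longrightarrow> subst_tm x u t = t"
  by (induction t) auto

lemma subst_id: "x \<notin> fv \<phi> \<Longrightarrow> subst x u \<phi> = \<phi>"
  by (induction \<phi>) (auto simp: subst_tm_id)

lemma subst_tm_Var: "subst_tm x (Var x) t = t"
  by (induction t) auto

lemma subst_Var: "subst x (Var x) \<phi> = \<phi>"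
  by (induction \<phi>) (auto simp: subst_tm_Var)

lemma substitutable_notin: "x \<notin> fv \<phi> \<Longrightarrow> substitutable x u \<phi>"
  by (induction \<phi>) auto

text \<open>A quantifier that could capture a variable of \<open>u\<close> binds \<open>x\<close>
  itself, and below it \<open>x\<close> has no free occurrence left to replace. This covers numerals
  and the successor term of the induction scheme.\<close>

lemma substitutable_self: "fv_tm u \<subseteq> {x} \<Longrightarrow> substitutable x u \<phi>"
  by (induction \<phi>) (auto simp: substitutable_notin)

lemma fv_num [simp]: "fv_tm (num n) = {}"
  by (induction n) auto

lemma eval_num [simp]: "eval_tm e (num n) = n"
  by (induction n) auto

lemma subst_num [simp]: "subst_tm x u (num n) = num n"
  by (simp add: subst_tm_id)

lemma num_inject [simp]: "num m = num n \<longleftrightarrow> m = n"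
  by (metis eval_num)

lemma substitutable_num [simp]: "substitutable x (num n) \<phi>"
  by (simp add: substitutable_self)

lemma fv_subst_tm_num: "fv_tm (subst_tm x (num n) t) = fv_tm t - {x}"
  by (induction t) auto

lemma fv_subst_num: "fv (subst x (num n) \<phi>) = fv \<phi> - {x}"
  by (induction \<phi>) (auto simp: fv_subst_tm_num)

lemma subst_tm_num_inject:
  "x \<in> fv_tm t \<Longrightarrow> subst_tm x (num m) t = subst_tm x (num n) t \<Longrightarrow> m = n"
  by (induction t) (auto split: if_splits)

text \<open>Keeps the instances of \<open>P\<close> at different numbers apart as formulas, on which
  the injectivity of the interpretation rests.\<close>

lemma subst_num_inject:
  "x \<in> fv \<phi> \<Longrightarrow> subst x (num m) \<phi> = subst x (num n) \<phi> \<Longrightarrow> m = n"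
  by (induction \<phi>) (auto split: if_splits dest: subst_tm_num_inject)

lemma eval_subst_tm: "eval_tm e (subst_tm x u t) = eval_tm (e(x := eval_tm e u)) t"
  by (induction t) auto

lemma sat_subst:
  "substitutable x u \<phi> \<Longrightarrow> sat e (subst x u \<phi>) = sat (e(x := eval_tm e u)) \<phi>"
proof (induction \<phi> arbitrary: e)
  case (All y \<phi>)
  show ?case
  proof (cases "x \<in> fv (All y \<phi>)")
    case True
    have xy: "x \<noteq> y" using True by auto
    have "sat (e(y := v)) (subst x u \<phi>) = sat ((e(x := eval_tm e u))(y := v)) \<phi>" for v
    proof -
      have "sat (e(y := v)) (subst x u \<phi>) = sat ((e(y := v))(x := eval_tm (e(y := v)) u)) \<phi>"
        by (rule All.IH) (use True All.prems in auto)
      moreover have "eval_tm (e(y := v)) u = eval_tm e u"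
        by (rule eval_tm_cong) (use True All.prems in auto)
      ultimately show ?thesis by (simp only: fun_upd_twist[OF xy])
    qed
    then show ?thesis by (simp only: subst.simps sat.simps if_not_P[OF xy[symmetric]])
  next
    case False
    then have "sat e (subst x u (All y \<phi>)) = sat e (All y \<phi>)"
      by (metis subst_id)
    also have "\<dots> = sat (e(x := eval_tm e u)) (All y \<phi>)"
      by (rule sat_cong) (use False in \<open>metis fun_upd_other\<close>)
    finally show ?thesis .
  qed
next
  case (Ex y \<phi>)
  show ?case
  proof (cases "x \<in> fv (Ex y \<phi>)")
    case True
    have xy: "x \<noteq> y" using True by auto
    have "sat (e(y := v)) (subst x u \<phi>) = sat ((e(x := eval_tm e u))(y := v)) \<phi>" for v
    proof -
      have "sat (e(y := v)) (subst x u \<phi>) = sat ((e(y := v))(x := eval_tm (e(y := v)) u)) \<phi>"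
        by (rule Ex.IH) (use True Ex.prems in auto)
      moreover have "eval_tm (e(y := v)) u = eval_tm e u"
        by (rule eval_tm_cong) (use True Ex.prems in auto)
      ultimately show ?thesis by (simp only: fun_upd_twist[OF xy])
    qed
    then show ?thesis by (simp only: subst.simps sat.simps if_not_P[OF xy[symmetric]])
  next
    case False
    then have "sat e (subst x u (Ex y \<phi>)) = sat e (Ex y \<phi>)"
      by (metis subst_id)
    also have "\<dots> = sat (e(x := eval_tm e u)) (Ex y \<phi>)"
      by (rule sat_cong) (use False in \<open>metis fun_upd_other\<close>)
    finally show ?thesis .
  qed
qed (auto simp: eval_subst_tm)

section \<open>Soundness of the calculus and of PA\<close>

lemma proves_sound:
  assumes "T \<turnstile> \<phi>" and "\<And>\<psi> e. \<psi> \<in> T \<Longrightarrow> sat e \<psi>"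
  shows "sat e \<phi>"
  using assms(1)
proof (induction arbitrary: e)
  case (all2 x \<phi> \<psi>)
  have "sat (e(x := v)) \<phi> = sat e \<phi>" for v
    by (rule sat_cong) (use all2 in auto)
  then show ?case by simp
next
  case (ex2 x \<psi> \<phi>)
  have "sat (e(x := v)) \<psi> = sat e \<psi>" for v
    by (rule sat_cong) (use ex2 in auto)
  then show ?case by auto
qed (auto simp: assms(2) sat_subst)

lemma PA_true: "\<phi> \<in> PA \<Longrightarrow> sat e \<phi>"
proof (induction rule: PA.induct)
  case (10 x \<phi>)
  have *: "substitutable x Zero \<phi>" "substitutable x (Succ (Var x)) \<phi>"
    by (simp_all add: substitutable_self)
  have ind: "sat (e(x := n)) \<phi>"
    if "sat (e(x := 0)) \<phi>" "\<forall>v. sat (e(x := v)) \<phi> \<longrightarrow> sat (e(x := Suc v)) \<phi>" for n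
    using that by (induction n) auto
  have "sat (e(x := v)) (subst x (Succ (Var x)) \<phi>) = sat (e(x := Suc v)) \<phi>" for v
    using sat_subst[OF *(2), of "e(x := v)"] by simp
  moreover have "sat e (subst x Zero \<phi>) = sat (e(x := 0)) \<phi>"
    using sat_subst[OF *(1), of e] by simp
  ultimately show ?case
    unfolding sat.simps using ind by blast
qed auto

lemma PA_sound: "PA \<turnstile> \<phi> \<Longrightarrow> sat e \<phi>"
  using proves_sound PA_true by blast

section \<open>Propositional completeness of the calculus\<close>

fun fm_peval :: "(fm \<Rightarrow> bool) \<Rightarrow> fm \<Rightarrow> bool" where
  "fm_peval v (Neg \<phi>) \<longleftrightarrow> \<not> fm_peval v \<phi>"
| "fm_peval v (And \<phi> \<psi>) \<longleftrightarrow> fm_peval v \<phi> \<and> fm_peval v \<psi>"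
| "fm_peval v (Or \<phi> \<psi>) \<longleftrightarrow> fm_peval v \<phi> \<or> fm_peval v \<psi>"
| "fm_peval v (Imp \<phi> \<psi>) \<longleftrightarrow> (fm_peval v \<phi> \<longrightarrow> fm_peval v \<psi>)"
| "fm_peval v (Eq s t) \<longleftrightarrow> v (Eq s t)"
| "fm_peval v (Lt s t) \<longleftrightarrow> v (Lt s t)"
| "fm_peval v (All x \<phi>) \<longleftrightarrow> v (All x \<phi>)"
| "fm_peval v (Ex x \<phi>) \<longleftrightarrow> v (Ex x \<phi>)"

fun prime_parts :: "fm \<Rightarrow> fm set" where
  "prime_parts (Neg \<phi>) = prime_parts \<phi>"
| "prime_parts (And \<phi> \<psi>) = prime_parts \<phi> \<union> prime_parts \<psi>"
| "prime_parts (Or \<phi> \<psi>) = prime_parts \<phi> \<union> prime_parts \<psi>"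
| "prime_parts (Imp \<phi> \<psi>) = prime_parts \<phi> \<union> prime_parts \<psi>"
| "prime_parts (Eq s t) = {Eq s t}"
| "prime_parts (Lt s t) = {Lt s t}"
| "prime_parts (All x \<phi>) = {All x \<phi>}"
| "prime_parts (Ex x \<phi>) = {Ex x \<phi>}"

lemma finite_prime_parts [simp]: "finite (prime_parts \<phi>)"
  by (induction \<phi>) auto

text \<open>Derivations from hypotheses without generalization, so that the deduction theorem holds.\<close>

inductive hyp_proves :: "fm set \<Rightarrow> fm set \<Rightarrow> fm \<Rightarrow> bool" for T H where
  base: "T \<turnstile> \<phi> \<Longrightarrow> hyp_proves T H \<phi>"
| hyp: "\<phi> \<in> H \<Longrightarrow> hyp_proves T H \<phi>"
| mp: "hyp_proves T H (Imp \<phi> \<psi>) \<Longrightarrow> hyp_proves T H \<phi> \<Longrightarrow> hyp_proves T H \<psi>"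

lemma proves_Imp_refl: "T \<turnstile> Imp \<phi> \<phi>"
  by (meson proves.mp proves.imp1 proves.imp2)

lemma hyp_proves_deduct:
  "hyp_proves T (insert \<psi> H) \<phi> \<Longrightarrow> hyp_proves T H (Imp \<psi> \<phi>)"
proof (induction rule: hyp_proves.induct)
  case (base \<phi>)
  then show ?case by (meson hyp_proves.base proves.imp1 proves.mp)
next
  case (hyp \<phi>)
  then show ?case
    by (metis hyp_proves.hyp hyp_proves.mp hyp_proves.base insert_iff proves.imp1 proves_Imp_refl)
next
  case (mp \<phi> \<chi>)
  then show ?case by (meson hyp_proves.mp hyp_proves.base proves.imp2)
qed

lemma hyp_proves_empty: "hyp_proves T {} \<phi> \<Longrightarrow> T \<turnstile> \<phi>"
  by (induction rule: hyp_proves.induct) (auto intro: proves.mp)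

lemma hyp_proves_mono: "hyp_proves T H \<phi> \<Longrightarrow> H \<subseteq> H' \<Longrightarrow> hyp_proves T H' \<phi>"
  by (induction rule: hyp_proves.induct) (auto intro: hyp_proves.intros)

lemma hyp_proves_weaken: "hyp_proves T H \<phi> \<Longrightarrow> hyp_proves T (insert \<psi> H) \<phi>"
  by (rule hyp_proves_mono) auto

lemma hyp_proves_contra:
  assumes "hyp_proves T (insert \<phi> H) \<psi>" "hyp_proves T (insert \<phi> H) (Neg \<psi>)"
  shows "hyp_proves T H (Neg \<phi>)"
  using assms by (meson hyp_proves_deduct hyp_proves.mp hyp_proves.base proves.neg1)

lemma hyp_proves_exfalso:
  assumes "hyp_proves T H \<psi>" "hyp_proves T H (Neg \<psi>)"
  shows "hyp_proves T H \<phi>"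
  using hyp_proves_contra[of T "Neg \<phi>" H \<psi>] assms
  by (meson hyp_proves_weaken hyp_proves.mp hyp_proves.base proves.neg2)

lemma hyp_proves_cases:
  assumes "hyp_proves T (insert \<phi> H) \<psi>" "hyp_proves T (insert (Neg \<phi>) H) \<psi>"
  shows "hyp_proves T H \<psi>"
proof -
  have *: "hyp_proves T (insert (Neg \<psi>) H) (Neg \<phi>)"
  proof (rule hyp_proves_contra)
    show "hyp_proves T (insert \<phi> (insert (Neg \<psi>) H)) \<psi>"
      by (rule hyp_proves_mono[OF assms(1)]) auto
  qed (simp add: hyp_proves.hyp)
  have "hyp_proves T (insert (Neg \<psi>) H) \<psi>"
    using hyp_proves_deduct[OF assms(2)] * by (meson hyp_proves.mp hyp_proves_weaken)
  then have "hyp_proves T H (Neg (Neg \<psi>))"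
    by (rule hyp_proves_contra) (simp add: hyp_proves.hyp)
  then show ?thesis by (meson hyp_proves.mp hyp_proves.base proves.neg2)
qed

definition lit :: "(fm \<Rightarrow> bool) \<Rightarrow> fm \<Rightarrow> fm" where
  "lit v a = (if v a then a else Neg a)"

abbreviation literals :: "(fm \<Rightarrow> bool) \<Rightarrow> fm set \<Rightarrow> fm set" where
  "literals v S \<equiv> lit v ` S"

text \<open>Kalmar's argument: an assignment to the prime parts, written as hypotheses, decides the
  whole formula inside the calculus. Quantified formulas count as prime and are never
  opened.\<close>

lemma kalmar:
  "literals v (prime_parts \<phi>) \<subseteq> H \<Longrightarrow> hyp_proves T H (if fm_peval v \<phi> then \<phi> else Neg \<phi>)"
proof (induction \<phi>)
  case (Neg \<phi>)
  then have IH: "hyp_proves T H (if fm_peval v \<phi> then \<phi> else Neg \<phi>)" by simp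
  have "hyp_proves T H (Neg (Neg \<phi>))" if "hyp_proves T H \<phi>"
    by (rule hyp_proves_contra[where \<psi> = \<phi>])
      (use that in \<open>simp_all add: hyp_proves_weaken hyp_proves.hyp\<close>)
  with IH show ?case by (auto split: if_splits)
next
  case (And \<phi> \<psi>)
  then have IH: "hyp_proves T H (if fm_peval v \<phi> then \<phi> else Neg \<phi>)"
    "hyp_proves T H (if fm_peval v \<psi> then \<psi> else Neg \<psi>)"
    by (simp_all add: image_Un)
  have 1: "hyp_proves T (insert (And \<phi> \<psi>) H) \<phi>" "hyp_proves T (insert (And \<phi> \<psi>) H) \<psi>"
    by (meson hyp_proves.hyp hyp_proves.mp hyp_proves.base insertI1 proves.and1 proves.and2)+
  have 2: "hyp_proves T H (And \<phi> \<psi>)" if "hyp_proves T H \<phi>" "hyp_proves T H \<psi>"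
    using that by (meson hyp_proves.mp hyp_proves.base proves.and3)
  have 3: "hyp_proves T H (Neg (And \<phi> \<psi>))"
    if "hyp_proves T H (Neg \<phi>) \<or> hyp_proves T H (Neg \<psi>)"
    using that hyp_proves_contra[OF 1(1)] hyp_proves_contra[OF 1(2)] by (blast intro: hyp_proves_weaken)
  show ?case using IH 2 3 by (auto split: if_splits)
next
  case (Or \<phi> \<psi>)
  then have IH: "hyp_proves T H (if fm_peval v \<phi> then \<phi> else Neg \<phi>)"
    "hyp_proves T H (if fm_peval v \<psi> then \<psi> else Neg \<psi>)"
    by (simp_all add: image_Un)
  have 1: "hyp_proves T H (Neg (Or \<phi> \<psi>))" if "hyp_proves T H (Neg \<phi>)" "hyp_proves T H (Neg \<psi>)"
  proof -
    let ?H = "insert (Or \<phi> \<psi>) H"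
    have "hyp_proves T ?H (Imp \<phi> \<chi>)" for \<chi>
      by (rule hyp_proves_deduct, rule hyp_proves_exfalso[of _ _ \<phi>])
        (use that in \<open>simp_all add: hyp_proves_weaken hyp_proves.hyp\<close>)
    moreover have "hyp_proves T ?H (Imp \<psi> \<chi>)" for \<chi>
      by (rule hyp_proves_deduct, rule hyp_proves_exfalso[of _ _ \<psi>])
        (use that in \<open>simp_all add: hyp_proves_weaken hyp_proves.hyp\<close>)
    ultimately have "\<And>\<chi>. hyp_proves T ?H \<chi>"
      by (meson hyp_proves.hyp hyp_proves.mp hyp_proves.base insertI1 proves.or3)
    then show ?thesis by (rule hyp_proves_contra[OF _ \<open>\<And>\<chi>. hyp_proves T ?H \<chi>\<close>])
  qed
  have 2: "hyp_proves T H (Or \<phi> \<psi>)" if "hyp_proves T H \<phi> \<or> hyp_proves T H \<psi>"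
    using that by (meson hyp_proves.mp hyp_proves.base proves.or1 proves.or2)
  show ?case using IH 1 2 by (auto split: if_splits)
next
  case (Imp \<phi> \<psi>)
  then have IH: "hyp_proves T H (if fm_peval v \<phi> then \<phi> else Neg \<phi>)"
    "hyp_proves T H (if fm_peval v \<psi> then \<psi> else Neg \<psi>)"
    by (simp_all add: image_Un)
  have 1: "hyp_proves T H (Imp \<phi> \<psi>)" if "hyp_proves T H \<psi>"
    using that by (meson hyp_proves.mp hyp_proves.base proves.imp1)
  have 2: "hyp_proves T H (Imp \<phi> \<psi>)" if "hyp_proves T H (Neg \<phi>)"
    by (rule hyp_proves_deduct, rule hyp_proves_exfalso[of _ _ \<phi>])
      (use that in \<open>simp_all add: hyp_proves_weaken hyp_proves.hyp\<close>)
  have 3: "hyp_proves T H (Neg (Imp \<phi> \<psi>))" if "hyp_proves T H \<phi>" "hyp_proves T H (Neg \<psi>)"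
    by (rule hyp_proves_contra[where \<psi> = \<psi>])
      (use that in \<open>meson hyp_proves.hyp hyp_proves.mp insertI1 hyp_proves_weaken\<close>)+
  show ?case using IH 1 2 3 by (auto split: if_splits)
qed (auto simp: lit_def intro: hyp_proves.hyp)

text \<open>Each prime formula is discharged by a case distinction: two assignments that differ only
  at \<open>a\<close> supply the two cases.\<close>

lemma literals_eliminate:
  "finite S \<Longrightarrow> (\<And>v. hyp_proves T (literals v S) \<phi>) \<Longrightarrow> hyp_proves T {} \<phi>"
proof (induction S rule: finite_induct)
  case (insert a S)
  have "hyp_proves T (literals v S) \<phi>" for v
  proof -
    have "literals (v(a := b)) S = literals v S" for b
      using insert.hyps by (intro image_cong) (auto simp: lit_def)
    then have "hyp_proves T (insert a (literals v S)) \<phi>"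
      "hyp_proves T (insert (Neg a) (literals v S)) \<phi>"
      using insert.prems[of "v(a := True)"] insert.prems[of "v(a := False)"]
      by (simp_all add: lit_def)
    then show ?thesis by (rule hyp_proves_cases)
  qed
  then show ?case by (rule insert.IH)
qed simp

text \<open>From here on propositional steps are left to truth tables. The plain deduction theorem
  fails for \<open>proves\<close> because generalization is unrestricted, so later hypotheses are
  written as explicit antecedents and handled by the variants below.\<close>

theorem taut_proves:
  assumes "\<And>v. fm_peval v \<phi>"
  shows "T \<turnstile> \<phi>"
proof (rule hyp_proves_empty, rule literals_eliminate[of "prime_parts \<phi>"])
  fix v
  show "hyp_proves T (literals v (prime_parts \<phi>)) \<phi>"
    using kalmar[of v \<phi>, OF order_refl] assms[of v] by simp
qed simp

lemma taut1: "T \<turnstile> \<phi>1 \<Longrightarrow> (\<And>v. fm_peval v \<phi>1 \<Longrightarrow> fm_peval v \<psi>) \<Longrightarrow> T \<turnstile> \<psi>"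
  by (rule proves.mp[OF taut_proves[of "Imp \<phi>1 \<psi>"]]) auto

lemma taut2:
  "T \<turnstile> \<phi>1 \<Longrightarrow> T \<turnstile> \<phi>2 \<Longrightarrow> (\<And>v. fm_peval v \<phi>1 \<Longrightarrow> fm_peval v \<phi>2 \<Longrightarrow> fm_peval v \<psi>) \<Longrightarrow> T \<turnstile> \<psi>"
  by (rule proves.mp[OF taut1[of T \<phi>1 "Imp \<phi>2 \<psi>"]]) auto

lemma taut3:
  "T \<turnstile> \<phi>1 \<Longrightarrow> T \<turnstile> \<phi>2 \<Longrightarrow> T \<turnstile> \<phi>3 \<Longrightarrow>
    (\<And>v. fm_peval v \<phi>1 \<Longrightarrow> fm_peval v \<phi>2 \<Longrightarrow> fm_peval v \<phi>3 \<Longrightarrow> fm_peval v \<psi>) \<Longrightarrow> T \<turnstile> \<psi>"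
  by (rule proves.mp[OF taut2[of T \<phi>1 \<phi>2 "Imp \<phi>3 \<psi>"]]) auto

lemma taut4:
  "T \<turnstile> \<phi>1 \<Longrightarrow> T \<turnstile> \<phi>2 \<Longrightarrow> T \<turnstile> \<phi>3 \<Longrightarrow> T \<turnstile> \<phi>4 \<Longrightarrow>
    (\<And>v. fm_peval v \<phi>1 \<Longrightarrow> fm_peval v \<phi>2 \<Longrightarrow> fm_peval v \<phi>3 \<Longrightarrow> fm_peval v \<phi>4 \<Longrightarrow> fm_peval v \<psi>) \<Longrightarrow> T \<turnstile> \<psi>"
  by (rule proves.mp[OF taut3[of T \<phi>1 \<phi>2 \<phi>3 "Imp \<phi>4 \<psi>"]]) auto

section \<open>Completeness of extensions of PA for true \<open>\<Sigma>\<^sub>1\<close> formulas\<close>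

lemma proves_inst: "T \<turnstile> \<phi> \<Longrightarrow> substitutable x t \<phi> \<Longrightarrow> T \<turnstile> subst x t \<phi>"
  by (rule proves.mp[OF proves.all1 proves.gen])

lemma proves_gen_imp: "T \<turnstile> Imp G \<phi> \<Longrightarrow> x \<notin> fv G \<Longrightarrow> T \<turnstile> Imp G (All x \<phi>)"
  by (rule proves.mp[OF proves.all2 proves.gen])

lemma proves_all_elim: "T \<turnstile> Imp (All x \<phi>) \<phi>"
  using proves.all1[of x "Var x" \<phi> T] by (simp add: subst_Var substitutable_self)

lemma proves_ex_intro: "T \<turnstile> Imp \<phi> (Ex x \<phi>)"
  using proves.ex1[of x "Var x" \<phi> T] by (simp add: subst_Var substitutable_self)

lemma proves_neg_ex:
  assumes "T \<turnstile> Imp G (Neg \<phi>)" "x \<notin> fv G"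
  shows "T \<turnstile> Imp G (Neg (Ex x \<phi>))"
proof -
  have "T \<turnstile> Imp \<phi> (Neg G)" using assms(1) by (rule taut1) auto
  then have "T \<turnstile> Imp (Ex x \<phi>) (Neg G)"
    using proves.mp[OF proves.ex2 proves.gen, of x "Neg G" T \<phi>] assms(2) by simp
  then show ?thesis by (rule taut1) auto
qed

section \<open>Equality and congruence in the calculus\<close>

lemma finite_fv_tm [simp]: "finite (fv_tm t)"
  by (induction t) auto

text \<open>A fresh variable marks the one position at which the replacement axiom
  \<open>eq2\<close> acts; other occurrences of the same term stay untouched.\<close>

lemma fresh_tm: obtains x where "x \<notin> fv_tm s" "x \<notin> fv_tm t"
proof -
  have "finite (fv_tm s \<union> fv_tm t)" by simp
  from ex_new_if_finite[OF _ this] obtain x where "x \<notin> fv_tm s \<union> fv_tm t" by auto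
  then show ?thesis using that by auto
qed

lemma eq_sym: "T \<turnstile> Imp (Eq s t) (Eq t s)"
proof -
  obtain x where x: "x \<notin> fv_tm s" by (rule fresh_tm[of s s])
  have "T \<turnstile> Imp (Eq s t) (Imp (Eq s s) (Eq t s))"
    using proves.eq2[of x s "Eq (Var x) s" t T] x by (simp add: subst_tm_id)
  then show ?thesis using proves.eq1[of T s] by (rule taut2) auto
qed

lemma eq_trans: "T \<turnstile> Imp (Eq s t) (Imp (Eq t u) (Eq s u))"
proof -
  obtain x where x: "x \<notin> fv_tm u" by (rule fresh_tm[of u u])
  have "T \<turnstile> Imp (Eq t s) (Imp (Eq t u) (Eq s u))"
    using proves.eq2[of x t "Eq (Var x) u" s T] x by (simp add: subst_tm_id)
  then show ?thesis using eq_sym[of T s t] by (rule taut2) auto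
qed

lemma eq_Succ: "T \<turnstile> Imp (Eq s t) (Eq (Succ s) (Succ t))"
proof -
  obtain x where x: "x \<notin> fv_tm s" by (rule fresh_tm[of s s])
  have "T \<turnstile> Imp (Eq s t) (Imp (Eq (Succ s) (Succ s)) (Eq (Succ s) (Succ t)))"
    using proves.eq2[of x s "Eq (Succ s) (Succ (Var x))" t T] x by (simp add: subst_tm_id)
  then show ?thesis using proves.eq1[of T "Succ s"] by (rule taut2) auto
qed

lemma eq_Add: "T \<turnstile> Imp (Eq s s') (Imp (Eq t t') (Eq (Add s t) (Add s' t')))"
proof -
  obtain x where x: "x \<notin> fv_tm s" "x \<notin> fv_tm t" by (rule fresh_tm[of s t])
  have 1: "T \<turnstile> Imp (Eq s s') (Imp (Eq (Add s t) (Add s t)) (Eq (Add s t) (Add s' t)))"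
    using proves.eq2[of x s "Eq (Add s t) (Add (Var x) t)" s' T] x by (simp add: subst_tm_id)
  obtain y where y: "y \<notin> fv_tm s'" "y \<notin> fv_tm (Add s t)" by (rule fresh_tm[of s' "Add s t"])
  have "T \<turnstile> Imp (Eq t t') (Imp (Eq (Add s t) (Add s' t)) (Eq (Add s t) (Add s' t')))"
    using proves.eq2[of y t "Eq (Add s t) (Add s' (Var y))" t' T] y by (simp add: subst_tm_id)
  from this 1 proves.eq1[of T "Add s t"] show ?thesis by (rule taut3) auto
qed

lemma eq_Mult: "T \<turnstile> Imp (Eq s s') (Imp (Eq t t') (Eq (Mult s t) (Mult s' t')))"
proof -
  obtain x where x: "x \<notin> fv_tm s" "x \<notin> fv_tm t" by (rule fresh_tm[of s t])
  have 1: "T \<turnstile> Imp (Eq s s') (Imp (Eq (Mult s t) (Mult s t)) (Eq (Mult s t) (Mult s' t)))"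
    using proves.eq2[of x s "Eq (Mult s t) (Mult (Var x) t)" s' T] x by (simp add: subst_tm_id)
  obtain y where y: "y \<notin> fv_tm s'" "y \<notin> fv_tm (Mult s t)" by (rule fresh_tm[of s' "Mult s t"])
  have "T \<turnstile> Imp (Eq t t') (Imp (Eq (Mult s t) (Mult s' t)) (Eq (Mult s t) (Mult s' t')))"
    using proves.eq2[of y t "Eq (Mult s t) (Mult s' (Var y))" t' T] y by (simp add: subst_tm_id)
  from this 1 proves.eq1[of T "Mult s t"] show ?thesis by (rule taut3) auto
qed

lemma eq_Lt: "T \<turnstile> Imp (Eq s s') (Imp (Eq t t') (Imp (Lt s t) (Lt s' t')))"
proof -
  obtain x where x: "x \<notin> fv_tm t" by (rule fresh_tm[of t t])
  have 1: "T \<turnstile> Imp (Eq s s') (Imp (Lt s t) (Lt s' t))"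
    using proves.eq2[of x s "Lt (Var x) t" s' T] x by (simp add: subst_tm_id)
  obtain y where y: "y \<notin> fv_tm s'" by (rule fresh_tm[of s' s'])
  have "T \<turnstile> Imp (Eq t t') (Imp (Lt s' t) (Lt s' t'))"
    using proves.eq2[of y t "Lt s' (Var y)" t' T] y by (simp add: subst_tm_id)
  from this 1 show ?thesis by (rule taut2) auto
qed

text \<open>Instantiating \<open>x\<close> by the numeral turns the antecedent into an instance of
  reflexivity. Values are passed around as such equations and discharged in this way.\<close>

lemma proves_inst_eq:
  assumes "T \<turnstile> Imp (Eq (Var x) (num n)) \<phi>"
  shows "T \<turnstile> subst x (num n) \<phi>"
  using proves_inst[OF assms, of x "num n"] proves.mp proves.eq1 by auto

lemma proves_elim_eq:
  assumes "T \<turnstile> Imp (Eq (Var x) (num n)) \<phi>" "x \<notin> fv \<phi>"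
  shows "T \<turnstile> \<phi>"
  using proves_inst_eq[OF assms(1)] assms(2) by (simp add: subst_id)

section \<open>Arithmetic of numerals in extensions of PA\<close>

locale arith =
  fixes T :: "fm set"
  assumes ext: "extends T PA"
begin

lemma PA_axiom: "\<phi> \<in> PA \<Longrightarrow> T \<turnstile> \<phi>"
  using ext proves.ax unfolding extends_def by blast

lemma Add_num: "T \<turnstile> Eq (Add (num m) (num n)) (num (m + n))"
proof (induction n)
  case 0
  show ?case using proves_inst[OF PA_axiom[OF PA.intros(3)], of 0 "num m"] by simp
next
  case (Suc n)
  have "T \<turnstile> Eq (Add (num m) (Succ (num n))) (Succ (Add (num m) (num n)))"
    using proves_inst[OF proves_inst[OF PA_axiom[OF PA.intros(4)], of 0 "num m"], of 1 "num n"]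
    by simp
  moreover have "T \<turnstile> Eq (Succ (Add (num m) (num n))) (Succ (num (m + n)))"
    by (rule proves.mp[OF eq_Succ Suc])
  ultimately show ?case using proves.mp[OF proves.mp[OF eq_trans]] by fastforce
qed

lemma Mult_num: "T \<turnstile> Eq (Mult (num m) (num n)) (num (m * n))"
proof (induction n)
  case 0
  show ?case using proves_inst[OF PA_axiom[OF PA.intros(5)], of 0 "num m"] by simp
next
  case (Suc n)
  have 1: "T \<turnstile> Eq (Mult (num m) (Succ (num n))) (Add (Mult (num m) (num n)) (num m))"
    using proves_inst[OF proves_inst[OF PA_axiom[OF PA.intros(6)], of 0 "num m"], of 1 "num n"]
    by simp
  have 2: "T \<turnstile> Eq (Add (Mult (num m) (num n)) (num m)) (Add (num (m * n)) (num m))"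
    by (rule proves.mp[OF proves.mp[OF eq_Add Suc] proves.eq1])
  have 3: "T \<turnstile> Eq (Add (Mult (num m) (num n)) (num m)) (num (m * n + m))"
    by (rule proves.mp[OF proves.mp[OF eq_trans 2] Add_num])
  have "T \<turnstile> Eq (Mult (num m) (Succ (num n))) (num (m * n + m))"
    by (rule proves.mp[OF proves.mp[OF eq_trans 1] 3])
  then show ?case by (simp add: add.commute)
qed

lemma num_neq: "m \<noteq> n \<Longrightarrow> T \<turnstile> Neg (Eq (num m) (num n))"
proof (induction m arbitrary: n)
  case 0
  then obtain k where n: "n = Suc k" by (cases n) auto
  have "T \<turnstile> Neg (Eq (num (Suc k)) (num 0))"
    using proves_inst[OF PA_axiom[OF PA.intros(1)], of 0 "num k"] by simp
  from this eq_sym[of T "num 0" "num (Suc k)"] show ?case unfolding n by (rule taut2) auto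
next
  case (Suc m)
  show ?case
  proof (cases n)
    case 0
    then show ?thesis using proves_inst[OF PA_axiom[OF PA.intros(1)], of 0 "num m"] by simp
  next
    case (Suc k)
    have "T \<turnstile> Imp (Eq (num (Suc m)) (num (Suc k))) (Eq (num m) (num k))"
      using proves_inst[OF proves_inst[OF PA_axiom[OF PA.intros(2)], of 0 "num m"], of 1 "num k"]
      by simp
    moreover have "T \<turnstile> Neg (Eq (num m) (num k))" using Suc.IH[of k] Suc.prems Suc by simp
    ultimately show ?thesis unfolding Suc by (rule taut2) auto
  qed
qed

lemma Lt_0: "T \<turnstile> Neg (Lt s (num 0))"
  using proves_inst[OF PA_axiom[OF PA.intros(7)], of 0 s] by simp

lemma Lt_Suc1: "T \<turnstile> Imp (Lt s (num (Suc n))) (Or (Lt s (num n)) (Eq s (num n)))"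
  using proves_inst[OF proves_inst[OF PA_axiom[OF PA.intros(8)], of 1 "num n"], of 0 s] by simp

lemma Lt_Suc2: "T \<turnstile> Imp (Or (Lt s (num n)) (Eq s (num n))) (Lt s (num (Suc n)))"
  using proves_inst[OF proves_inst[OF PA_axiom[OF PA.intros(9)], of 1 "num n"], of 0 s] by simp

lemma Lt_Succ_Var: "T \<turnstile> Imp (Lt (num n) (Var x)) (Lt (num n) (Succ (Var x)))"
proof -
  have "T \<turnstile> Imp (Or (Lt (num n) (Var x)) (Eq (num n) (Var x))) (Lt (num n) (Succ (Var x)))"
    using proves_inst[OF proves_inst[OF PA_axiom[OF PA.intros(9)], of 0 "num n"], of 1 "Var x"]
    by simp
  then show ?thesis by (rule taut1) auto
qed

lemma num_Lt: "if m < n then T \<turnstile> Lt (num m) (num n) else T \<turnstile> Neg (Lt (num m) (num n))"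
proof (induction n)
  case 0
  then show ?case using Lt_0[of "num m"] by simp
next
  case (Suc n)
  consider "m < n" | "m = n" | "n < m" by linarith
  then show ?case
  proof cases
    case 1
    then have "T \<turnstile> Lt (num m) (num n)" using Suc by simp
    from this Lt_Suc2[of "num m" n] have "T \<turnstile> Lt (num m) (num (Suc n))" by (rule taut2) auto
    with 1 show ?thesis by simp
  next
    case 2
    from proves.eq1[of T "num m"] Lt_Suc2[of "num m" m]
    have "T \<turnstile> Lt (num m) (num (Suc m))" by (rule taut2) auto
    with 2 show ?thesis by simp
  next
    case 3
    then have "T \<turnstile> Neg (Lt (num m) (num n))" using Suc by simp
    moreover have "T \<turnstile> Neg (Eq (num m) (num n))" using 3 by (simp add: num_neq)
    ultimately have "T \<turnstile> Neg (Lt (num m) (num (Suc n)))"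
      using Lt_Suc1[of "num m" n] by (rule taut3) auto
    with 3 show ?thesis by simp
  qed
qed

text \<open>Induction on \<open>n\<close> outside the calculus: each step splits off the largest
  value by the axiom for comparison with a successor.\<close>

lemma bounded_cases:
  "(\<And>i. i < n \<Longrightarrow> T \<turnstile> Imp (Eq (Var x) (num i)) \<phi>) \<Longrightarrow> T \<turnstile> Imp (Lt (Var x) (num n)) \<phi>"
proof (induction n)
  case 0
  from Lt_0[of "Var x"] show ?case by (rule taut1) auto
next
  case (Suc n)
  from Lt_Suc1[of "Var x" n] Suc.IH[OF Suc.prems[OF less_SucI]] Suc.prems[OF lessI]
  show ?case by (rule taut3) auto
qed

text \<open>The one place where the induction scheme is applied inside the calculus. It handles an
  \<open>x\<close> of unknown, possibly nonstandard, size: either \<open>x\<close> is one of the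
  numerals up to \<open>n\<close>, or it lies above \<open>n\<close>.\<close>

lemma dichotomy: "T \<turnstile> Or (Lt (Var x) (num (Suc n))) (Lt (num n) (Var x))" (is "T \<turnstile> ?D")
proof -
  let ?D' = "Or (Lt (Succ (Var x)) (num (Suc n))) (Lt (num n) (Succ (Var x)))"
  have sub: "subst x (Succ (Var x)) ?D = ?D'"
    "subst x Zero ?D = Or (Lt (num 0) (num (Suc n))) (Lt (num n) (num 0))"
    by simp_all
  have "T \<turnstile> Lt (num 0) (num (Suc n))" using num_Lt[of 0 "Suc n"] by simp
  then have base: "T \<turnstile> subst x Zero ?D" unfolding sub by (rule taut1) auto
  \<comment> \<open>Induction step for the left disjunct: \<open>x\<close> is a concrete numeral
    \<open>i\<close>, whose successor stays within the bound unless \<open>i = n\<close>, and then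
    it lies above \<open>n\<close>. The right disjunct is preserved by
    \<open>Lt_Succ_Var\<close>.\<close>
  have "T \<turnstile> Imp (Eq (Var x) (num i)) ?D'" if "i < Suc n" for i
  proof -
    have 1: "T \<turnstile> Imp (Eq (num i) (Var x)) (Imp (subst x (num i) ?D') ?D')"
      using proves.eq2[of x "num i" ?D' "Var x" T] by simp
    have "T \<turnstile> subst x (num i) ?D'"
    proof (cases "i = n")
      case True
      then have "T \<turnstile> Lt (num n) (num (Suc i))" using num_Lt[of n "Suc i"] by simp
      then show ?thesis by (rule taut1) auto
    next
      case False
      then have "T \<turnstile> Lt (num (Suc i)) (num (Suc n))" using num_Lt[of "Suc i" "Suc n"] that by simp
      then show ?thesis by (rule taut1) auto
    qed
    from this 1 eq_sym[of T "Var x" "num i"] show ?thesis by (rule taut3) auto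
  qed
  then have "T \<turnstile> Imp (Lt (Var x) (num (Suc n))) ?D'" by (rule bounded_cases)
  from this Lt_Succ_Var[of n x] have "T \<turnstile> Imp ?D ?D'" by (rule taut2) auto
  then have "T \<turnstile> All x (Imp ?D (subst x (Succ (Var x)) ?D))"
    unfolding sub by (rule proves.gen)
  from base this PA_axiom[OF PA.intros(10)[of x ?D]] have "T \<turnstile> All x ?D"
    by (rule taut3) auto
  then show ?thesis by (rule proves.mp[OF proves_all_elim])
qed

end

text \<open>The environment is stated by equations instead of being substituted, which avoids
  simultaneous substitution; the trivial equation stands for the empty conjunction.\<close>

fun hyps :: "(nat \<Rightarrow> nat) \<Rightarrow> nat list \<Rightarrow> fm" where
  "hyps e [] = Eq Zero Zero"
| "hyps e (x # V) = And (Eq (Var x) (num (e x))) (hyps e V)"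

lemma fv_hyps [simp]: "fv (hyps e V) = set V"
  by (induction V) auto

lemma hyps_cong: "(\<And>x. x \<in> set V \<Longrightarrow> e x = e' x) \<Longrightarrow> hyps e V = hyps e' V"
  by (induction V) auto

lemma hyps_mem: "x \<in> set V \<Longrightarrow> T \<turnstile> Imp (hyps e V) (Eq (Var x) (num (e x)))"
proof (induction V)
  case (Cons y V)
  show ?case
  proof (cases "x = y")
    case True
    show ?thesis unfolding True by (rule taut_proves) auto
  next
    case False
    then have "T \<turnstile> Imp (hyps e V) (Eq (Var x) (num (e x)))" using Cons by auto
    then show ?thesis by (rule taut1) auto
  qed
qed simp

lemma hyps_intro:
  "(\<And>x. x \<in> set V \<Longrightarrow> T \<turnstile> Imp G (Eq (Var x) (num (e x)))) \<Longrightarrow> T \<turnstile> Imp G (hyps e V)"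
proof (induction V)
  case Nil
  from proves.eq1[of T Zero] show ?case by (rule taut1) auto
next
  case (Cons y V)
  then have "T \<turnstile> Imp G (Eq (Var y) (num (e y)))" "T \<turnstile> Imp G (hyps e V)" by simp_all
  then show ?case by (rule taut2) auto
qed

lemma hyps_mono: "set V' \<subseteq> set V \<Longrightarrow> T \<turnstile> Imp (hyps e V) (hyps e V')"
  by (rule hyps_intro) (auto intro: hyps_mem)

lemma hyps_upd:
  assumes "x \<notin> set V"
  shows "hyps (e(x := i)) (x # V) = And (Eq (Var x) (num i)) (hyps e V)"
proof -
  have "hyps (e(x := i)) V = hyps e V" by (rule hyps_cong) (use assms in auto)
  then show ?thesis by simp
qed

section \<open>Deciding \<Delta>0 formulas and proving true \<Sigma>1 formulas\<close>

context arith
begin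

lemma eval_complete:
  "fv_tm t \<subseteq> set V \<Longrightarrow> T \<turnstile> Imp (hyps e V) (Eq t (num (eval_tm e t)))"
proof (induction t)
  case (Var x)
  then show ?case by (simp add: hyps_mem)
next
  case Zero
  from proves.eq1[of T Zero] show ?case by (rule taut1) auto
next
  case (Succ t)
  then have "T \<turnstile> Imp (hyps e V) (Eq t (num (eval_tm e t)))" by simp
  from this eq_Succ[of T t "num (eval_tm e t)"] show ?case by (rule taut2) auto
next
  case (Add s t)
  let ?m = "eval_tm e s" and ?n = "eval_tm e t"
  have "T \<turnstile> Imp (hyps e V) (Eq s (num ?m))" "T \<turnstile> Imp (hyps e V) (Eq t (num ?n))"
    using Add by simp_all
  from this eq_Add[of T s "num ?m" t "num ?n"]
  have "T \<turnstile> Imp (hyps e V) (Eq (Add s t) (Add (num ?m) (num ?n)))" by (rule taut3) auto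
  from this Add_num[of ?m ?n] eq_trans[of T "Add s t" "Add (num ?m) (num ?n)" "num (?m + ?n)"]
  show ?case by (rule taut3) auto
next
  case (Mult s t)
  let ?m = "eval_tm e s" and ?n = "eval_tm e t"
  have "T \<turnstile> Imp (hyps e V) (Eq s (num ?m))" "T \<turnstile> Imp (hyps e V) (Eq t (num ?n))"
    using Mult by simp_all
  from this eq_Mult[of T s "num ?m" t "num ?n"]
  have "T \<turnstile> Imp (hyps e V) (Eq (Mult s t) (Mult (num ?m) (num ?n)))" by (rule taut3) auto
  from this Mult_num[of ?m ?n] eq_trans[of T "Mult s t" "Mult (num ?m) (num ?n)" "num (?m * ?n)"]
  show ?case by (rule taut3) auto
qed

abbreviation decides :: "(nat \<Rightarrow> nat) \<Rightarrow> nat list \<Rightarrow> fm \<Rightarrow> bool" where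
  "decides e V \<phi> \<equiv> T \<turnstile> Imp (hyps e V) (if sat e \<phi> then \<phi> else Neg \<phi>)"

lemma decides_Eq: assumes "fv (Eq s t) \<subseteq> set V" shows "decides e V (Eq s t)"
proof -
  let ?m = "eval_tm e s" and ?n = "eval_tm e t"
  have st: "T \<turnstile> Imp (hyps e V) (Eq s (num ?m))" "T \<turnstile> Imp (hyps e V) (Eq t (num ?n))"
    using assms by (simp_all add: eval_complete)
  show ?thesis
  proof (cases "?m = ?n")
    case True
    from st eq_sym[of T t "num ?n"] eq_trans[of T s "num ?n" t]
    have "T \<turnstile> Imp (hyps e V) (Eq s t)" unfolding True by (rule taut4) auto
    with True show ?thesis by simp
  next
    case False
    have "T \<turnstile> Imp (Eq s (num ?m)) (Imp (Eq s t) (Eq (num ?m) t))"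
      by (rule taut2[OF eq_sym[of T s "num ?m"] eq_trans[of T "num ?m" s t]]) auto
    from this eq_trans[of T "num ?m" t "num ?n"]
    have "T \<turnstile> Imp (Eq s (num ?m)) (Imp (Eq t (num ?n)) (Imp (Eq s t) (Eq (num ?m) (num ?n))))"
      by (rule taut2) auto
    from st this num_neq[OF False]
    have "T \<turnstile> Imp (hyps e V) (Neg (Eq s t))" by (rule taut4) auto
    with False show ?thesis by simp
  qed
qed

lemma decides_Lt: assumes "fv (Lt s t) \<subseteq> set V" shows "decides e V (Lt s t)"
proof -
  let ?m = "eval_tm e s" and ?n = "eval_tm e t"
  have st: "T \<turnstile> Imp (hyps e V) (Eq s (num ?m))" "T \<turnstile> Imp (hyps e V) (Eq t (num ?n))"
    using assms by (simp_all add: eval_complete)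
  have st': "T \<turnstile> Imp (hyps e V) (Eq (num ?m) s)" "T \<turnstile> Imp (hyps e V) (Eq (num ?n) t)"
    by (rule taut2[OF st(1) eq_sym[of T s "num ?m"]], force)
      (rule taut2[OF st(2) eq_sym[of T t "num ?n"]], force)
  show ?thesis
  proof (cases "?m < ?n")
    case True
    then have "T \<turnstile> Lt (num ?m) (num ?n)" using num_Lt[of ?m ?n] by simp
    from st' this eq_Lt[of T "num ?m" s "num ?n" t]
    have "T \<turnstile> Imp (hyps e V) (Lt s t)" by (rule taut4) auto
    with True show ?thesis by simp
  next
    case False
    then have "T \<turnstile> Neg (Lt (num ?m) (num ?n))" using num_Lt[of ?m ?n] by simp
    from st this eq_Lt[of T s "num ?m" t "num ?n"]
    have "T \<turnstile> Imp (hyps e V) (Neg (Lt s t))" by (rule taut4) auto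
    with False show ?thesis by simp
  qed
qed

text \<open>Under the hypotheses the bound \<open>t\<close> has a numeral value, so the quantifier
  ranges over finitely many values. A true universal or a false existential collects all of them,
  the other two cases need one witness.\<close>

lemma decides_bounded:
  assumes IH: "\<And>e V. fv \<phi> \<subseteq> set V \<Longrightarrow> decides e V \<phi>"
    and t: "x \<notin> fv_tm t" "fv_tm t \<subseteq> set V" and \<phi>: "fv \<phi> \<subseteq> insert x (set V)"
  shows "decides e V (All x (Imp (Lt (Var x) t) \<phi>))" (is "decides e V ?A")
    and "decides e V (Ex x (And (Lt (Var x) t) \<phi>))" (is "decides e V ?E")
proof -
  \<comment> \<open>The quantifier hides whatever value \<open>V\<close> records for
    \<open>x\<close>; that value is dropped before \<open>x\<close> is given the value
    \<open>i\<close>.\<close>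
  define W where "W = filter (\<lambda>y. y \<noteq> x) V"
  have W: "x \<notin> set W" "fv_tm t \<subseteq> set W" "fv \<phi> \<subseteq> set (x # W)" "set W \<subseteq> set V"
    using t \<phi> by (auto simp: W_def)
  let ?G = "hyps e W" and ?n = "eval_tm e t"
  have VG: "T \<turnstile> Imp (hyps e V) ?G" using W by (simp add: hyps_mono)
  have n: "eval_tm (e(x := i)) t = ?n" for i
    by (rule eval_tm_cong) (use t in auto)
  have dec: "T \<turnstile> Imp (Eq (Var x) (num i)) (Imp ?G (if sat (e(x := i)) \<phi> then \<phi> else Neg \<phi>))" for i
  proof -
    have "decides (e(x := i)) (x # W) \<phi>" using W by (intro IH)
    then show ?thesis unfolding hyps_upd[OF W(1)] by (rule taut1) auto
  qed
  have lt: "T \<turnstile> Imp (Eq (Var x) (num i)) (Imp ?G (Lt (Var x) t))" if "i < ?n" for i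
  proof -
    have "decides (e(x := i)) (x # W) (Lt (Var x) t)" using W by (intro decides_Lt) auto
    then have "T \<turnstile> Imp (hyps (e(x := i)) (x # W)) (Lt (Var x) t)" using that n by simp
    then show ?thesis unfolding hyps_upd[OF W(1)] by (rule taut1) auto
  qed
  have all: "T \<turnstile> Imp ?G (Imp (Lt (Var x) t) \<psi>)"
    if "\<And>i. i < ?n \<Longrightarrow> T \<turnstile> Imp (Eq (Var x) (num i)) (Imp ?G \<psi>)" for \<psi>
  proof -
    have 1: "T \<turnstile> Imp (Lt (Var x) (num ?n)) (Imp ?G \<psi>)" using that by (rule bounded_cases)
    have 2: "T \<turnstile> Imp (Eq t (num ?n)) (Imp (Lt (Var x) t) (Lt (Var x) (num ?n)))"
      by (rule taut2[OF eq_Lt[of T "Var x" "Var x" t "num ?n"] proves.eq1[of T "Var x"]]) auto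
    show ?thesis by (rule taut3[OF 1 2 eval_complete[OF W(2), of e]]) auto
  qed
  show "decides e V ?A"
  proof (cases "sat e ?A")
    case True
    then have "T \<turnstile> Imp (Eq (Var x) (num i)) (Imp ?G \<phi>)" if "i < ?n" for i
      using dec[of i] that n by auto
    then have "T \<turnstile> Imp ?G (Imp (Lt (Var x) t) \<phi>)" by (rule all)
    then have "T \<turnstile> Imp ?G ?A" by (rule proves_gen_imp) (simp add: W)
    from VG this have "T \<turnstile> Imp (hyps e V) ?A" by (rule taut2) auto
    with True show ?thesis by simp
  next
    case False
    then obtain i where i: "i < ?n" "\<not> sat (e(x := i)) \<phi>" using n by auto
    have "T \<turnstile> Imp (Eq (Var x) (num i)) (Imp ?G (Neg \<phi>))" using dec[of i] i by simp
    from this lt[OF i(1)] proves_all_elim[of T x "Imp (Lt (Var x) t) \<phi>"]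
    have "T \<turnstile> Imp (Eq (Var x) (num i)) (Imp ?G (Neg ?A))" by (rule taut3) auto
    then have "T \<turnstile> Imp ?G (Neg ?A)" by (rule proves_elim_eq) (use W in auto)
    from VG this have "T \<turnstile> Imp (hyps e V) (Neg ?A)" by (rule taut2) auto
    with False show ?thesis by (simp only: if_False)
  qed
  show "decides e V ?E"
  proof (cases "sat e ?E")
    case True
    then obtain i where i: "i < ?n" "sat (e(x := i)) \<phi>" using n by auto
    have "T \<turnstile> Imp (Eq (Var x) (num i)) (Imp ?G \<phi>)" using dec[of i] i by simp
    from this lt[OF i(1)] proves_ex_intro[of T "And (Lt (Var x) t) \<phi>" x]
    have "T \<turnstile> Imp (Eq (Var x) (num i)) (Imp ?G ?E)" by (rule taut3) auto
    then have "T \<turnstile> Imp ?G ?E" by (rule proves_elim_eq) (use W in auto)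
    from VG this have "T \<turnstile> Imp (hyps e V) ?E" by (rule taut2) auto
    with True show ?thesis by (simp only: if_True)
  next
    case False
    then have "T \<turnstile> Imp (Eq (Var x) (num i)) (Imp ?G (Neg \<phi>))" if "i < ?n" for i
      using dec[of i] that n by auto
    then have "T \<turnstile> Imp ?G (Imp (Lt (Var x) t) (Neg \<phi>))" by (rule all)
    then have "T \<turnstile> Imp ?G (Neg (And (Lt (Var x) t) \<phi>))" by (rule taut1) auto
    then have "T \<turnstile> Imp ?G (Neg ?E)" by (rule proves_neg_ex) (simp add: W)
    from VG this have "T \<turnstile> Imp (hyps e V) (Neg ?E)" by (rule taut2) auto
    with False show ?thesis by (simp only: if_False)
  qed
qed

lemma Delta0_decides: "Delta0 \<phi> \<Longrightarrow> fv \<phi> \<subseteq> set V \<Longrightarrow> decides e V \<phi>"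
proof (induction arbitrary: e V rule: Delta0.induct)
  case (1 s t)
  then show ?case by (rule decides_Eq)
next
  case (2 s t)
  then show ?case by (rule decides_Lt)
next
  case (3 \<phi>)
  then have "decides e V \<phi>" by simp
  then show ?case by (rule taut1) auto
next
  case (4 \<phi> \<psi>)
  then have "decides e V \<phi>" "decides e V \<psi>" by simp_all
  then show ?case by (rule taut2) auto
next
  case (5 \<phi> \<psi>)
  then have "decides e V \<phi>" "decides e V \<psi>" by simp_all
  then show ?case by (rule taut2) auto
next
  case (6 \<phi> \<psi>)
  then have "decides e V \<phi>" "decides e V \<psi>" by simp_all
  then show ?case by (rule taut2) auto
next
  case (7 \<phi> x t)
  show ?case by (rule decides_bounded(1)[OF 7(3)]) (use 7 in auto)
next
  case (8 \<phi> x t)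
  show ?case by (rule decides_bounded(2)[OF 8(3)]) (use 8 in auto)
qed

text \<open>A witness \<open>i\<close> of a true existential enters as the hypothesis that
  \<open>x\<close> equals its numeral, and this equation is then eliminated by
  instantiation.\<close>

theorem Sigma1_complete:
  "Sigma1 \<phi> \<Longrightarrow> fv \<phi> \<subseteq> set V \<Longrightarrow> sat e \<phi> \<Longrightarrow> T \<turnstile> Imp (hyps e V) \<phi>"
proof (induction arbitrary: e V rule: Sigma1.induct)
  case (1 \<phi>)
  then show ?case using Delta0_decides[of \<phi> V e] by simp
next
  case (2 \<phi> x)
  then obtain i where i: "sat (e(x := i)) \<phi>" by auto
  define W where "W = filter (\<lambda>y. y \<noteq> x) V"
  have W: "x \<notin> set W" "fv \<phi> \<subseteq> set (x # W)" "set W \<subseteq> set V"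
    using 2 by (auto simp: W_def)
  have "T \<turnstile> Imp (hyps (e(x := i)) (x # W)) \<phi>" using 2(2)[OF W(2) i] .
  from this proves_ex_intro[of T \<phi> x]
  have "T \<turnstile> Imp (Eq (Var x) (num i)) (Imp (hyps e W) (Ex x \<phi>))"
    unfolding hyps_upd[OF W(1)] by (rule taut2) auto
  then have "T \<turnstile> Imp (hyps e W) (Ex x \<phi>)" by (rule proves_elim_eq) (use W in auto)
  from this hyps_mono[OF W(3), of T e] show ?case by (rule taut2) auto
qed

end

section \<open>\<open>\<Sigma>\<^sub>1\<close>-definable relations\<close>

text \<open>Definable relations are predicates on environments with de Bruijn indices: a quantifier pushes
  its value by \<open>case_nat\<close>, so that the closure rules compose by unification without any bookkeeping
  of fresh variables.\<close>

inductive poly :: "((nat \<Rightarrow> nat) \<Rightarrow> nat) \<Rightarrow> bool" where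
  poly_var: "poly (\<lambda>e. e i)"
| poly_zero: "poly (\<lambda>e. 0)"
| poly_Suc: "poly t \<Longrightarrow> poly (\<lambda>e. Suc (t e))"
| poly_add: "poly s \<Longrightarrow> poly t \<Longrightarrow> poly (\<lambda>e. s e + t e)"
| poly_mult: "poly s \<Longrightarrow> poly t \<Longrightarrow> poly (\<lambda>e. s e * t e)"

inductive delta0 :: "((nat \<Rightarrow> nat) \<Rightarrow> bool) \<Rightarrow> bool" where
  delta0_eq: "poly s \<Longrightarrow> poly t \<Longrightarrow> delta0 (\<lambda>e. s e = t e)"
| delta0_less: "poly s \<Longrightarrow> poly t \<Longrightarrow> delta0 (\<lambda>e. s e < t e)"
| delta0_not: "delta0 R \<Longrightarrow> delta0 (\<lambda>e. \<not> R e)"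
| delta0_and: "delta0 R \<Longrightarrow> delta0 S \<Longrightarrow> delta0 (\<lambda>e. R e \<and> S e)"
| delta0_bex0: "delta0 R \<Longrightarrow> poly t \<Longrightarrow> delta0 (\<lambda>e. \<exists>x<t e. R (case_nat x e))"

lemma case_nat_eta [simp]: "case_nat (e 0) (\<lambda>i. e (Suc i)) = (e :: nat \<Rightarrow> 'a)"
  by (rule ext) (simp split: nat.split)

lemma poly_const: "poly (\<lambda>e. c)"
  by (induction c) (auto intro: poly.intros)

lemma poly_subst:
  assumes "poly t" "\<And>i. poly (\<sigma> i)"
  shows "poly (\<lambda>e. t (\<lambda>i. \<sigma> i e))"
  using assms(1) by induction (auto intro: poly.intros assms(2))

lemma delta0_subst:
  assumes "delta0 R" "\<And>i. poly (\<sigma> i)"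
  shows "delta0 (\<lambda>e. R (\<lambda>i. \<sigma> i e))"
  using assms
proof (induction arbitrary: \<sigma>)
  case (delta0_bex0 R t)
  \<comment> \<open>The substitution lifted under the quantifier: index 0 is the bound value and
    stays, the other indices see the environment without it.\<close>
  define \<tau> where "\<tau> = case_nat (\<lambda>e :: nat \<Rightarrow> nat. e 0) (\<lambda>i e. \<sigma> i (\<lambda>j. e (Suc j)))"
  have "poly (\<tau> i)" for i
    unfolding \<tau>_def using delta0_bex0.prems
    by (cases i) (auto intro: poly_var poly_subst[where \<sigma> = "\<lambda>j e. e (Suc j)"])
  then have "delta0 (\<lambda>e. R (\<lambda>i. \<tau> i e))" by (rule delta0_bex0.IH)
  from delta0.delta0_bex0[OF this poly_subst[OF delta0_bex0.hyps(2) delta0_bex0.prems]]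
  have "delta0 (\<lambda>e. \<exists>x<t (\<lambda>i. \<sigma> i e). R (\<lambda>i. \<tau> i (case_nat x e)))" .
  moreover have "(\<lambda>i. \<tau> i (case_nat x e)) = case_nat x (\<lambda>i. \<sigma> i e)" for x e
    by (rule ext) (simp add: \<tau>_def split: nat.split)
  ultimately show ?case by simp
next
  case (delta0_eq s t)
  show ?case by (rule delta0.delta0_eq[OF poly_subst[OF delta0_eq(1,3)] poly_subst[OF delta0_eq(2,3)]])
next
  case (delta0_less s t)
  show ?case by (rule delta0.delta0_less[OF poly_subst[OF delta0_less(1,3)] poly_subst[OF delta0_less(2,3)]])
next
  case (delta0_not R)
  show ?case by (rule delta0.delta0_not[OF delta0_not.IH[OF delta0_not.prems]])
next
  case (delta0_and R S)
  show ?case by (rule delta0.delta0_and[OF delta0_and.IH(1)[OF delta0_and.prems] delta0_and.IH(2)[OF delta0_and.prems]])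
qed

lemma delta0_ren: "delta0 R \<Longrightarrow> delta0 (\<lambda>e. R (\<lambda>i. e (\<pi> i)))"
  by (rule delta0_subst) (auto intro: poly_var)

lemma delta0_or: "delta0 R \<Longrightarrow> delta0 S \<Longrightarrow> delta0 (\<lambda>e. R e \<or> S e)"
  using delta0_not[OF delta0_and[OF delta0_not delta0_not, of R S]] by simp

lemma delta0_imp:
  assumes "delta0 R" "delta0 S"
  shows "delta0 (\<lambda>e. R e \<longrightarrow> S e)"
  using delta0_or[OF delta0_not[OF assms(1)] assms(2)] by (simp only: imp_conv_disj)

lemma delta0_bex: "delta0 (\<lambda>e. B (\<lambda>i. e (Suc i)) (e 0)) \<Longrightarrow> poly t \<Longrightarrow> delta0 (\<lambda>e. \<exists>x<t e. B e x)"
  using delta0_bex0[of "\<lambda>e. B (\<lambda>i. e (Suc i)) (e 0)" t] by simp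

lemma delta0_ball:
  assumes "delta0 (\<lambda>e. B (\<lambda>i. e (Suc i)) (e 0))" "poly t"
  shows "delta0 (\<lambda>e. \<forall>x<t e. B e x)"
  using delta0_not[OF delta0_bex[of "\<lambda>e x. \<not> B e x", OF delta0_not[OF assms(1)] assms(2)]] by simp

lemmas delta0_intros = delta0_eq delta0_less delta0_not delta0_and delta0_or delta0_imp delta0_bex delta0_ball
  poly_var poly_const poly_Suc poly_add poly_mult

section \<open>From semantic \<Delta>0 relations to formulas\<close>

lemma poly_tm: "poly t \<Longrightarrow> \<exists>u. fv_tm u \<subseteq> range \<rho> \<and> (\<forall>e. eval_tm e u = t (\<lambda>i. e (\<rho> i)))"
proof (induction rule: poly.induct)
  case (poly_var i)
  show ?case by (rule exI[of _ "Var (\<rho> i)"]) auto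
next
  case poly_zero
  show ?case by (rule exI[of _ Zero]) auto
next
  case (poly_Suc t)
  then obtain u where "fv_tm u \<subseteq> range \<rho>" "\<forall>e. eval_tm e u = t (\<lambda>i. e (\<rho> i))" by blast
  then show ?case by (intro exI[of _ "Succ u"]) auto
next
  case (poly_add s t)
  then obtain u v where "fv_tm u \<subseteq> range \<rho>" "\<forall>e. eval_tm e u = s (\<lambda>i. e (\<rho> i))"
    "fv_tm v \<subseteq> range \<rho>" "\<forall>e. eval_tm e v = t (\<lambda>i. e (\<rho> i))" by blast
  then show ?case by (intro exI[of _ "Add u v"]) auto
next
  case (poly_mult s t)
  then obtain u v where "fv_tm u \<subseteq> range \<rho>" "\<forall>e. eval_tm e u = s (\<lambda>i. e (\<rho> i))"
    "fv_tm v \<subseteq> range \<rho>" "\<forall>e. eval_tm e v = t (\<lambda>i. e (\<rho> i))" by blast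
  then show ?case by (intro exI[of _ "Mult u v"]) auto
qed

theorem delta0_fm:
  "delta0 R \<Longrightarrow> infinite (- range \<rho>) \<Longrightarrow>
    \<exists>\<phi>. Delta0 \<phi> \<and> fv \<phi> \<subseteq> range \<rho> \<and> (\<forall>e. sat e \<phi> = R (\<lambda>i. e (\<rho> i)))"
proof (induction arbitrary: \<rho> rule: delta0.induct)
  case (delta0_eq s t)
  obtain u v where "fv_tm u \<subseteq> range \<rho>" "\<forall>e. eval_tm e u = s (\<lambda>i. e (\<rho> i))"
    "fv_tm v \<subseteq> range \<rho>" "\<forall>e. eval_tm e v = t (\<lambda>i. e (\<rho> i))"
    using poly_tm[OF delta0_eq(1)] poly_tm[OF delta0_eq(2)] by metis
  then show ?case by (intro exI[of _ "Eq u v"]) (auto intro: Delta0.intros)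
next
  case (delta0_less s t)
  obtain u v where "fv_tm u \<subseteq> range \<rho>" "\<forall>e. eval_tm e u = s (\<lambda>i. e (\<rho> i))"
    "fv_tm v \<subseteq> range \<rho>" "\<forall>e. eval_tm e v = t (\<lambda>i. e (\<rho> i))"
    using poly_tm[OF delta0_less(1)] poly_tm[OF delta0_less(2)] by metis
  then show ?case by (intro exI[of _ "Lt u v"]) (auto intro: Delta0.intros)
next
  case (delta0_not R)
  then obtain \<phi> where "Delta0 \<phi>" "fv \<phi> \<subseteq> range \<rho>" "\<forall>e. sat e \<phi> = R (\<lambda>i. e (\<rho> i))" by blast
  then show ?case by (intro exI[of _ "Neg \<phi>"]) (auto intro: Delta0.intros)
next
  case (delta0_and R S)
  then obtain \<phi> \<psi> where "Delta0 \<phi>" "fv \<phi> \<subseteq> range \<rho>" "\<forall>e. sat e \<phi> = R (\<lambda>i. e (\<rho> i))"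
    "Delta0 \<psi>" "fv \<psi> \<subseteq> range \<rho>" "\<forall>e. sat e \<psi> = S (\<lambda>i. e (\<rho> i))" by metis
  then show ?case by (intro exI[of _ "And \<phi> \<psi>"]) (auto intro: Delta0.intros)
next
  case (delta0_bex0 R t)
  obtain u where u: "fv_tm u \<subseteq> range \<rho>" "\<And>e. eval_tm e u = t (\<lambda>i. e (\<rho> i))"
    using poly_tm[OF delta0_bex0(2)] by metis
  have "- range \<rho> \<noteq> {}" using delta0_bex0.prems by (metis finite.emptyI)
  then obtain k where k: "k \<notin> range \<rho>" by blast
  have rng: "range (case_nat k \<rho>) = insert k (range \<rho>)"
  proof
    show "range (case_nat k \<rho>) \<subseteq> insert k (range \<rho>)" by (auto split: nat.split)
    have "case_nat k \<rho> 0 = k" "\<And>i. case_nat k \<rho> (Suc i) = \<rho> i" by auto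
    then show "insert k (range \<rho>) \<subseteq> range (case_nat k \<rho>)"
      by (metis (no_types, lifting) image_subsetI insert_subset rangeI)
  qed
  have "infinite (- range (case_nat k \<rho>))"
    unfolding rng using delta0_bex0.prems by (simp add: Compl_insert)
  from delta0_bex0.IH[OF this] obtain \<phi> where \<phi>: "Delta0 \<phi>" "fv \<phi> \<subseteq> insert k (range \<rho>)"
    "\<And>e. sat e \<phi> = R (\<lambda>i. e (case_nat k \<rho> i))" unfolding rng by blast
  have upd: "(\<lambda>i. (e(k := v)) (\<rho> i)) = (\<lambda>i. e (\<rho> i))"
    "(\<lambda>i. (e(k := v)) (case_nat k \<rho> i)) = case_nat v (\<lambda>i. e (\<rho> i))" for e :: "nat \<Rightarrow> nat" and v
    using k by (auto simp: fun_eq_iff split: nat.split)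
  have "Delta0 (Ex k (And (Lt (Var k) u) \<phi>))"
    using \<phi>(1) u(1) k by (intro Delta0.intros) auto
  moreover have "fv (Ex k (And (Lt (Var k) u) \<phi>)) \<subseteq> range \<rho>"
    using \<phi>(2) u(1) by auto
  moreover have "sat e (Ex k (And (Lt (Var k) u) \<phi>)) = (\<exists>x<t (\<lambda>i. e (\<rho> i)). R (case_nat x (\<lambda>i. e (\<rho> i))))"
    for e
    by (simp only: sat.simps eval_tm.simps u(2) \<phi>(3) upd fun_upd_same)
  ultimately show ?case by blast
qed

section \<open>\<Sigma>1 relations and their closure properties\<close>

definition sigma1 :: "((nat \<Rightarrow> nat) \<Rightarrow> bool) \<Rightarrow> bool" where
  "sigma1 R \<longleftrightarrow> (\<exists>M. delta0 M \<and> (\<forall>e. R e \<longleftrightarrow> (\<exists>u. M (case_nat u e))))"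

lemma sigma1I: "delta0 M \<Longrightarrow> (\<And>e. R e \<longleftrightarrow> (\<exists>u. M (case_nat u e))) \<Longrightarrow> sigma1 R"
  unfolding sigma1_def by blast

lemma sigma1E:
  assumes "sigma1 R"
  obtains M where "delta0 M" "\<And>e. R e \<longleftrightarrow> (\<exists>u. M (case_nat u e))"
  using assms unfolding sigma1_def by blast

lemma sigma1_delta0: "delta0 R \<Longrightarrow> sigma1 R"
  by (rule sigma1I[of "\<lambda>e. R (\<lambda>i. e (Suc i))"]) (auto intro: delta0_ren)

lemma sigma1_ren:
  assumes "sigma1 R"
  shows "sigma1 (\<lambda>e. R (\<lambda>i. e (\<pi> i)))"
proof -
  from assms obtain M where M: "delta0 M" "\<And>e. R e \<longleftrightarrow> (\<exists>u. M (case_nat u e))" by (rule sigma1E) blast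
  have "delta0 (\<lambda>e. M (\<lambda>i. e (case_nat 0 (\<lambda>j. Suc (\<pi> j)) i)))" using M(1) by (rule delta0_ren)
  moreover have "(\<lambda>i. case_nat u e (case_nat 0 (\<lambda>j. Suc (\<pi> j)) i)) = case_nat u (\<lambda>i. e (\<pi> i))"
    for u and e :: "nat \<Rightarrow> nat"
    by (rule ext) (simp split: nat.split)
  ultimately show ?thesis using M(2) by (intro sigma1I[of "\<lambda>e. M (\<lambda>i. e (case_nat 0 (\<lambda>j. Suc (\<pi> j)) i))"]) simp_all
qed

text \<open>The witnesses of the components are bounded by a common witness.\<close>

lemma delta0_below: "delta0 M \<Longrightarrow> delta0 (\<lambda>e. \<exists>u<e 0. M (case_nat u (\<lambda>i. e (Suc i))))"
proof (rule delta0_bex[OF _ poly_var])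
  assume "delta0 M"
  then have "delta0 (\<lambda>e. M (\<lambda>i. e (case_nat 0 (\<lambda>j. Suc (Suc j)) i)))" by (rule delta0_ren)
  moreover have "(\<lambda>i. e (case_nat 0 (\<lambda>j. Suc (Suc j)) i)) = case_nat (e 0) (\<lambda>i. e (Suc (Suc i)))"
    for e :: "nat \<Rightarrow> nat"
    by (rule ext) (simp split: nat.split)
  ultimately show "delta0 (\<lambda>e. M (case_nat (e 0) (\<lambda>i. e (Suc (Suc i)))))" by simp
qed

lemma sigma1_and:
  assumes "sigma1 R" "sigma1 S"
  shows "sigma1 (\<lambda>e. R e \<and> S e)"
proof -
  from assms(1) obtain M where M: "delta0 M" "\<And>e. R e \<longleftrightarrow> (\<exists>u. M (case_nat u e))" by (rule sigma1E) blast
  from assms(2) obtain N where N: "delta0 N" "\<And>e. S e \<longleftrightarrow> (\<exists>u. N (case_nat u e))" by (rule sigma1E) blast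
  show ?thesis
  proof (rule sigma1I[OF delta0_and[OF delta0_below[OF M(1)] delta0_below[OF N(1)]]])
    fix e
    have "(\<exists>u v. A u \<and> B v) \<longleftrightarrow> (\<exists>w. (\<exists>u<w. A u) \<and> (\<exists>u<w. B u))" for A B :: "nat \<Rightarrow> bool"
      by (meson less_add_Suc1 less_add_Suc2)
    from this[of "\<lambda>u. M (case_nat u e)" "\<lambda>u. N (case_nat u e)"]
    show "(R e \<and> S e) = (\<exists>u. (\<exists>ua<case_nat u e 0. M (case_nat ua (\<lambda>i. case_nat u e (Suc i)))) \<and>
        (\<exists>ua<case_nat u e 0. N (case_nat ua (\<lambda>i. case_nat u e (Suc i)))))"
      by (simp add: M(2) N(2))
  qed
qed

lemma sigma1_or:
  assumes "sigma1 R" "sigma1 S"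
  shows "sigma1 (\<lambda>e. R e \<or> S e)"
proof -
  from assms(1) obtain M where M: "delta0 M" "\<And>e. R e \<longleftrightarrow> (\<exists>u. M (case_nat u e))" by (rule sigma1E) blast
  from assms(2) obtain N where N: "delta0 N" "\<And>e. S e \<longleftrightarrow> (\<exists>u. N (case_nat u e))" by (rule sigma1E) blast
  show ?thesis by (rule sigma1I[OF delta0_or[OF M(1) N(1)]]) (auto simp: M(2) N(2))
qed

text \<open>The new \<open>x\<close> and the old witness \<open>u\<close> are both placed below one
  unbounded variable, which merges two unbounded quantifiers without a pairing function.\<close>

lemma sigma1_ex:
  assumes "sigma1 (\<lambda>e. B (\<lambda>i. e (Suc i)) (e 0))"
  shows "sigma1 (\<lambda>e. \<exists>x. B e x)"
proof -
  from assms obtain M where M: "delta0 M" "\<And>e. B (\<lambda>i. e (Suc i)) (e 0) \<longleftrightarrow> (\<exists>u. M (case_nat u e))"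
    by (rule sigma1E) blast
  have B: "B e x \<longleftrightarrow> (\<exists>u. M (case_nat u (case_nat x e)))" for e x
    using M(2)[of "case_nat x e"] by simp
  \<comment> \<open>Under the quantifiers the environment reads \<open>u\<close>, \<open>x\<close>,
    the common bound, then the parameters; the renaming makes \<open>M\<close> skip the
    bound.\<close>
  let ?\<pi> = "case_nat 0 (case_nat (Suc 0) (\<lambda>i. Suc (Suc (Suc i))))"
  have "delta0 (\<lambda>e. M (\<lambda>i. e (?\<pi> i)))" using M(1) by (rule delta0_ren)
  moreover have "(\<lambda>i. e (?\<pi> i)) = case_nat (e 0) (case_nat (e (Suc 0)) (\<lambda>i. e (Suc (Suc (Suc i)))))"
    for e :: "nat \<Rightarrow> nat"
    by (rule ext) (simp split: nat.split)
  ultimately have "delta0 (\<lambda>e. M (case_nat (e 0) (case_nat (e (Suc 0)) (\<lambda>i. e (Suc (Suc (Suc i)))))))"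
    by simp
  then have "delta0 (\<lambda>e. \<exists>x<e 0. \<exists>u<e 0. M (case_nat u (case_nat x (\<lambda>i. e (Suc i)))))"
    by (intro delta0_bex poly_var) simp
  then show ?thesis
  proof (rule sigma1I)
    fix e
    have "(\<exists>x u. A x u) \<longleftrightarrow> (\<exists>w. \<exists>x<w. \<exists>u<w. A x u)" for A :: "nat \<Rightarrow> nat \<Rightarrow> bool"
      by (meson less_add_Suc1 less_add_Suc2)
    from this[of "\<lambda>x u. M (case_nat u (case_nat x e))"]
    show "(\<exists>x. B e x) = (\<exists>u. \<exists>x<case_nat u e 0. \<exists>ua<case_nat u e 0.
        M (case_nat ua (case_nat x (\<lambda>i. case_nat u e (Suc i)))))"
      by (simp add: B)
  qed
qed

text \<open>Collection: the finitely many witnesses lie below one more than their sum, so a single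
  unbounded search can be moved in front of the bounded quantifier.\<close>

lemma sigma1_ball:
  assumes "sigma1 (\<lambda>e. B (\<lambda>i. e (Suc i)) (e 0))" "poly t"
  shows "sigma1 (\<lambda>e. \<forall>x<t e. B e x)"
proof -
  from assms obtain M where M: "delta0 M" "\<And>e. B (\<lambda>i. e (Suc i)) (e 0) \<longleftrightarrow> (\<exists>u. M (case_nat u e))"
    by (elim sigma1E) blast
  have B: "B e x \<longleftrightarrow> (\<exists>u. M (case_nat u (case_nat x e)))" for e x
    using M(2)[of "case_nat x e"] by simp
  let ?\<pi> = "case_nat 0 (case_nat (Suc 0) (\<lambda>i. Suc (Suc (Suc i))))"
  have "delta0 (\<lambda>e. M (\<lambda>i. e (?\<pi> i)))" using M(1) by (rule delta0_ren)
  moreover have "(\<lambda>i. e (?\<pi> i)) = case_nat (e 0) (case_nat (e (Suc 0)) (\<lambda>i. e (Suc (Suc (Suc i)))))"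
    for e :: "nat \<Rightarrow> nat"
    by (rule ext) (simp split: nat.split)
  ultimately have "delta0 (\<lambda>e. M (case_nat (e 0) (case_nat (e (Suc 0)) (\<lambda>i. e (Suc (Suc (Suc i)))))))"
    by simp
  moreover have "poly (\<lambda>e. t (\<lambda>i. e (Suc i)))"
    using poly_subst[OF assms(2), of "\<lambda>i e. e (Suc i)"] by (simp add: poly_var)
  ultimately have "delta0 (\<lambda>e. \<forall>x<t (\<lambda>i. e (Suc i)). \<exists>u<e 0. M (case_nat u (case_nat x (\<lambda>i. e (Suc i)))))"
    by (intro delta0_bex delta0_ball poly_var) simp_all
  then show ?thesis
  proof (rule sigma1I)
    fix e
    have "(\<forall>x<n. \<exists>u. A x u) \<longleftrightarrow> (\<exists>w. \<forall>x<n. \<exists>u<w. A x u)" for n and A :: "nat \<Rightarrow> nat \<Rightarrow> bool"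
    proof
      assume "\<forall>x<n. \<exists>u. A x u"
      then obtain f where f: "\<And>x. x < n \<Longrightarrow> A x (f x)" by metis
      have "f x < Suc (\<Sum>i<n. f i)" if "x < n" for x
        using that member_le_sum[of x "{..<n}" f] by (simp add: le_imp_less_Suc)
      with f show "\<exists>w. \<forall>x<n. \<exists>u<w. A x u" by blast
    qed blast
    from this[of "t e" "\<lambda>x u. M (case_nat u (case_nat x e))"]
    show "(\<forall>x<t e. B e x) = (\<exists>u. \<forall>x<t (\<lambda>i. case_nat u e (Suc i)). \<exists>ua<case_nat u e 0.
        M (case_nat ua (case_nat x (\<lambda>i. case_nat u e (Suc i)))))"
      by (simp add: B)
  qed
qed

section \<open>Functions with a \<Sigma>1 graph\<close>

definition sigma1_fun :: "((nat \<Rightarrow> nat) \<Rightarrow> nat) \<Rightarrow> bool" where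
  "sigma1_fun t \<longleftrightarrow> sigma1 (\<lambda>e. e 0 = t (\<lambda>i. e (Suc i)))"

lemma sigma1_fun_poly: "poly t \<Longrightarrow> sigma1_fun t"
  unfolding sigma1_fun_def using poly_subst[of t "\<lambda>i e. e (Suc i)"]
  by (intro sigma1_delta0 delta0_eq poly_var) (simp add: poly_var)

lemma sigma1_fun_shift: "sigma1_fun t \<Longrightarrow> sigma1_fun (\<lambda>e. t (\<lambda>i. e (Suc i)))"
  unfolding sigma1_fun_def
  using sigma1_ren[of "\<lambda>e. e 0 = t (\<lambda>i. e (Suc i))" "case_nat 0 (\<lambda>i. Suc (Suc i))"] by simp

text \<open>An argument is replaced by searching for the value of \<open>t\<close>, so a \<Sigma>1
  graph suffices and no term of the language is required.\<close>

lemma sigma1_inst: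
  assumes "sigma1 R" "sigma1_fun t"
  shows "sigma1 (\<lambda>e. R (case_nat (t e) e))"
proof -
  have "sigma1 (\<lambda>e. \<exists>y. y = t e \<and> R (case_nat y e))"
    by (rule sigma1_ex) (use assms in \<open>simp add: sigma1_and sigma1_fun_def\<close>)
  then show ?thesis by simp
qed

lemma sigma1_comp1: "sigma1 (\<lambda>e. Q (e 0)) \<Longrightarrow> sigma1_fun s \<Longrightarrow> sigma1 (\<lambda>e. Q (s e))"
  using sigma1_inst[of "\<lambda>e. Q (e 0)" s] by simp

lemma sigma1_comp2:
  "sigma1 (\<lambda>e. Q (e 0) (e 1)) \<Longrightarrow> sigma1_fun s \<Longrightarrow> sigma1_fun t \<Longrightarrow> sigma1 (\<lambda>e. Q (s e) (t e))"
  using sigma1_inst[OF sigma1_inst[of "\<lambda>e. Q (e 0) (e 1)", OF _ sigma1_fun_shift[of s]], of t] by simp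

lemma sigma1_comp3:
  assumes "sigma1 (\<lambda>e. Q (e 0) (e 1) (e 2))" "sigma1_fun s" "sigma1_fun t" "sigma1_fun u"
  shows "sigma1 (\<lambda>e. Q (s e) (t e) (u e))"
  using sigma1_inst[OF sigma1_inst[OF sigma1_inst[OF assms(1) sigma1_fun_shift[OF sigma1_fun_shift[OF assms(2)]]]
        sigma1_fun_shift[OF assms(3)]] assms(4)]
  by (simp add: numeral_2_eq_2)

lemma sigma1_fun_comp1:
  assumes "sigma1 (\<lambda>e. e 0 = F (e 1))" "sigma1_fun s"
  shows "sigma1_fun (\<lambda>e. F (s e))"
  unfolding sigma1_fun_def
  by (rule sigma1_comp2[of "\<lambda>y a. y = F a", OF assms(1) sigma1_fun_poly[OF poly_var] sigma1_fun_shift[OF assms(2)]])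

lemma sigma1_fun_comp2:
  assumes "sigma1 (\<lambda>e. e 0 = F (e 1) (e 2))" "sigma1_fun s" "sigma1_fun t"
  shows "sigma1_fun (\<lambda>e. F (s e) (t e))"
  unfolding sigma1_fun_def
  by (rule sigma1_comp3[of "\<lambda>y a b. y = F a b", OF assms(1) sigma1_fun_poly[OF poly_var] sigma1_fun_shift[OF assms(2)]
        sigma1_fun_shift[OF assms(3)]])

lemma sigma1_fun_var: "sigma1_fun (\<lambda>e. e i)" and sigma1_fun_const: "sigma1_fun (\<lambda>e. c)"
  by (simp_all add: sigma1_fun_poly poly_var poly_const)

lemma sigma1_eq: "sigma1_fun s \<Longrightarrow> sigma1_fun t \<Longrightarrow> sigma1 (\<lambda>e. s e = t e)"
  by (rule sigma1_comp2[of "\<lambda>x y. x = y" s t]) (intro sigma1_delta0 delta0_intros)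

lemma sigma1_neq: "sigma1_fun s \<Longrightarrow> sigma1_fun t \<Longrightarrow> sigma1 (\<lambda>e. s e \<noteq> t e)"
  by (rule sigma1_comp2[of "\<lambda>x y. x \<noteq> y" s t]) (intro sigma1_delta0 delta0_intros)

lemma sigma1_less: "sigma1_fun s \<Longrightarrow> sigma1_fun t \<Longrightarrow> sigma1 (\<lambda>e. s e < t e)"
  by (rule sigma1_comp2[of "\<lambda>x y. x < y" s t]) (intro sigma1_delta0 delta0_intros)

lemma sigma1_fun_Suc: "sigma1_fun s \<Longrightarrow> sigma1_fun (\<lambda>e. Suc (s e))"
  by (rule sigma1_fun_comp1[of Suc s]) (intro sigma1_delta0 delta0_intros)

text \<open>Cantor's pairing contains a triangular number; doubling the equation removes the
  division by 2 and leaves polynomials.\<close>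

lemma prod_encode_eq_iff:
  "y = prod_encode (a, b) \<longleftrightarrow> y + y = (a + b) * Suc (a + b) + (a + a)"
proof -
  have "2 * triangle n = n * Suc n" for n
    unfolding triangle_def by (rule dvd_mult_div_cancel) simp
  then have "2 * prod_encode (a, b) = (a + b) * Suc (a + b) + 2 * a"
    unfolding prod_encode_def by (simp add: add_mult_distrib2)
  then show ?thesis by linarith
qed

lemma sigma1_fun_pair: "sigma1_fun s \<Longrightarrow> sigma1_fun t \<Longrightarrow> sigma1_fun (\<lambda>e. prod_encode (s e, t e))"
  by (rule sigma1_fun_comp2[of "\<lambda>a b. prod_encode (a, b)" s t])
    (unfold prod_encode_eq_iff, intro sigma1_delta0 delta0_intros)

lemmas sigma1_intros = sigma1_and sigma1_or sigma1_ex sigma1_eq sigma1_neq sigma1_less sigma1_fun_var sigma1_fun_const sigma1_fun_Suc sigma1_fun_pair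

subsection \<open>Codes of finite sets\<close>

text \<open>Goedel's beta function adapted to sets: \<open>x\<close> belongs to the set if the
  modulus \<open>1 + (x + 1) * b\<close> divides \<open>a\<close>. The cap \<open>n\<close> keeps
  the set finite even for \<open>a = 0\<close> and allows the code to be made large.\<close>

definition memb :: "nat \<Rightarrow> nat \<Rightarrow> bool" where
  "memb d x \<longleftrightarrow> (\<exists>a b n. d = prod_encode (a, prod_encode (b, n)) \<and> x < n \<and> Suc (Suc x * b) dvd a)"

text \<open>Components of a pair do not exceed its code, so every quantifier can be bounded.
  \<open>p\<close> names the inner pair because pairing is not polynomial and can enter only as an
  equation.\<close>

lemma memb_bounded:
  "memb d x \<longleftrightarrow> (\<exists>a<Suc d. \<exists>b<Suc d. \<exists>n<Suc d. \<exists>p<Suc d. p = prod_encode (b, n) \<and>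
    d = prod_encode (a, p) \<and> x < n \<and> (\<exists>k<Suc a. a = k * Suc (Suc x * b)))"
proof
  assume "memb d x"
  then obtain a b n where d: "d = prod_encode (a, prod_encode (b, n))" "x < n"
    "Suc (Suc x * b) dvd a" unfolding memb_def by blast
  have "a \<le> d" "prod_encode (b, n) \<le> d" "b \<le> prod_encode (b, n)" "n \<le> prod_encode (b, n)"
    unfolding d by (rule le_prod_encode_1 le_prod_encode_2)+
  moreover obtain k where k: "a = k * Suc (Suc x * b)" using d(3) by (metis dvd_def mult.commute)
  moreover have "k \<le> a" unfolding k by simp
  ultimately show "\<exists>a<Suc d. \<exists>b<Suc d. \<exists>n<Suc d. \<exists>p<Suc d. p = prod_encode (b, n) \<and>
    d = prod_encode (a, p) \<and> x < n \<and> (\<exists>k<Suc a. a = k * Suc (Suc x * b))"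
    using d(1,2)
    by (intro exI[of _ a] exI[of _ b] exI[of _ n] exI[of _ "prod_encode (b, n)"] exI[of _ k] conjI)
      linarith+
next
  assume "\<exists>a<Suc d. \<exists>b<Suc d. \<exists>n<Suc d. \<exists>p<Suc d. p = prod_encode (b, n) \<and>
    d = prod_encode (a, p) \<and> x < n \<and> (\<exists>k<Suc a. a = k * Suc (Suc x * b))"
  then show "memb d x" unfolding memb_def by (metis dvd_triv_right)
qed

lemma delta0_memb: "delta0 (\<lambda>e. memb (e i) (e j))"
  unfolding memb_bounded prod_encode_eq_iff by (intro delta0_intros)

lemma memb_less: "memb d x \<Longrightarrow> x < d"
proof -
  assume "memb d x"
  then obtain a b n where "d = prod_encode (a, prod_encode (b, n))" "x < n"
    unfolding memb_def by blast
  then show ?thesis using le_prod_encode_2[of n b] le_prod_encode_2[of "prod_encode (b, n)" a] by linarith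
qed

text \<open>A common divisor is coprime to \<open>b\<close> and divides \<open>(x - y) * b\<close>,
  hence \<open>x - y\<close>, which is a factor of \<open>fact n\<close> and so divides
  \<open>b\<close>; only a unit does both.\<close>

lemma coprime_moduli:
  fixes b n x y :: nat
  assumes "fact n dvd b" "x < n" "y < x"
  shows "coprime (Suc (Suc x * b)) (Suc (Suc y * b))"
proof (rule coprimeI)
  fix c assume c: "c dvd Suc (Suc x * b)" "c dvd Suc (Suc y * b)"
  have "coprime c b"
  proof (rule coprimeI)
    fix r assume "r dvd c" "r dvd b"
    then have "r dvd Suc (Suc x * b)" "r dvd Suc x * b" using c dvd_trans by (blast, simp)
    then have "r dvd Suc (Suc x * b) - Suc x * b" by (rule dvd_diff_nat)
    then show "is_unit r" by simp
  qed
  have "Suc (Suc x * b) - Suc (Suc y * b) = (x - y) * b"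
    using assms(3) by (simp add: diff_mult_distrib)
  then have "c dvd (x - y) * b" using dvd_diff_nat[OF c] by simp
  then have "c dvd x - y" using \<open>coprime c b\<close> by (simp add: coprime_dvd_mult_left_iff)
  moreover have "x - y dvd fact n" using assms by (intro dvd_fact) auto
  ultimately have "c dvd b" using assms(1) dvd_trans by blast
  then show "is_unit c" using \<open>coprime c b\<close> by (metis coprime_absorb_left)
qed

text \<open>\<open>a\<close> is the product of the moduli of the members; by pairwise coprimality no
  other modulus below the cap divides it. The code is made at least \<open>n0\<close> because a
  pattern speaks only about numbers below its code.\<close>

lemma memb_surj:
  assumes "finite Y"
  obtains d where "n0 \<le> d" "\<And>x. memb d x \<longleftrightarrow> x \<in> Y"
proof -
  obtain m where m: "\<And>y. y \<in> Y \<Longrightarrow> y < m"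
    using assms finite_nat_set_iff_bounded by auto
  define n where "n = max m n0"
  define b :: nat where "b = fact n"
  define a where "a = (\<Prod>y\<in>Y. Suc (Suc y * b))"
  define d where "d = prod_encode (a, prod_encode (b, n))"
  have cop: "coprime (Suc (Suc x * b)) (Suc (Suc y * b))" if "x < n" "y < n" "x \<noteq> y" for x y
    using that coprime_moduli[of n b x y] coprime_moduli[of n b y x]
    by (auto simp: b_def coprime_commute neq_iff)
  have Y: "y < n" if "y \<in> Y" for y using m[OF that] by (simp add: n_def)
  have "n0 \<le> d"
    using le_prod_encode_2[of n b] le_prod_encode_2[of "prod_encode (b, n)" a]
    unfolding d_def n_def by linarith
  moreover have "memb d x \<longleftrightarrow> x \<in> Y" for x
  proof
    assume "x \<in> Y"
    then have "Suc (Suc x * b) dvd a" unfolding a_def using assms by (intro dvd_prodI) auto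
    then show "memb d x" using Y[OF \<open>x \<in> Y\<close>] unfolding memb_def d_def by blast
  next
    assume "memb d x"
    then have x: "x < n" "Suc (Suc x * b) dvd a" unfolding memb_def d_def by auto
    show "x \<in> Y"
    proof (rule ccontr)
      assume "x \<notin> Y"
      then have "coprime (Suc (Suc x * b)) a"
        unfolding a_def using x(1) Y by (intro prod_coprime_right cop) auto
      then have "is_unit (Suc (Suc x * b))" using x(2) by (metis coprime_absorb_left)
      then show False by (simp add: b_def)
    qed
  qed
  ultimately show ?thesis by (rule that)
qed

subsection \<open>Inductive definitions\<close>

text \<open>Monotone, finitary, and preserving \<Sigma>1 sets. The renaming \<open>\<pi>\<close>
  separates the environments: the set may depend on variables, such as a rank or the code of a
  derivation, that the operator does not see.\<close>

definition sigma1_op :: "(nat set \<Rightarrow> (nat \<Rightarrow> nat) \<Rightarrow> bool) \<Rightarrow> bool" where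
  "sigma1_op \<Phi> \<longleftrightarrow> (\<forall>X Y e. \<Phi> X e \<longrightarrow> X \<subseteq> Y \<longrightarrow> \<Phi> Y e) \<and>
    (\<forall>X e. \<Phi> X e \<longrightarrow> (\<exists>D\<subseteq>X. finite D \<and> \<Phi> D e)) \<and>
    (\<forall>R \<pi>. sigma1 R \<longrightarrow> sigma1 (\<lambda>e. \<Phi> {y. R (case_nat y e)} (\<lambda>i. e (\<pi> i))))"

lemma sigma1_opI:
  assumes "\<And>X Y e. \<Phi> X e \<Longrightarrow> X \<subseteq> Y \<Longrightarrow> \<Phi> Y e"
    and "\<And>X e. \<Phi> X e \<Longrightarrow> \<exists>D\<subseteq>X. finite D \<and> \<Phi> D e"
    and "\<And>R \<pi>. sigma1 R \<Longrightarrow> sigma1 (\<lambda>e. \<Phi> {y. R (case_nat y e)} (\<lambda>i. e (\<pi> i)))"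
  shows "sigma1_op \<Phi>"
  unfolding sigma1_op_def using assms by (intro conjI allI impI)

lemma sigma1_op_mono: "sigma1_op \<Phi> \<Longrightarrow> \<Phi> X e \<Longrightarrow> X \<subseteq> Y \<Longrightarrow> \<Phi> Y e"
  unfolding sigma1_op_def by (drule conjunct1) simp

lemma sigma1_op_finite: "sigma1_op \<Phi> \<Longrightarrow> \<Phi> X e \<Longrightarrow> \<exists>D\<subseteq>X. finite D \<and> \<Phi> D e"
  unfolding sigma1_op_def by (drule conjunct2, drule conjunct1) simp

lemma sigma1_op_subst:
  "sigma1_op \<Phi> \<Longrightarrow> sigma1 R \<Longrightarrow> sigma1 (\<lambda>e. \<Phi> {y. R (case_nat y e)} (\<lambda>i. e (\<pi> i)))"
  unfolding sigma1_op_def by (drule conjunct2, drule conjunct2) simp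

lemma sigma1_op_const: "sigma1 R \<Longrightarrow> sigma1_op (\<lambda>X e. R e)"
  by (rule sigma1_opI) (auto intro: sigma1_ren)

lemma sigma1_op_mem_var: "sigma1_op (\<lambda>X e. e i \<in> X)"
proof (rule sigma1_opI)
  fix X and e :: "nat \<Rightarrow> nat"
  assume "e i \<in> X"
  then show "\<exists>D\<subseteq>X. finite D \<and> e i \<in> D" by (intro exI[of _ "{e i}"]) auto
next
  fix R and \<pi> :: "nat \<Rightarrow> nat"
  assume "sigma1 R"
  then show "sigma1 (\<lambda>e. e (\<pi> i) \<in> {y. R (case_nat y e)})"
    using sigma1_inst[of R, OF _ sigma1_fun_var[of "\<pi> i"]] by simp
qed auto

lemma sigma1_op_and:
  assumes "sigma1_op \<Phi>" "sigma1_op \<Psi>"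
  shows "sigma1_op (\<lambda>X e. \<Phi> X e \<and> \<Psi> X e)"
proof (rule sigma1_opI)
  fix X e
  assume *: "\<Phi> X e \<and> \<Psi> X e"
  from sigma1_op_finite[OF assms(1), OF conjunct1[OF *]] obtain D1
    where D1: "D1 \<subseteq> X" "finite D1" "\<Phi> D1 e" by (elim exE conjE)
  from sigma1_op_finite[OF assms(2), OF conjunct2[OF *]] obtain D2
    where D2: "D2 \<subseteq> X" "finite D2" "\<Psi> D2 e" by (elim exE conjE)
  have "\<Phi> (D1 \<union> D2) e" using sigma1_op_mono[OF assms(1), OF D1(3)] by simp
  moreover have "\<Psi> (D1 \<union> D2) e" using sigma1_op_mono[OF assms(2), OF D2(3)] by simp
  moreover have "D1 \<union> D2 \<subseteq> X" "finite (D1 \<union> D2)" using D1 D2 by simp_all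
  ultimately show "\<exists>D\<subseteq>X. finite D \<and> \<Phi> D e \<and> \<Psi> D e" by (intro exI[of _ "D1 \<union> D2"] conjI)
next
  fix R \<pi>
  assume "sigma1 R"
  from sigma1_and[OF sigma1_op_subst[OF assms(1) this] sigma1_op_subst[OF assms(2) this]]
  show "sigma1 (\<lambda>e. \<Phi> {y. R (case_nat y e)} (\<lambda>i. e (\<pi> i)) \<and> \<Psi> {y. R (case_nat y e)} (\<lambda>i. e (\<pi> i)))" .
next
  fix X Y e
  assume "\<Phi> X e \<and> \<Psi> X e" "X \<subseteq> Y"
  then show "\<Phi> Y e \<and> \<Psi> Y e"
    using sigma1_op_mono[OF assms(1), of X e Y] sigma1_op_mono[OF assms(2), of X e Y] by simp
qed

lemma sigma1_op_or:
  assumes "sigma1_op \<Phi>" "sigma1_op \<Psi>"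
  shows "sigma1_op (\<lambda>X e. \<Phi> X e \<or> \<Psi> X e)"
proof (rule sigma1_opI)
  fix X e
  assume "\<Phi> X e \<or> \<Psi> X e"
  then show "\<exists>D\<subseteq>X. finite D \<and> (\<Phi> D e \<or> \<Psi> D e)"
  proof
    assume "\<Phi> X e"
    from sigma1_op_finite[OF assms(1), OF this] obtain D where "D \<subseteq> X" "finite D" "\<Phi> D e"
      by (elim exE conjE)
    then show ?thesis by (intro exI[of _ D] conjI disjI1)
  next
    assume "\<Psi> X e"
    from sigma1_op_finite[OF assms(2), OF this] obtain D where "D \<subseteq> X" "finite D" "\<Psi> D e"
      by (elim exE conjE)
    then show ?thesis by (intro exI[of _ D] conjI disjI2)
  qed
next
  fix R \<pi>
  assume "sigma1 R"
  from sigma1_or[OF sigma1_op_subst[OF assms(1) this] sigma1_op_subst[OF assms(2) this]]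
  show "sigma1 (\<lambda>e. \<Phi> {y. R (case_nat y e)} (\<lambda>i. e (\<pi> i)) \<or> \<Psi> {y. R (case_nat y e)} (\<lambda>i. e (\<pi> i)))" .
next
  fix X Y e
  assume "\<Phi> X e \<or> \<Psi> X e" "X \<subseteq> Y"
  then show "\<Phi> Y e \<or> \<Psi> Y e"
    using sigma1_op_mono[OF assms(1), of X e Y] sigma1_op_mono[OF assms(2), of X e Y] by (elim disjE) simp_all
qed

lemma sigma1_op_ex:
  assumes "sigma1_op (\<lambda>X e. B X (\<lambda>i. e (Suc i)) (e 0))"
  shows "sigma1_op (\<lambda>X e. \<exists>x. B X e x)"
proof (rule sigma1_opI)
  fix X e
  assume "\<exists>x. B X e x"
  then obtain x where "B X e x" by (elim exE)
  then show "\<exists>D\<subseteq>X. finite D \<and> (\<exists>x. B D e x)"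
    using sigma1_op_finite[OF assms, of X "case_nat x e"] by auto
next
  fix R \<pi>
  assume R: "sigma1 R"
  show "sigma1 (\<lambda>e. \<exists>x. B {y. R (case_nat y e)} (\<lambda>i. e (\<pi> i)) x)"
  proof (rule sigma1_ex)
    let ?R = "\<lambda>e. R (\<lambda>i. e (case_nat 0 (\<lambda>i. Suc (Suc i)) i))"
    let ?\<pi> = "case_nat 0 (\<lambda>i. Suc (\<pi> i))"
    have "sigma1 ?R" using R by (rule sigma1_ren)
    from sigma1_op_subst[OF assms this, of ?\<pi>]
    have "sigma1 (\<lambda>e. B {y. ?R (case_nat y e)} (\<lambda>i. e (Suc (\<pi> i))) (e 0))" by simp
    moreover have "(\<lambda>i. case_nat y e (case_nat 0 (\<lambda>i. Suc (Suc i)) i)) = case_nat y (\<lambda>i. e (Suc i))"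
      for y and e :: "nat \<Rightarrow> nat"
      by (rule ext) (simp split: nat.split)
    ultimately show "sigma1 (\<lambda>e. B {y. R (case_nat y (\<lambda>i. e (Suc i)))} (\<lambda>i. e (Suc (\<pi> i))) (e 0))"
      by simp
  qed
next
  fix X Y e
  assume "\<exists>x. B X e x" "X \<subseteq> Y"
  then obtain x where "B X e x" by (elim exE)
  then have "B Y e x" using sigma1_op_mono[OF assms, of X "case_nat x e" Y] \<open>X \<subseteq> Y\<close> by simp
  then show "\<exists>x. B Y e x" by (rule exI)
qed

lemma sigma1_op_mem:
  assumes "sigma1_fun t"
  shows "sigma1_op (\<lambda>X e. t e \<in> X)"
proof -
  have "sigma1_op (\<lambda>X e. \<exists>y. y = t e \<and> y \<in> X)"
    by (rule sigma1_op_ex, rule sigma1_op_and[OF sigma1_op_const[OF assms[unfolded sigma1_fun_def]] sigma1_op_mem_var])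
  then show ?thesis by simp
qed

text \<open>Membership in the least fixed point is witnessed by a finite derivation: a finite set of
  elements tagged with ranks, each of which follows from elements of smaller rank.\<close>

theorem sigma1_lfp:
  assumes \<Phi>: "sigma1_op \<Phi>"
    and closed: "\<And>e z. \<Phi> (I e) (case_nat z e) \<Longrightarrow> z \<in> I e"
    and least: "\<And>e X z. (\<And>z. \<Phi> X (case_nat z e) \<Longrightarrow> z \<in> X) \<Longrightarrow> z \<in> I e \<Longrightarrow> z \<in> X"
  shows "sigma1 (\<lambda>e. e 0 \<in> I (\<lambda>i. e (Suc i)))"
proof -
  define good where "good e S \<longleftrightarrow> finite S \<and>
      (\<forall>m\<in>S. \<exists>k z. m = prod_encode (k, z) \<and> \<Phi> {y. \<exists>j<k. prod_encode (j, y) \<in> S} (case_nat z e))" for e S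
  define J where "J e = {z. \<exists>S k. good e S \<and> prod_encode (k, z) \<in> S}" for e
  have good_step: "\<Phi> {y. \<exists>j<k. prod_encode (j, y) \<in> S} (case_nat z e)"
    if "good e S" "prod_encode (k, z) \<in> S" for e S k z
  proof -
    from that obtain k' z' where "prod_encode (k, z) = prod_encode (k', z')"
      "\<Phi> {y. \<exists>j<k'. prod_encode (j, y) \<in> S} (case_nat z' e)" unfolding good_def by meson
    then show ?thesis by simp
  qed
  have "z \<in> I e" if "good e S" "prod_encode (k, z) \<in> S" for e S k z
    using that(2)
  proof (induction k arbitrary: z rule: less_induct)
    case (less k)
    have "{y. \<exists>j<k. prod_encode (j, y) \<in> S} \<subseteq> I e" using less.IH by blast
    then show ?case by (rule closed[OF sigma1_op_mono[OF \<Phi>, OF good_step[OF that(1) less.prems]]])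
  qed
  then have JI: "J e \<subseteq> I e" for e unfolding J_def by blast
  have union: "\<exists>S. good e S \<and> (\<forall>y\<in>D. \<exists>k. prod_encode (k, y) \<in> S)" if "finite D" "D \<subseteq> J e" for e D
    using that
  proof (induction D rule: finite_induct)
    case empty
    show ?case by (intro exI[of _ "{}"]) (simp add: good_def)
  next
    case (insert y D)
    then obtain S where S: "good e S" "\<forall>y\<in>D. \<exists>k. prod_encode (k, y) \<in> S" by auto
    from insert.prems obtain S' k where S': "good e S'" "prod_encode (k, y) \<in> S'"
      unfolding J_def by auto
    have mono: "{y. \<exists>j<k. prod_encode (j, y) \<in> S} \<subseteq> {y. \<exists>j<k. prod_encode (j, y) \<in> S \<union> S'}"
      "{y. \<exists>j<k. prod_encode (j, y) \<in> S'} \<subseteq> {y. \<exists>j<k. prod_encode (j, y) \<in> S \<union> S'}" for k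
      by auto
    have "good e (S \<union> S')"
      unfolding good_def
    proof (intro conjI ballI)
      show "finite (S \<union> S')" using S(1) S'(1) by (simp add: good_def)
      fix m assume "m \<in> S \<union> S'"
      then show "\<exists>k z. m = prod_encode (k, z) \<and>
          \<Phi> {y. \<exists>j<k. prod_encode (j, y) \<in> S \<union> S'} (case_nat z e)"
      proof
        assume "m \<in> S"
        then obtain k z where "m = prod_encode (k, z)"
          "\<Phi> {y. \<exists>j<k. prod_encode (j, y) \<in> S} (case_nat z e)" using S(1) unfolding good_def by meson
        then show ?thesis using sigma1_op_mono[OF \<Phi>, OF _ mono(1)] by (intro exI conjI)
      next
        assume "m \<in> S'"
        then obtain k z where "m = prod_encode (k, z)"
          "\<Phi> {y. \<exists>j<k. prod_encode (j, y) \<in> S'} (case_nat z e)" using S'(1) unfolding good_def by meson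
        then show ?thesis using sigma1_op_mono[OF \<Phi>, OF _ mono(2)] by (intro exI conjI)
      qed
    qed
    with S S' show ?case by (intro exI[of _ "S \<union> S'"]) auto
  qed
  have J_closed: "z \<in> J e" if "\<Phi> (J e) (case_nat z e)" for e z
  proof -
    from sigma1_op_finite[OF \<Phi>, OF that] obtain D where D: "D \<subseteq> J e" "finite D" "\<Phi> D (case_nat z e)"
      by (elim exE conjE)
    from union[OF D(2,1)] obtain S where S: "good e S" "\<forall>y\<in>D. \<exists>k. prod_encode (k, y) \<in> S" by blast
    have "finite S" using S(1) by (simp add: good_def)
    then have "finite (fst ` prod_decode ` S)" by simp
    \<comment> \<open>\<open>K\<close> exceeds every rank in \<open>S\<close>, so \<open>z\<close>
      tagged with \<open>K\<close> may draw on all of \<open>S\<close>.\<close>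
    then obtain K where K: "\<And>k. k \<in> fst ` prod_decode ` S \<Longrightarrow> k < K"
      using finite_nat_set_iff_bounded by auto
    have K': "k < K" if "prod_encode (k, y) \<in> S" for k y
      using K[of k] that by (metis (no_types, lifting) fst_conv image_eqI prod_encode_inverse)
    let ?S = "insert (prod_encode (K, z)) S"
    have "D \<subseteq> {y. \<exists>j<K. prod_encode (j, y) \<in> ?S}" using S(2) K' by blast
    then have top: "\<Phi> {y. \<exists>j<K. prod_encode (j, y) \<in> ?S} (case_nat z e)"
      by (rule sigma1_op_mono[OF \<Phi>, OF D(3)])
    have "good e ?S"
      unfolding good_def
    proof (intro conjI ballI)
      show "finite ?S" using \<open>finite S\<close> by simp
      fix m assume "m \<in> ?S"
      then show "\<exists>k z. m = prod_encode (k, z) \<and> \<Phi> {y. \<exists>j<k. prod_encode (j, y) \<in> ?S} (case_nat z e)"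
      proof
        assume "m \<in> S"
        then obtain k z where m: "m = prod_encode (k, z)"
          "\<Phi> {y. \<exists>j<k. prod_encode (j, y) \<in> S} (case_nat z e)" using S(1) unfolding good_def by meson
        have "{y. \<exists>j<k. prod_encode (j, y) \<in> S} \<subseteq> {y. \<exists>j<k. prod_encode (j, y) \<in> ?S}" by auto
        with m(2) have "\<Phi> {y. \<exists>j<k. prod_encode (j, y) \<in> ?S} (case_nat z e)" by (rule sigma1_op_mono[OF \<Phi>])
        with m(1) show ?thesis by (intro exI conjI)
      qed (use top in blast)
    qed
    then show ?thesis unfolding J_def by blast
  qed
  have IJ: "z \<in> I e \<longleftrightarrow> z \<in> J e" for e z
    using JI[of e] least[where X = "J e" and e = e and z = z, OF J_closed] by auto
  \<comment> \<open>Finite derivations are replaced by their codes \<open>D\<close>. Members of a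
    coded set lie below the code, so checking a derivation is a bounded quantification.\<close>
  have J_memb: "z \<in> J e \<longleftrightarrow> (\<exists>D k. memb D (prod_encode (k, z)) \<and> (\<forall>m<D. \<not> memb D m \<or>
      (\<exists>k z. m = prod_encode (k, z) \<and> \<Phi> {y. \<exists>j<k. memb D (prod_encode (j, y))} (case_nat z e))))"
    (is "_ \<longleftrightarrow> (\<exists>D k. ?G D k)") for e z
  proof
    assume "z \<in> J e"
    then obtain S k where S: "good e S" "prod_encode (k, z) \<in> S" unfolding J_def by blast
    have "finite S" using S(1) by (simp add: good_def)
    then obtain D where D: "\<And>x. memb D x \<longleftrightarrow> x \<in> S" using memb_surj by metis
    have "?G D k" using S unfolding D good_def by blast
    then show "\<exists>D k. ?G D k" by blast
  next
    assume "\<exists>D k. ?G D k"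
    then obtain D k where G: "?G D k" by blast
    have "finite {x. memb D x}"
      by (rule finite_subset[of _ "{..<D}"]) (auto dest: memb_less)
    then have "good e {x. memb D x}" using G memb_less unfolding good_def by (auto 0 4)
    then show "z \<in> J e" using G unfolding J_def by blast
  qed
  \<comment> \<open>Inside all quantifiers below, the environment is \<open>z\<close>, its rank
    \<open>k\<close>, \<open>m\<close>, the outer rank, \<open>D\<close>, the element in question,
    and then the parameters from index 6 on. The indices 2 and 5 of \<open>k\<close> and
    \<open>D\<close> count one extra slot for the set variable.\<close>
  let ?R = "\<lambda>e. \<exists>j<e 2. memb (e 5) (prod_encode (j, e 0))"
  have memb_rel: "sigma1 (\<lambda>e. memb (s e) (t e))" if "sigma1_fun s" "sigma1_fun t" for s t
    using sigma1_comp2[of memb, OF sigma1_delta0[OF delta0_memb] that] .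
  have "?R = (\<lambda>e. \<exists>j. j < e 2 \<and> memb (e 5) (prod_encode (j, e 0)))" by blast
  moreover have "sigma1 (\<lambda>e. \<exists>j. j < e 2 \<and> memb (e 5) (prod_encode (j, e 0)))"
    by (intro sigma1_intros memb_rel)
  ultimately have "sigma1 ?R" by simp
  then have "sigma1 (\<lambda>e. \<Phi> {y. ?R (case_nat y e)} (\<lambda>i. e (case_nat 0 (\<lambda>i. i + 6) i)))"
    by (rule sigma1_op_subst[OF \<Phi>])
  moreover have "(\<lambda>i. e (case_nat 0 (\<lambda>i. i + 6) i)) = case_nat (e 0) (\<lambda>i. e (Suc (Suc (Suc (Suc (Suc (Suc i)))))))"
    for e :: "nat \<Rightarrow> nat"
    by (rule ext) (simp split: nat.split add: eval_nat_numeral)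
  ultimately have step: "sigma1 (\<lambda>e. \<Phi> {y. \<exists>j<e (Suc 0). memb (e (Suc (Suc (Suc (Suc 0))))) (prod_encode (j, y))}
      (case_nat (e 0) (\<lambda>i. e (Suc (Suc (Suc (Suc (Suc (Suc i)))))))))"
    by (simp add: eval_nat_numeral)
  have "sigma1 (\<lambda>e. \<exists>D k. memb D (prod_encode (k, e 0)) \<and> (\<forall>m<D. \<not> memb D m \<or>
      (\<exists>k z. m = prod_encode (k, z) \<and>
        \<Phi> {y. \<exists>j<k. memb D (prod_encode (j, y))} (case_nat z (\<lambda>i. e (Suc i))))))"
    apply (rule sigma1_ex)
    apply (rule sigma1_ex)
    apply (rule sigma1_and)
     apply (intro memb_rel sigma1_intros)
    apply (rule sigma1_ball[OF _ poly_var])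
    apply (rule sigma1_or)
     apply (rule sigma1_delta0[OF delta0_not[OF delta0_memb]])
    apply (rule sigma1_ex)
    apply (rule sigma1_ex)
    apply (rule sigma1_and)
     apply (intro sigma1_intros)
    apply (rule step)
    done
  then show ?thesis unfolding IJ J_memb .
qed

lemmas sigma1_op_intros = sigma1_op_const sigma1_op_and sigma1_op_or sigma1_op_ex sigma1_op_mem

section \<open>Arithmetization of the calculus\<close>

lemma sigma1_fun_ren:
  assumes "sigma1_fun t"
  shows "sigma1_fun (\<lambda>e. t (\<lambda>i. e (\<pi> i)))"
  using sigma1_ren[OF assms[unfolded sigma1_fun_def], of "case_nat 0 (\<lambda>i. Suc (\<pi> i))"] unfolding sigma1_fun_def by simp

text \<open>The graph, as a set of coded pairs, is the least set containing the initial pair and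
  closed under the recursion step, so no coding of computation sequences is needed.\<close>

lemma sigma1_fun_rec:
  assumes "sigma1_fun G" "sigma1_fun (\<lambda>e. H (e 0) (e (Suc 0)) (\<lambda>i. e (Suc (Suc i))))" "sigma1_fun t"
  shows "sigma1_fun (\<lambda>e. rec_nat (G e) (\<lambda>k r. H k r e) (t e))"
proof -
  define f where "f e = rec_nat (G e) (\<lambda>k r. H k r e)" for e
  have f: "f e 0 = G e" "f e (Suc k) = H k (f e k) e" for e k by (simp_all add: f_def)
  define I where "I e = range (\<lambda>k. prod_encode (k, f e k))" for e
  have H: "sigma1_fun (\<lambda>e. H (e (Suc 0)) (e 0) (\<lambda>i. e (Suc (Suc (Suc i)))))"
    using sigma1_fun_ren[OF assms(2), of "case_nat (Suc 0) (case_nat 0 (\<lambda>i. Suc (Suc (Suc i))))"] by simp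
  have "sigma1 (\<lambda>e. e 0 \<in> I (\<lambda>i. e (Suc i)))"
  proof (rule sigma1_lfp[where \<Phi> = "\<lambda>X e. e 0 = prod_encode (0, G (\<lambda>i. e (Suc i))) \<or>
      (\<exists>k r. prod_encode (k, r) \<in> X \<and> e 0 = prod_encode (Suc k, H k r (\<lambda>i. e (Suc i))))"])
    show "sigma1_op (\<lambda>X e. e 0 = prod_encode (0, G (\<lambda>i. e (Suc i))) \<or>
      (\<exists>k r. prod_encode (k, r) \<in> X \<and> e 0 = prod_encode (Suc k, H k r (\<lambda>i. e (Suc i)))))"
      by (intro sigma1_op_intros sigma1_intros sigma1_fun_shift[OF assms(1)] H)
  next
    fix e z
    assume "case_nat z e 0 = prod_encode (0, G (\<lambda>i. case_nat z e (Suc i))) \<or>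
      (\<exists>k r. prod_encode (k, r) \<in> I e \<and>
        case_nat z e 0 = prod_encode (Suc k, H k r (\<lambda>i. case_nat z e (Suc i))))"
    then have "z = prod_encode (0, f e 0) \<or> (\<exists>k. z = prod_encode (Suc k, f e (Suc k)))"
      by (auto simp: f I_def)
    then show "z \<in> I e" unfolding I_def by blast
  next
    fix e X z
    assume h: "\<And>z. case_nat z e 0 = prod_encode (0, G (\<lambda>i. case_nat z e (Suc i))) \<or>
      (\<exists>k r. prod_encode (k, r) \<in> X \<and>
        case_nat z e 0 = prod_encode (Suc k, H k r (\<lambda>i. case_nat z e (Suc i)))) \<Longrightarrow> z \<in> X"
    have "prod_encode (k, f e k) \<in> X" for k
    proof (induction k)
      case 0
      show ?case by (rule h) (simp add: f)
    next
      case (Suc k)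
      show ?case
        by (rule h, rule disjI2, rule exI[of _ k], rule exI[of _ "f e k"]) (use Suc in \<open>simp add: f\<close>)
    qed
    then show "z \<in> I e \<Longrightarrow> z \<in> X" unfolding I_def by blast
  qed
  from sigma1_ren[OF this, of "case_nat 0 (\<lambda>i. Suc (Suc i))"]
  have "sigma1 (\<lambda>e. e 0 \<in> I (\<lambda>i. e (Suc (Suc i))))" by simp
  from sigma1_inst[OF this sigma1_fun_pair[OF sigma1_fun_shift[OF assms(3)] sigma1_fun_var[of 0]]]
  have "sigma1 (\<lambda>e. prod_encode (t (\<lambda>i. e (Suc i)), e 0) \<in> I (\<lambda>i. e (Suc i)))" by simp
  moreover have "prod_encode (k, y) \<in> I e \<longleftrightarrow> y = f e k" for e k y
    unfolding I_def by auto
  ultimately show ?thesis unfolding sigma1_fun_def f_def by simp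
qed

text \<open>The arguments are generalized from variables to \<Sigma>1 functions of the environment;
  composition then feeds the inner functions to the induction hypothesis of the outer one.\<close>

lemma primrec_sigma1_fun:
  "primrec_fun n f \<Longrightarrow> length ts = n \<Longrightarrow> (\<And>t. t \<in> set ts \<Longrightarrow> sigma1_fun t) \<Longrightarrow> sigma1_fun (\<lambda>e. f (map (\<lambda>t. t e) ts))"
proof (induction arbitrary: ts rule: primrec_fun.induct)
  case (zero n)
  show ?case by (rule sigma1_fun_const)
next
  case succ
  then have "sigma1_fun (ts ! 0)" by simp
  from sigma1_fun_Suc[OF this] show ?case using succ by simp
next
  case (proj i n)
  then have "sigma1_fun (ts ! i)" by simp
  with proj show ?case by simp
next
  case (comp gs h n)
  have "sigma1_fun (\<lambda>e. h (map (\<lambda>t. t e) (map (\<lambda>g e. g (map (\<lambda>t. t e) ts)) gs)))"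
    using comp by (intro comp.IH(1)) auto
  then show ?case by (simp add: comp_def)
next
  case (prec n g h)
  then obtain t us where ts: "ts = t # us" by (cases ts) auto
  have us: "length us = n" "\<And>u. u \<in> set us \<Longrightarrow> sigma1_fun u" "sigma1_fun t" using prec.prems ts by auto
  have G: "sigma1_fun (\<lambda>e. g (map (\<lambda>t. t e) us))" using us by (intro prec.IH(1)) auto
  let ?vs = "(\<lambda>e. e 0) # (\<lambda>e. e (Suc 0)) # map (\<lambda>u e. u (\<lambda>i. e (Suc (Suc i)))) us"
  have "sigma1_fun (\<lambda>e. h (map (\<lambda>t. t e) ?vs))"
    using us by (intro prec.IH(2)) (auto intro: sigma1_fun_var sigma1_fun_ren)
  then have H: "sigma1_fun (\<lambda>e. h (e 0 # e (Suc 0) # map (\<lambda>u. u (\<lambda>i. e (Suc (Suc i)))) us))"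
    by (simp add: comp_def)
  show ?case
    using sigma1_fun_rec[of _ "\<lambda>k r e. h (k # r # map (\<lambda>u. u e) us)" t, OF G H us(3)] by (simp add: ts)
qed

lemma sigma1_primrec_set:
  assumes "primrec_set X"
  shows "sigma1 (\<lambda>e. e 0 \<in> X)"
proof -
  from assms obtain f where f: "primrec_fun 1 f" "\<And>n. f [n] = (if n \<in> X then 1 else 0)"
    unfolding primrec_set_def by blast
  have "sigma1_fun (\<lambda>e. f (map (\<lambda>t. t e) [\<lambda>e. e 0]))"
    by (rule primrec_sigma1_fun[OF f(1)]) (auto intro: sigma1_fun_var)
  from sigma1_eq[OF this sigma1_fun_const[of 1]] have "sigma1 (\<lambda>e. f [e 0] = 1)" by simp
  then show ?thesis unfolding f(2) by (simp split: if_splits)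
qed

lemma sigma1_fun_gn_num:
  assumes "sigma1_fun t"
  shows "sigma1_fun (\<lambda>e. gn_tm (num (t e)))"
proof -
  have "gn_tm (num n) = rec_nat (prod_encode (1, 0)) (\<lambda>k r. prod_encode (2, r)) n" for n
    by (induction n) simp_all
  moreover have "sigma1_fun (\<lambda>e. rec_nat (prod_encode (1, 0)) (\<lambda>k r. prod_encode (2, r)) (t e))"
    by (rule sigma1_fun_rec[OF _ _ assms, of _ "\<lambda>k r e. prod_encode (2, r)"]) (intro sigma1_intros)+
  ultimately show ?thesis by simp
qed

section \<open>Codes of terms and formulas\<close>

lemma gn_tm_eq [simp]: "gn_tm s = gn_tm t \<longleftrightarrow> s = t"
  using gn_tm_inject by auto

lemma gn_eq [simp]: "gn \<phi> = gn \<psi> \<longleftrightarrow> \<phi> = \<psi>"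
  using gn_inject by auto

text \<open>Opens exactly one outermost symbol, so that the disjuncts match the generating clauses
  of the operators below. As a general rewrite rule it would loop, hence it is applied by single
  steps.\<close>

lemma ex_tm: "(\<exists>t. P t) \<longleftrightarrow> (\<exists>x. P (Var x)) \<or> P Zero \<or> (\<exists>t. P (Succ t)) \<or>
    (\<exists>s t. P (Add s t)) \<or> (\<exists>s t. P (Mult s t))"
  by (metis tm.exhaust)

lemma ex_fm: "(\<exists>\<phi>. P \<phi>) \<longleftrightarrow> (\<exists>s t. P (Eq s t)) \<or> (\<exists>s t. P (Lt s t)) \<or> (\<exists>\<phi>. P (Neg \<phi>)) \<or>
    (\<exists>\<phi> \<psi>. P (And \<phi> \<psi>)) \<or> (\<exists>\<phi> \<psi>. P (Or \<phi> \<psi>)) \<or> (\<exists>\<phi> \<psi>. P (Imp \<phi> \<psi>)) \<or>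
    (\<exists>x \<phi>. P (All x \<phi>)) \<or> (\<exists>x \<phi>. P (Ex x \<phi>))"
  by (metis fm.exhaust)

abbreviation pr :: "nat \<Rightarrow> nat \<Rightarrow> nat" where
  "pr a b \<equiv> prod_encode (a, b)"

definition Tm :: "nat \<Rightarrow> bool" where
  "Tm a \<longleftrightarrow> (\<exists>t. a = gn_tm t)"

definition Fm :: "nat \<Rightarrow> bool" where
  "Fm a \<longleftrightarrow> (\<exists>\<phi>. a = gn \<phi>)"

text \<open>Non-occurrence is generated directly: the side conditions of the calculus are negative,
  and \<Sigma>1 relations are not closed under complement.\<close>

definition NfvT :: "nat \<Rightarrow> nat \<Rightarrow> bool" where
  "NfvT x a \<longleftrightarrow> (\<exists>t. a = gn_tm t \<and> x \<notin> fv_tm t)"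

definition Nfv :: "nat \<Rightarrow> nat \<Rightarrow> bool" where
  "Nfv x a \<longleftrightarrow> (\<exists>\<phi>. a = gn \<phi> \<and> x \<notin> fv \<phi>)"

text \<open>Input and output are packed into one code because the fixed point theorem generates sets
  of numbers; \<open>x\<close> and \<open>u\<close> stay parameters.\<close>

definition SubT :: "nat \<Rightarrow> nat \<Rightarrow> nat \<Rightarrow> bool" where
  "SubT x u z \<longleftrightarrow> (\<exists>v t. u = gn_tm v \<and> z = pr (gn_tm t) (gn_tm (subst_tm x v t)))"

definition Sub :: "nat \<Rightarrow> nat \<Rightarrow> nat \<Rightarrow> bool" where
  "Sub x u z \<longleftrightarrow> (\<exists>v \<phi>. u = gn_tm v \<and> z = pr (gn \<phi>) (gn (subst x v \<phi>)))"

definition Sbl :: "nat \<Rightarrow> nat \<Rightarrow> nat \<Rightarrow> bool" where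
  "Sbl x u a \<longleftrightarrow> (\<exists>v \<phi>. u = gn_tm v \<and> a = gn \<phi> \<and> substitutable x v \<phi>)"

lemma sigma1_Tm0: "sigma1 (\<lambda>e. Tm (e 0))"
proof -
  let ?\<Phi> = "\<lambda>X e. (\<exists>x. e 0 = pr 0 x) \<or> e 0 = pr 1 0 \<or> (\<exists>a. a \<in> X \<and> e 0 = pr 2 a) \<or>
    (\<exists>a b. a \<in> X \<and> b \<in> X \<and> (e 0 = pr 3 (pr a b) \<or> e 0 = pr 4 (pr a b)))"
  have "sigma1 (\<lambda>e. e 0 \<in> {a. Tm a})"
  proof (rule sigma1_lfp[where \<Phi> = ?\<Phi> and I = "\<lambda>e. {a. Tm a}"])
    show "sigma1_op ?\<Phi>" by (intro sigma1_op_intros sigma1_intros)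
    show "z \<in> {a. Tm a}" if "?\<Phi> {a. Tm a} (case_nat z e)" for z e
      using that unfolding Tm_def by (subst mem_Collect_eq, subst ex_tm) auto
    show "z \<in> X" if h: "\<And>z. ?\<Phi> X (case_nat z e) \<Longrightarrow> z \<in> X" and z: "z \<in> {a. Tm a}" for e X z
    proof -
      have "gn_tm t \<in> X" for t by (induction t) (rule h, simp)+
      then show ?thesis using z by (auto simp: Tm_def)
    qed
  qed
  then show ?thesis by simp
qed

lemma sigma1_Tm: "sigma1_fun s \<Longrightarrow> sigma1 (\<lambda>e. Tm (s e))"
  by (rule sigma1_comp1[of Tm, OF sigma1_Tm0])

lemma sigma1_NfvT:
  assumes "sigma1_fun s" "sigma1_fun t"
  shows "sigma1 (\<lambda>e. NfvT (s e) (t e))"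
proof -
  let ?\<Phi> = "\<lambda>X e. (\<exists>x. x \<noteq> e (Suc 0) \<and> e 0 = pr 0 x) \<or> e 0 = pr 1 0 \<or> (\<exists>a. a \<in> X \<and> e 0 = pr 2 a) \<or>
    (\<exists>a b. a \<in> X \<and> b \<in> X \<and> (e 0 = pr 3 (pr a b) \<or> e 0 = pr 4 (pr a b)))"
  let ?I = "\<lambda>e :: nat \<Rightarrow> nat. {a. NfvT (e 0) a}"
  have "sigma1 (\<lambda>e. e 0 \<in> ?I (\<lambda>i. e (Suc i)))"
  proof (rule sigma1_lfp[where \<Phi> = ?\<Phi> and I = ?I])
    show "sigma1_op ?\<Phi>" by (intro sigma1_op_intros sigma1_intros)
    show "z \<in> ?I e" if "?\<Phi> (?I e) (case_nat z e)" for z e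
      using that unfolding NfvT_def by (subst mem_Collect_eq, subst ex_tm) auto
    show "z \<in> X" if h: "\<And>z. ?\<Phi> X (case_nat z e) \<Longrightarrow> z \<in> X" and z: "z \<in> ?I e" for e X z
    proof -
      have "e 0 \<notin> fv_tm t \<Longrightarrow> gn_tm t \<in> X" for t by (induction t) (rule h, simp)+
      then show ?thesis using z by (auto simp: NfvT_def)
    qed
  qed
  then have "sigma1 (\<lambda>e. NfvT (e 1) (e 0))" by simp
  from sigma1_comp2[of "\<lambda>a x. NfvT x a", OF this assms(2,1)] show ?thesis .
qed

lemma sigma1_Fm:
  assumes "sigma1_fun s"
  shows "sigma1 (\<lambda>e. Fm (s e))"
proof -
  let ?\<Phi> = "\<lambda>X e. (\<exists>a b. Tm a \<and> Tm b \<and> (e 0 = pr 0 (pr a b) \<or> e 0 = pr 1 (pr a b))) \<or>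
    (\<exists>a. a \<in> X \<and> e 0 = pr 2 a) \<or>
    (\<exists>a b. a \<in> X \<and> b \<in> X \<and> (e 0 = pr 3 (pr a b) \<or> e 0 = pr 4 (pr a b) \<or> e 0 = pr 5 (pr a b))) \<or>
    (\<exists>x a. a \<in> X \<and> (e 0 = pr 6 (pr x a) \<or> e 0 = pr 7 (pr x a)))"
  have "sigma1 (\<lambda>e. e 0 \<in> {a. Fm a})"
  proof (rule sigma1_lfp[where \<Phi> = ?\<Phi> and I = "\<lambda>e. {a. Fm a}"])
    show "sigma1_op ?\<Phi>" by (intro sigma1_op_intros sigma1_intros sigma1_Tm)
    show "z \<in> {a. Fm a}" if "?\<Phi> {a. Fm a} (case_nat z e)" for z e
      using that unfolding Fm_def Tm_def by (subst mem_Collect_eq, subst ex_fm) auto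
    show "z \<in> X" if h: "\<And>z. ?\<Phi> X (case_nat z e) \<Longrightarrow> z \<in> X" and z: "z \<in> {a. Fm a}" for e X z
    proof -
      have "gn \<phi> \<in> X" for \<phi> by (induction \<phi>) (rule h, simp add: Tm_def)+
      then show ?thesis using z by (auto simp: Fm_def)
    qed
  qed
  then have "sigma1 (\<lambda>e. Fm (e 0))" by simp
  from sigma1_comp1[of Fm, OF this assms] show ?thesis .
qed

lemma sigma1_Nfv:
  assumes "sigma1_fun s" "sigma1_fun t"
  shows "sigma1 (\<lambda>e. Nfv (s e) (t e))"
proof -
  let ?\<Phi> = "\<lambda>X e. (\<exists>a b. NfvT (e (Suc 0)) a \<and> NfvT (e (Suc 0)) b \<and> (e 0 = pr 0 (pr a b) \<or> e 0 = pr 1 (pr a b))) \<or>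
    (\<exists>a. a \<in> X \<and> e 0 = pr 2 a) \<or>
    (\<exists>a b. a \<in> X \<and> b \<in> X \<and> (e 0 = pr 3 (pr a b) \<or> e 0 = pr 4 (pr a b) \<or> e 0 = pr 5 (pr a b))) \<or>
    (\<exists>x a. (x = e (Suc 0) \<and> Fm a \<or> a \<in> X) \<and> (e 0 = pr 6 (pr x a) \<or> e 0 = pr 7 (pr x a)))"
  let ?I = "\<lambda>e :: nat \<Rightarrow> nat. {a. Nfv (e 0) a}"
  have "sigma1 (\<lambda>e. e 0 \<in> ?I (\<lambda>i. e (Suc i)))"
  proof (rule sigma1_lfp[where \<Phi> = ?\<Phi> and I = ?I])
    show "sigma1_op ?\<Phi>" by (intro sigma1_op_intros sigma1_intros sigma1_NfvT sigma1_Fm)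
    show "z \<in> ?I e" if "?\<Phi> (?I e) (case_nat z e)" for z e
      using that unfolding Nfv_def NfvT_def Fm_def by (subst mem_Collect_eq, subst ex_fm) auto
    show "z \<in> X" if h: "\<And>z. ?\<Phi> X (case_nat z e) \<Longrightarrow> z \<in> X" and z: "z \<in> ?I e" for e X z
    proof -
      have "e 0 \<notin> fv \<phi> \<Longrightarrow> gn \<phi> \<in> X" for \<phi>
        by (induction \<phi>) (rule h, force simp: NfvT_def Fm_def)+
      then show ?thesis using z by (auto simp: Nfv_def)
    qed
  qed
  then have "sigma1 (\<lambda>e. Nfv (e 1) (e 0))" by simp
  from sigma1_comp2[of "\<lambda>a x. Nfv x a", OF this assms(2,1)] show ?thesis .
qed

lemma sigma1_SubT:
  assumes "sigma1_fun r" "sigma1_fun s" "sigma1_fun t"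
  shows "sigma1 (\<lambda>e. SubT (r e) (s e) (t e))"
proof -
  let ?\<Phi> = "\<lambda>X e. Tm (e (Suc (Suc 0))) \<and> (e 0 = pr (pr 0 (e (Suc 0))) (e (Suc (Suc 0))) \<or>
    (\<exists>x. x \<noteq> e (Suc 0) \<and> e 0 = pr (pr 0 x) (pr 0 x)) \<or> e 0 = pr (pr 1 0) (pr 1 0) \<or>
    (\<exists>a a'. pr a a' \<in> X \<and> e 0 = pr (pr 2 a) (pr 2 a')) \<or>
    (\<exists>a a' b b'. pr a a' \<in> X \<and> pr b b' \<in> X \<and>
      (e 0 = pr (pr 3 (pr a b)) (pr 3 (pr a' b')) \<or> e 0 = pr (pr 4 (pr a b)) (pr 4 (pr a' b')))))"
  let ?I = "\<lambda>e :: nat \<Rightarrow> nat. {a. SubT (e 0) (e (Suc 0)) a}"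
  have "sigma1 (\<lambda>e. e 0 \<in> ?I (\<lambda>i. e (Suc i)))"
  proof (rule sigma1_lfp[where \<Phi> = ?\<Phi> and I = ?I])
    show "sigma1_op ?\<Phi>" by (intro sigma1_op_intros sigma1_intros sigma1_Tm)
    show "z \<in> ?I e" if "?\<Phi> (?I e) (case_nat z e)" for z e
    proof -
      from that obtain v where v: "e (Suc 0) = gn_tm v" by (auto simp: Tm_def)
      show ?thesis
        using that unfolding SubT_def v by (simp, subst ex_tm) (auto simp: v)
    qed
    show "z \<in> X" if h: "\<And>z. ?\<Phi> X (case_nat z e) \<Longrightarrow> z \<in> X" and z: "z \<in> ?I e" for e X z
    proof -
      from z obtain v t where v: "e (Suc 0) = gn_tm v"
        and z: "z = pr (gn_tm t) (gn_tm (subst_tm (e 0) v t))" by (auto simp: SubT_def)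
      have "pr (gn_tm t) (gn_tm (subst_tm (e 0) v t)) \<in> X"
        by (induction t) (rule h, simp add: v Tm_def)+
      then show ?thesis using z by simp
    qed
  qed
  then have "sigma1 (\<lambda>e. SubT (e 1) (e 2) (e 0))" by (simp add: numeral_2_eq_2)
  from sigma1_comp3[of "\<lambda>a x u. SubT x u a", OF this assms(3,1,2)] show ?thesis .
qed

lemma sigma1_Sub:
  assumes "sigma1_fun r" "sigma1_fun s" "sigma1_fun t"
  shows "sigma1 (\<lambda>e. Sub (r e) (s e) (t e))"
proof -
  let ?\<Phi> = "\<lambda>X e. Tm (e (Suc (Suc 0))) \<and> (
    (\<exists>a a' b b'. SubT (e (Suc 0)) (e (Suc (Suc 0))) (pr a a') \<and> SubT (e (Suc 0)) (e (Suc (Suc 0))) (pr b b') \<and>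
      (e 0 = pr (pr 0 (pr a b)) (pr 0 (pr a' b')) \<or> e 0 = pr (pr 1 (pr a b)) (pr 1 (pr a' b')))) \<or>
    (\<exists>a a'. pr a a' \<in> X \<and> e 0 = pr (pr 2 a) (pr 2 a')) \<or>
    (\<exists>a a' b b'. pr a a' \<in> X \<and> pr b b' \<in> X \<and>
      (e 0 = pr (pr 3 (pr a b)) (pr 3 (pr a' b')) \<or> e 0 = pr (pr 4 (pr a b)) (pr 4 (pr a' b')) \<or>
        e 0 = pr (pr 5 (pr a b)) (pr 5 (pr a' b')))) \<or>
    (\<exists>x a a'. (x = e (Suc 0) \<and> a = a' \<and> Fm a \<or> x \<noteq> e (Suc 0) \<and> pr a a' \<in> X) \<and>
      (e 0 = pr (pr 6 (pr x a)) (pr 6 (pr x a')) \<or> e 0 = pr (pr 7 (pr x a)) (pr 7 (pr x a')))))"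
  let ?I = "\<lambda>e :: nat \<Rightarrow> nat. {a. Sub (e 0) (e (Suc 0)) a}"
  have "sigma1 (\<lambda>e. e 0 \<in> ?I (\<lambda>i. e (Suc i)))"
  proof (rule sigma1_lfp[where \<Phi> = ?\<Phi> and I = ?I])
    show "sigma1_op ?\<Phi>" by (intro sigma1_op_intros sigma1_intros sigma1_Tm sigma1_Fm sigma1_SubT)
    show "z \<in> ?I e" if "?\<Phi> (?I e) (case_nat z e)" for z e
    proof -
      from that obtain v where v: "e (Suc 0) = gn_tm v" by (auto simp: Tm_def)
      show ?thesis
        using that unfolding Sub_def SubT_def Fm_def v by (simp, subst ex_fm) (auto simp: v)
    qed
    show "z \<in> X" if h: "\<And>z. ?\<Phi> X (case_nat z e) \<Longrightarrow> z \<in> X" and z: "z \<in> ?I e" for e X z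
    proof -
      from z obtain v \<phi> where v: "e (Suc 0) = gn_tm v"
        and z: "z = pr (gn \<phi>) (gn (subst (e 0) v \<phi>))" by (auto simp: Sub_def)
      have "pr (gn \<phi>) (gn (subst (e 0) v \<phi>)) \<in> X"
        by (induction \<phi>) (rule h, force simp: v Tm_def SubT_def Fm_def)+
      then show ?thesis using z by simp
    qed
  qed
  then have "sigma1 (\<lambda>e. Sub (e 1) (e 2) (e 0))" by (simp add: numeral_2_eq_2)
  from sigma1_comp3[of "\<lambda>a x u. Sub x u a", OF this assms(3,1,2)] show ?thesis .
qed

text \<open>In the quantifier clause, the condition that the variable is not free in the quantified
  formula is split: the quantifier binds this very variable, or the variable is not free in the
  body.\<close>

lemma sigma1_Sbl:
  assumes "sigma1_fun r" "sigma1_fun s" "sigma1_fun t"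
  shows "sigma1 (\<lambda>e. Sbl (r e) (s e) (t e))"
proof -
  let ?\<Phi> = "\<lambda>X e. Tm (e (Suc (Suc 0))) \<and> (
    (\<exists>a b. Tm a \<and> Tm b \<and> (e 0 = pr 0 (pr a b) \<or> e 0 = pr 1 (pr a b))) \<or>
    (\<exists>a. a \<in> X \<and> e 0 = pr 2 a) \<or>
    (\<exists>a b. a \<in> X \<and> b \<in> X \<and> (e 0 = pr 3 (pr a b) \<or> e 0 = pr 4 (pr a b) \<or> e 0 = pr 5 (pr a b))) \<or>
    (\<exists>x a. (x = e (Suc 0) \<and> Fm a \<or> Nfv (e (Suc 0)) a \<or> NfvT x (e (Suc (Suc 0))) \<and> a \<in> X) \<and>
      (e 0 = pr 6 (pr x a) \<or> e 0 = pr 7 (pr x a))))"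
  let ?I = "\<lambda>e :: nat \<Rightarrow> nat. {a. Sbl (e 0) (e (Suc 0)) a}"
  have "sigma1 (\<lambda>e. e 0 \<in> ?I (\<lambda>i. e (Suc i)))"
  proof (rule sigma1_lfp[where \<Phi> = ?\<Phi> and I = ?I])
    show "sigma1_op ?\<Phi>" by (intro sigma1_op_intros sigma1_intros sigma1_Tm sigma1_Fm sigma1_Nfv sigma1_NfvT)
    show "z \<in> ?I e" if "?\<Phi> (?I e) (case_nat z e)" for z e
    proof -
      from that obtain v where v: "e (Suc 0) = gn_tm v" by (auto simp: Tm_def)
      show ?thesis
        using that unfolding Sbl_def Fm_def Tm_def Nfv_def NfvT_def v by (simp, subst ex_fm) (auto simp: v)
    qed
    show "z \<in> X" if h: "\<And>z. ?\<Phi> X (case_nat z e) \<Longrightarrow> z \<in> X" and z: "z \<in> ?I e" for e X z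
    proof -
      from z obtain v \<phi> where v: "e (Suc 0) = gn_tm v"
        and z: "z = gn \<phi>" "substitutable (e 0) v \<phi>" by (auto simp: Sbl_def)
      have "substitutable (e 0) v \<phi> \<Longrightarrow> gn \<phi> \<in> X"
        by (induction \<phi>) (rule h, force simp: v Tm_def Fm_def Nfv_def NfvT_def)+
      then show ?thesis using z by simp
    qed
  qed
  then have "sigma1 (\<lambda>e. Sbl (e 1) (e 2) (e 0))" by (simp add: numeral_2_eq_2)
  from sigma1_comp3[of "\<lambda>a x u. Sbl x u a", OF this assms(3,1,2)] show ?thesis .
qed

section \<open>Codes of logical axioms and of theorems\<close>

abbreviation imp_code :: "nat \<Rightarrow> nat \<Rightarrow> nat" where
  "imp_code a b \<equiv> pr 5 (pr a b)"

definition Ax :: "nat \<Rightarrow> bool" where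
  "Ax z \<longleftrightarrow>
    (\<exists>a b. Fm a \<and> Fm b \<and> (z = imp_code a (imp_code b a) \<or>
      z = imp_code (pr 3 (pr a b)) a \<or> z = imp_code (pr 3 (pr a b)) b \<or>
      z = imp_code a (imp_code b (pr 3 (pr a b))) \<or>
      z = imp_code a (pr 4 (pr a b)) \<or> z = imp_code b (pr 4 (pr a b)) \<or>
      z = imp_code (imp_code a b) (imp_code (imp_code a (pr 2 b)) (pr 2 a)) \<or>
      z = imp_code (pr 2 (pr 2 a)) a)) \<or>
    (\<exists>a b c. Fm a \<and> Fm b \<and> Fm c \<and>
      (z = imp_code (imp_code a (imp_code b c)) (imp_code (imp_code a b) (imp_code a c)) \<or>
       z = imp_code (imp_code a c) (imp_code (imp_code b c) (imp_code (pr 4 (pr a b)) c)))) \<or>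
    (\<exists>x u a a'. Sbl x u a \<and> Sub x u (pr a a') \<and>
      (z = imp_code (pr 6 (pr x a)) a' \<or> z = imp_code a' (pr 7 (pr x a)))) \<or>
    (\<exists>x a b. Nfv x a \<and> Fm b \<and> z = imp_code (pr 6 (pr x (imp_code a b))) (imp_code a (pr 6 (pr x b)))) \<or>
    (\<exists>x a b. Nfv x b \<and> Fm a \<and> z = imp_code (pr 6 (pr x (imp_code a b))) (imp_code (pr 7 (pr x a)) b)) \<or>
    (\<exists>u. Tm u \<and> z = pr 0 (pr u u)) \<or>
    (\<exists>x u v a b c. Sbl x u a \<and> Sbl x v a \<and> Sub x u (pr a b) \<and> Sub x v (pr a c) \<and>
      z = imp_code (pr 0 (pr u v)) (imp_code b c))"

lemma sigma1_Ax: "sigma1 (\<lambda>e. Ax (e 0))"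
  unfolding Ax_def by (intro sigma1_intros sigma1_Fm sigma1_Tm sigma1_Nfv sigma1_Sub sigma1_Sbl)

lemma AxI:
  "Ax (gn (Imp \<phi> (Imp \<psi> \<phi>)))" "Ax (gn (Imp (And \<phi> \<psi>) \<phi>))" "Ax (gn (Imp (And \<phi> \<psi>) \<psi>))"
  "Ax (gn (Imp \<phi> (Imp \<psi> (And \<phi> \<psi>))))" "Ax (gn (Imp \<phi> (Or \<phi> \<psi>)))" "Ax (gn (Imp \<psi> (Or \<phi> \<psi>)))"
  "Ax (gn (Imp (Imp \<phi> \<psi>) (Imp (Imp \<phi> (Neg \<psi>)) (Neg \<phi>))))" "Ax (gn (Imp (Neg (Neg \<phi>)) \<phi>))"
  "Ax (gn (Imp (Imp \<phi> (Imp \<psi> \<chi>)) (Imp (Imp \<phi> \<psi>) (Imp \<phi> \<chi>))))"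
  "Ax (gn (Imp (Imp \<phi> \<chi>) (Imp (Imp \<psi> \<chi>) (Imp (Or \<phi> \<psi>) \<chi>))))"
  "substitutable x t \<phi> \<Longrightarrow> Ax (gn (Imp (All x \<phi>) (subst x t \<phi>)))"
  "substitutable x t \<phi> \<Longrightarrow> Ax (gn (Imp (subst x t \<phi>) (Ex x \<phi>)))"
  "x \<notin> fv \<phi> \<Longrightarrow> Ax (gn (Imp (All x (Imp \<phi> \<psi>)) (Imp \<phi> (All x \<psi>))))"
  "x \<notin> fv \<psi> \<Longrightarrow> Ax (gn (Imp (All x (Imp \<phi> \<psi>)) (Imp (Ex x \<phi>) \<psi>)))"
  "Ax (gn (Eq t t))"
  "substitutable x s \<phi> \<Longrightarrow> substitutable x t \<phi> \<Longrightarrow>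
    Ax (gn (Imp (Eq s t) (Imp (subst x s \<phi>) (subst x t \<phi>))))"
proof -
  have F: "Fm (gn \<phi>)" for \<phi> by (auto simp: Fm_def)
  show "Ax (gn (Imp \<phi> (Imp \<psi> \<phi>)))" "Ax (gn (Imp (And \<phi> \<psi>) \<phi>))" "Ax (gn (Imp (And \<phi> \<psi>) \<psi>))"
    "Ax (gn (Imp \<phi> (Imp \<psi> (And \<phi> \<psi>))))" "Ax (gn (Imp \<phi> (Or \<phi> \<psi>)))" "Ax (gn (Imp \<psi> (Or \<phi> \<psi>)))"
    "Ax (gn (Imp (Imp \<phi> \<psi>) (Imp (Imp \<phi> (Neg \<psi>)) (Neg \<phi>))))" "Ax (gn (Imp (Neg (Neg \<phi>)) \<phi>))"
    unfolding Ax_def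
    by (rule disjI1, rule exI[of _ "gn \<phi>"], rule exI[of _ "gn \<psi>"], simp add: F)+
  show "Ax (gn (Imp (Imp \<phi> (Imp \<psi> \<chi>)) (Imp (Imp \<phi> \<psi>) (Imp \<phi> \<chi>))))"
    "Ax (gn (Imp (Imp \<phi> \<chi>) (Imp (Imp \<psi> \<chi>) (Imp (Or \<phi> \<psi>) \<chi>))))"
    unfolding Ax_def
    by (rule disjI2, rule disjI1, rule exI[of _ "gn \<phi>"], rule exI[of _ "gn \<psi>"], rule exI[of _ "gn \<chi>"],
        simp add: F)+
  have S: "Sub x (gn_tm t) (pr (gn \<phi>) (gn (subst x t \<phi>)))" for x t \<phi>
    by (auto simp: Sub_def)
  have B: "Sbl x (gn_tm t) (gn \<phi>)" if "substitutable x t \<phi>" for x t \<phi>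
    using that by (auto simp: Sbl_def)
  show "Ax (gn (Imp (All x \<phi>) (subst x t \<phi>)))" "Ax (gn (Imp (subst x t \<phi>) (Ex x \<phi>)))"
    if "substitutable x t \<phi>"
    unfolding Ax_def
    by (rule disjI2, rule disjI2, rule disjI1, rule exI[of _ x], rule exI[of _ "gn_tm t"],
        rule exI[of _ "gn \<phi>"], rule exI[of _ "gn (subst x t \<phi>)"], simp add: S B that)+
  show "Ax (gn (Imp (All x (Imp \<phi> \<psi>)) (Imp \<phi> (All x \<psi>))))" if "x \<notin> fv \<phi>"
    unfolding Ax_def
    by (rule disjI2, rule disjI2, rule disjI2, rule disjI1)
      (use that in \<open>simp add: Nfv_def F\<close>)
  show "Ax (gn (Imp (All x (Imp \<phi> \<psi>)) (Imp (Ex x \<phi>) \<psi>)))" if "x \<notin> fv \<psi>"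
    unfolding Ax_def
    by (rule disjI2, rule disjI2, rule disjI2, rule disjI2, rule disjI1)
      (use that in \<open>simp add: Nfv_def F\<close>)
  show "Ax (gn (Eq t t))"
    unfolding Ax_def
    by (rule disjI2, rule disjI2, rule disjI2, rule disjI2, rule disjI2, rule disjI1) (simp add: Tm_def)
  show "Ax (gn (Imp (Eq s t) (Imp (subst x s \<phi>) (subst x t \<phi>))))"
    if "substitutable x s \<phi>" "substitutable x t \<phi>"
    unfolding Ax_def
    by (rule disjI2, rule disjI2, rule disjI2, rule disjI2, rule disjI2, rule disjI2,
        rule exI[of _ x], rule exI[of _ "gn_tm s"], rule exI[of _ "gn_tm t"], rule exI[of _ "gn \<phi>"],
        rule exI[of _ "gn (subst x s \<phi>)"], rule exI[of _ "gn (subst x t \<phi>)"])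
      (simp add: S B that)
qed

lemma AxD: "Ax z \<Longrightarrow> \<exists>\<phi>. z = gn \<phi> \<and> T \<turnstile> \<phi>"
proof -
  have I: "\<exists>\<phi>. z = gn \<phi> \<and> T \<turnstile> \<phi>" if "T \<turnstile> \<psi>" "z = gn \<psi>" for z \<psi>
    using that by blast
  assume "Ax z"
  then show ?thesis
    unfolding Ax_def
  proof (elim disjE exE conjE, goal_cases)
    case (1 a b)
    then obtain \<phi> \<psi> where "a = gn \<phi>" "b = gn \<psi>" by (auto simp: Fm_def)
    then show ?case using I[OF proves.imp1[of T \<phi> \<psi>]] 1 by simp
  next
    case (2 a b)
    then obtain \<phi> \<psi> where "a = gn \<phi>" "b = gn \<psi>" by (auto simp: Fm_def)
    then show ?case using I[OF proves.and1[of T \<phi> \<psi>]] 2 by simp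
  next
    case (3 a b)
    then obtain \<phi> \<psi> where "a = gn \<phi>" "b = gn \<psi>" by (auto simp: Fm_def)
    then show ?case using I[OF proves.and2[of T \<phi> \<psi>]] 3 by simp
  next
    case (4 a b)
    then obtain \<phi> \<psi> where "a = gn \<phi>" "b = gn \<psi>" by (auto simp: Fm_def)
    then show ?case using I[OF proves.and3[of T \<phi> \<psi>]] 4 by simp
  next
    case (5 a b)
    then obtain \<phi> \<psi> where "a = gn \<phi>" "b = gn \<psi>" by (auto simp: Fm_def)
    then show ?case using I[OF proves.or1[of T \<phi> \<psi>]] 5 by simp
  next
    case (6 a b)
    then obtain \<phi> \<psi> where "a = gn \<phi>" "b = gn \<psi>" by (auto simp: Fm_def)
    then show ?case using I[OF proves.or2[of T \<psi> \<phi>]] 6 by simp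
  next
    case (7 a b)
    then obtain \<phi> \<psi> where "a = gn \<phi>" "b = gn \<psi>" by (auto simp: Fm_def)
    then show ?case using I[OF proves.neg1[of T \<phi> \<psi>]] 7 by simp
  next
    case (8 a b)
    then obtain \<phi> \<psi> where "a = gn \<phi>" "b = gn \<psi>" by (auto simp: Fm_def)
    then show ?case using I[OF proves.neg2[of T \<phi>]] 8 by simp
  next
    case (9 a b c)
    then obtain \<phi> \<psi> \<chi> where "a = gn \<phi>" "b = gn \<psi>" "c = gn \<chi>" by (auto simp: Fm_def)
    then show ?case using I[OF proves.imp2[of T \<phi> \<psi> \<chi>]] 9 by simp
  next
    case (10 a b c)
    then obtain \<phi> \<psi> \<chi> where "a = gn \<phi>" "b = gn \<psi>" "c = gn \<chi>" by (auto simp: Fm_def)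
    then show ?case using I[OF proves.or3[of T \<phi> \<chi> \<psi>]] 10 by simp
  next
    case (11 x u a a')
    then obtain t \<phi> where "a = gn \<phi>" "a' = gn (subst x t \<phi>)" "substitutable x t \<phi>"
      by (auto simp: Sbl_def Sub_def)
    then show ?case using I[OF proves.all1[of x t \<phi> T]] 11 by simp
  next
    case (12 x u a a')
    then obtain t \<phi> where "a = gn \<phi>" "a' = gn (subst x t \<phi>)" "substitutable x t \<phi>"
      by (auto simp: Sbl_def Sub_def)
    then show ?case using I[OF proves.ex1[of x t \<phi> T]] 12 by simp
  next
    case (13 x a b)
    then obtain \<phi> \<psi> where "a = gn \<phi>" "b = gn \<psi>" "x \<notin> fv \<phi>" by (auto simp: Fm_def Nfv_def)
    then show ?case using I[OF proves.all2[of x \<phi> T \<psi>]] 13 by simp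
  next
    case (14 x a b)
    then obtain \<phi> \<psi> where "a = gn \<phi>" "b = gn \<psi>" "x \<notin> fv \<psi>" by (auto simp: Fm_def Nfv_def)
    then show ?case using I[OF proves.ex2[of x \<psi> T \<phi>]] 14 by simp
  next
    case (15 u)
    then obtain t where "u = gn_tm t" by (auto simp: Tm_def)
    then show ?case using I[OF proves.eq1[of T t]] 15 by simp
  next
    case (16 x u v a b c)
    then obtain s t \<phi> where "u = gn_tm s" "v = gn_tm t" "b = gn (subst x s \<phi>)" "c = gn (subst x t \<phi>)"
      "substitutable x s \<phi>" "substitutable x t \<phi>"
      by (auto simp: Sbl_def Sub_def)
    then show ?case using I[OF proves.eq2[of x s \<phi> t T]] 16 by simp
  qed
qed

text \<open>The theorems form the least set containing the axioms and closed under the two rules;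
  the primitive recursive axiomatization makes the clause for members of \<open>T\<close>
  \<Sigma>1.\<close>

theorem sigma1_provable:
  assumes "primrec_axiomatized T"
  shows "sigma1 (\<lambda>e. e 0 \<in> gn ` {\<phi>. T \<turnstile> \<phi>})"
proof -
  let ?\<Phi> = "\<lambda>X e. e 0 \<in> gn ` T \<or> Ax (e 0) \<or> (\<exists>a. imp_code a (e 0) \<in> X \<and> a \<in> X) \<or>
    (\<exists>x a. a \<in> X \<and> e 0 = pr 6 (pr x a))"
  let ?I = "\<lambda>e :: nat \<Rightarrow> nat. gn ` {\<phi>. T \<turnstile> \<phi>}"
  have T: "sigma1 (\<lambda>e. e 0 \<in> gn ` T)"
    using assms unfolding primrec_axiomatized_def by (rule sigma1_primrec_set)
  show ?thesis
  proof (rule sigma1_lfp[where \<Phi> = ?\<Phi> and I = ?I])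
    show "sigma1_op ?\<Phi>" by (rule sigma1_op_or[OF sigma1_op_const[OF T]], rule sigma1_op_or[OF sigma1_op_const[OF sigma1_Ax]]) (intro sigma1_op_intros sigma1_intros)
    show "z \<in> ?I e" if "?\<Phi> (?I e) (case_nat z e)" for z e
    proof -
      have I: "z \<in> ?I e" if "T \<turnstile> \<phi>" "z = gn \<phi>" for \<phi> using that by blast
      from that have "z \<in> gn ` T \<or> Ax z \<or> (\<exists>a. imp_code a z \<in> ?I e \<and> a \<in> ?I e) \<or>
        (\<exists>x a. a \<in> ?I e \<and> z = pr 6 (pr x a))" by simp
      then show ?thesis
      proof (elim disjE exE conjE)
        assume "z \<in> gn ` T"
        then show ?thesis by (auto intro: proves.ax)
      next
        assume "Ax z"
        then show ?thesis using AxD[of z T] by auto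
      next
        fix a
        assume "imp_code a z \<in> ?I e" "a \<in> ?I e"
        then obtain \<phi> \<psi> where *: "imp_code (gn \<phi>) z = gn \<psi>" "T \<turnstile> \<phi>" "T \<turnstile> \<psi>" by auto
        \<comment> \<open>The tag 5 forces \<open>\<psi>\<close> to be an implication, and
          injectivity of \<open>gn\<close> identifies its antecedent with
          \<open>\<phi>\<close>.\<close>
        then obtain \<chi> where "\<psi> = Imp \<phi> \<chi>" "z = gn \<chi>" by (cases \<psi>) auto
        then show ?thesis using * I[of \<chi>] proves.mp[of T \<phi> \<chi>] by simp
      next
        fix x a
        assume "a \<in> ?I e" and z: "z = pr 6 (pr x a)"
        then obtain \<phi> where "a = gn \<phi>" "T \<turnstile> \<phi>" by auto
        then show ?thesis using I[OF proves.gen[of T \<phi> x]] z by simp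
      qed
    qed
    show "z \<in> X" if h: "\<And>z. ?\<Phi> X (case_nat z e) \<Longrightarrow> z \<in> X" and z: "z \<in> ?I e" for e X z
    proof -
      from z obtain \<phi> where z: "z = gn \<phi>" and "T \<turnstile> \<phi>" by auto
      have ax: "z \<in> X" if "Ax z" for z
        by (rule h) (use that in simp)
      from \<open>T \<turnstile> \<phi>\<close> have "gn \<phi> \<in> X"
      proof (induction rule: proves.induct)
        case (ax \<phi>)
        show ?case by (rule h) (use ax in simp)
      next
        case (mp \<phi> \<psi>)
        show ?case by (rule h, rule disjI2, rule disjI2, rule disjI1, rule exI[of _ "gn \<phi>"])
          (use mp in simp)
      next
        case (gen \<phi> x)
        show ?case by (rule h, rule disjI2, rule disjI2, rule disjI2, rule exI[of _ x], rule exI[of _ "gn \<phi>"])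
          (use gen in simp)
      qed (rule ax, rule AxI, assumption?)+
      then show ?thesis using z by simp
    qed
  qed
qed

section \<open>A flexible provability predicate\<close>

text \<open>With \<open>w u x\<close> for ``\<open>u\<close> witnesses that \<open>x\<close> is a theorem'' and \<open>ev u d q\<close> for ``\<open>u\<close> witnesses that
  \<open>T\<close> refutes the pattern \<open>d\<close>'': \<open>stop s q\<close> says that \<open>s\<close> codes a refutation of a pattern \<open>d\<close>, none of
  whose elements (the numbers to be excluded) has been recognized as a theorem up to stage \<open>s\<close>. The
  predicate follows the theorems until the first such stage and then realizes the refuted pattern.\<close>

definition stop :: "(nat \<Rightarrow> nat \<Rightarrow> bool) \<Rightarrow> (nat \<Rightarrow> nat \<Rightarrow> nat \<Rightarrow> bool) \<Rightarrow> nat \<Rightarrow> nat \<Rightarrow> bool" where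
  "stop w ev s q \<longleftrightarrow> (\<exists>d<Suc s. \<exists>u<Suc s. s = prod_encode (d, u) \<and> ev u d q \<and>
    (\<forall>y<d. memb d y \<longrightarrow> (\<forall>t<Suc s. \<not> w t y)))"

definition accept :: "(nat \<Rightarrow> nat \<Rightarrow> bool) \<Rightarrow> (nat \<Rightarrow> nat \<Rightarrow> nat \<Rightarrow> bool) \<Rightarrow> nat \<Rightarrow> nat \<Rightarrow> nat \<Rightarrow> bool" where
  "accept w ev x q s \<longleftrightarrow> w s x \<or> stop w ev s q \<and>
    (\<exists>d<Suc s. \<exists>u<Suc s. s = prod_encode (d, u) \<and> x < d \<and> \<not> memb d x)"

lemma delta0_stop:
  assumes "\<And>i j. delta0 (\<lambda>e. w (e i) (e j))" "\<And>i j k. delta0 (\<lambda>e. ev (e i) (e j) (e k))"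
  shows "delta0 (\<lambda>e. stop w ev (e i) (e j))"
  unfolding stop_def prod_encode_eq_iff by (intro delta0_intros delta0_memb assms)

lemma delta0_accept:
  assumes "\<And>i j. delta0 (\<lambda>e. w (e i) (e j))" "\<And>i j k. delta0 (\<lambda>e. ev (e i) (e j) (e k))"
  shows "delta0 (\<lambda>e. accept w ev (e i) (e j) (e k))"
  unfolding accept_def prod_encode_eq_iff by (intro delta0_intros delta0_memb delta0_stop assms)

text \<open>Self-reference: \<open>self M\<close> applies \<open>M\<close> to its own code, supplied through \<open>Var 1\<close>.\<close>

definition self :: "fm \<Rightarrow> fm" where
  "self M = Ex 1 (Ex 2 (And (Eq (Var 1) (num (gn M))) M))"

text \<open>\<open>Var 4\<close> carries the code of the excluded set and \<open>B\<close> is to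
  define membership in it, so one fixed formula expresses all patterns.\<close>

definition pattern :: "fm \<Rightarrow> fm \<Rightarrow> fm" where
  "pattern B P = All 0 (Imp (Lt (Var 0) (Var 4)) (And (Imp B (Neg P)) (Imp (Neg B) P)))"

text \<open>\<open>d\<close> enters through an equation rather than by substitution, so the code of
  the sentence depends on \<open>d\<close> only through the code of one numeral.\<close>

definition refutation :: "fm \<Rightarrow> fm \<Rightarrow> nat \<Rightarrow> fm" where
  "refutation B P d = All 4 (Imp (Eq (Var 4) (num d)) (Neg (pattern B P)))"

text \<open>Follows the clauses of \<open>gn\<close> on \<open>self M\<close> with \<open>q\<close>
  in place of the code of \<open>M\<close>; apart from the numeral only pairing occurs.\<close>

definition self_code :: "nat \<Rightarrow> nat" where
  "self_code q = pr 7 (pr 1 (pr 7 (pr 2 (pr 3 (pr (pr 0 (pr (gn_tm (Var 1)) (gn_tm (num q)))) q)))))"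

definition refutation_code :: "nat \<Rightarrow> nat \<Rightarrow> nat \<Rightarrow> nat" where
  "refutation_code b d q = pr 6 (pr 4 (imp_code (pr 0 (pr (gn_tm (Var 4)) (gn_tm (num d))))
    (pr 2 (pr 6 (pr 0 (imp_code (gn (Lt (Var 0) (Var 4)))
      (pr 3 (pr (imp_code b (pr 2 (self_code q))) (imp_code (pr 2 b) (self_code q))))))))))"

lemma refutation_code: "refutation_code (gn B) d (gn M) = gn (refutation B (self M) d)"
  unfolding refutation_code_def refutation_def pattern_def self_def self_code_def by simp

lemma sigma1_fun_refutation_code: "sigma1_fun (\<lambda>e. refutation_code b (e 0) (e 1))"
  unfolding refutation_code_def self_code_def by (intro sigma1_fun_pair sigma1_fun_const sigma1_fun_var sigma1_fun_gn_num)

text \<open>The circularity is broken here: \<open>ev\<close>, \<open>th\<close> and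
  \<open>st\<close> are given uniformly in a code \<open>q\<close>, before \<open>M\<close> is
  formed from \<open>th\<close> and \<open>st\<close>. Only afterwards is \<open>q\<close>
  specialized to the code of \<open>M\<close>, whereupon \<open>ev\<close> speaks about refutations
  of patterns of \<open>P\<close> itself.\<close>

locale flexible = arith T for T +
  fixes w :: "nat \<Rightarrow> nat \<Rightarrow> bool" and ev :: "nat \<Rightarrow> nat \<Rightarrow> nat \<Rightarrow> bool" and th st B :: fm
  assumes cons: "consistent T"
    and w: "x \<in> gn ` {\<phi>. T \<turnstile> \<phi>} \<longleftrightarrow> (\<exists>u. w u x)"
    and ev: "refutation_code (gn B) d q \<in> gn ` {\<phi>. T \<turnstile> \<phi>} \<longleftrightarrow> (\<exists>u. ev u d q)"
    and B: "Delta0 B" "fv B \<subseteq> {0, 4}" "sat e B \<longleftrightarrow> memb (e 4) (e 0)"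
    and th: "Delta0 th" "fv th \<subseteq> {0, 1, 2}" "sat e th \<longleftrightarrow> accept w ev (e 0) (e 1) (e 2)"
    and st: "Delta0 st" "fv st \<subseteq> {1, 3}" "sat e st \<longleftrightarrow> stop w ev (e 3) (e 1)"
begin

text \<open>The variables are 0 for the argument, 1 for the code of \<open>M\<close>, 2 for the
  accepting stage and 3 for an earlier stage. The second conjunct silences every stage after the
  first stop.\<close>

definition M :: fm where
  "M = And th (All 3 (Imp (Lt (Var 3) (Var 2)) (Neg st)))"

abbreviation q :: nat where
  "q \<equiv> gn M"

definition P :: fm where
  "P = self M"

lemma P_eq: "P = Ex 1 (Ex 2 (And (Eq (Var 1) (num q)) M))"
  by (simp add: P_def self_def)

lemma Sigma1_P: "Sigma1 P"
  unfolding P_eq M_def using th st by (intro Sigma1.intros Delta0.intros) simp_all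

lemma fv_P: "fv P \<subseteq> {0}"
  unfolding P_eq M_def using th(2) st(2) by auto

lemma sat_P: "sat e P \<longleftrightarrow> (\<exists>s. accept w ev (e 0) q s \<and> (\<forall>u<s. \<not> stop w ev u q))"
  unfolding P_eq M_def by (simp add: th(3) st(3))

lemma proves_P: "sat e P \<Longrightarrow> e 0 = x \<Longrightarrow> T \<turnstile> Imp (Eq (Var 0) (num x)) P"
proof -
  assume "sat e P" "e 0 = x"
  then have "T \<turnstile> Imp (hyps e [0]) P" using fv_P by (intro Sigma1_complete Sigma1_P) auto
  from this proves.eq1[of T Zero] show ?thesis by (rule taut2) (simp add: \<open>e 0 = x\<close>)
qed

text \<open>A negative instance of a \<Sigma>1 formula, beyond the reach of \<Sigma>1-completeness.
  By \<open>dichotomy\<close> the stage is at most \<open>s\<close>, where \<open>th\<close> is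
  refuted value by value, or above \<open>s\<close>, where the stop at \<open>s\<close> contradicts
  the second conjunct of \<open>M\<close>.\<close>

lemma proves_not_P:
  assumes s: "stop w ev s q" and no: "\<And>t. t \<le> s \<Longrightarrow> \<not> accept w ev y q t"
  shows "T \<turnstile> Imp (Eq (Var 0) (num y)) (Neg P)"
proof -
  let ?H = "Eq (Var 0) (num y)" and ?Q = "Eq (Var 1) (num q)"
  let ?A = "All 3 (Imp (Lt (Var 3) (Var 2)) (Neg st))"
  have below: "T \<turnstile> Imp (Lt (Var 2) (num (Suc s))) (Imp ?H (Imp ?Q (Neg th)))"
  proof (rule bounded_cases)
    fix t assume t: "t < Suc s"
    define e where "e = (\<lambda>_::nat. 0::nat)(0 := y, 1 := q, 2 := t)"
    have e: "e 0 = y" "e 1 = q" "e 2 = t" by (simp_all add: e_def)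
    have "decides e [0, 1, 2] th" using th by (intro Delta0_decides) auto
    moreover have "\<not> sat e th" using no[of t] t unfolding th(3) e by simp
    ultimately have "T \<turnstile> Imp (hyps e [0, 1, 2]) (Neg th)" by simp
    from this proves.eq1[of T Zero]
    show "T \<turnstile> Imp (Eq (Var 2) (num t)) (Imp ?H (Imp ?Q (Neg th)))"
      by (rule taut2) (simp add: e del: One_nat_def)
  qed
  define e where "e = (\<lambda>_::nat. 0::nat)(1 := q, 3 := s)"
  have e: "e 1 = q" "e 3 = s" by (simp_all add: e_def)
  have "decides e [1, 3] st" using st by (intro Delta0_decides) auto
  moreover have "sat e st" using s unfolding st(3) e by simp
  ultimately have "T \<turnstile> Imp (hyps e [1, 3]) st" by simp
  from this proves.eq1[of T Zero] have "T \<turnstile> Imp (Eq (Var 3) (num s)) (Imp ?Q st)"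
    by (rule taut2) (simp add: e del: One_nat_def)
  from proves_inst_eq[OF this] have "T \<turnstile> Imp ?Q (subst 3 (num s) st)" by simp
  moreover have "T \<turnstile> Imp ?A (Imp (Lt (num s) (Var 2)) (Neg (subst 3 (num s) st)))"
    using proves.all1[of 3 "num s" "Imp (Lt (Var 3) (Var 2)) (Neg st)" T] by simp
  ultimately have "T \<turnstile> Imp (Lt (num s) (Var 2)) (Imp ?Q (Neg ?A))" by (rule taut2) auto
  from this below dichotomy[of 2 s] have "T \<turnstile> Imp ?H (Neg (And ?Q M))"
    unfolding M_def by (rule taut3) auto
  then have "T \<turnstile> Imp ?H (Neg (Ex 2 (And ?Q M)))" by (rule proves_neg_ex) simp
  then show ?thesis unfolding P_eq by (rule proves_neg_ex) simp
qed

lemma decides_memb: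
  "T \<turnstile> Imp (Eq (Var 0) (num x)) (Imp (Eq (Var 4) (num d)) (if memb d x then B else Neg B))"
proof -
  define e where "e = (\<lambda>_::nat. 0::nat)(0 := x, 4 := d)"
  have e: "e 0 = x" "e 4 = d" by (simp_all add: e_def)
  have "decides e [0, 4] B" using B by (intro Delta0_decides) auto
  then have "T \<turnstile> Imp (hyps e [0, 4]) (if memb d x then B else Neg B)" unfolding B(3) e .
  from this proves.eq1[of T Zero] show ?thesis by (rule taut2) (simp add: e)
qed

lemma no_stop: "\<not> stop w ev s q"
proof
  assume "stop w ev s q"
  \<comment> \<open>The least stop is the only one that \<open>P\<close> obeys, so acceptance at
    \<open>s\<close> is not blocked by anything earlier.\<close>
  then obtain s where s: "stop w ev s q" "\<And>u. u < s \<Longrightarrow> \<not> stop w ev u q"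
    using exists_least_iff[of "\<lambda>s. stop w ev s q"] by blast
  then obtain d u where du: "s = prod_encode (d, u)" "ev u d q"
    "\<And>y t. y < d \<Longrightarrow> memb d y \<Longrightarrow> t \<le> s \<Longrightarrow> \<not> w t y"
    unfolding stop_def by (auto simp: less_Suc_eq_le)
  let ?D = "Eq (Var 4) (num d)" and ?body = "And (Imp B (Neg P)) (Imp (Neg B) P)"
  have lit: "T \<turnstile> Imp (Eq (Var 0) (num x)) (if memb d x then Neg P else P)" if "x < d" for x
  proof (cases "memb d x")
    case True
    \<comment> \<open>An excluded \<open>x\<close> is not recognized as a theorem up to
      \<open>s\<close>. Acceptance through a stop at \<open>t\<close> would force
      \<open>t = s\<close> by minimality, but the pair \<open>s\<close> determines \<open>d\<close>,
      which contains \<open>x\<close>.\<close>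
    have "\<not> accept w ev x q t" if "t \<le> s" for t
    proof
      assume "accept w ev x q t"
      then have "stop w ev t q" and *: "\<exists>d u. t = prod_encode (d, u) \<and> \<not> memb d x"
        using du(3)[OF \<open>x < d\<close> True that] unfolding accept_def by blast+
      then have "t = s" using s(2)[of t] that by linarith
      then show False using * True du(1) by auto
    qed
    from proves_not_P[OF s(1) this] True show ?thesis by simp
  next
    case False
    have "d < Suc s" "u < Suc s"
      using le_prod_encode_1[of d u] le_prod_encode_2[of u d] du(1) by simp_all
    then have "accept w ev x q s" unfolding accept_def using s(1) du(1) that False by blast
    then have "sat (\<lambda>_. x) P" unfolding sat_P using s(2) by blast
    from proves_P[OF this refl] False show ?thesis by simp
  qed
  have "T \<turnstile> Imp (Lt (Var 0) (num d)) (Imp ?D ?body)"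
  proof (rule bounded_cases)
    fix x assume "x < d"
    from lit[OF this] decides_memb[of x d] show "T \<turnstile> Imp (Eq (Var 0) (num x)) (Imp ?D ?body)"
      by (rule taut2) (auto split: if_splits)
  qed
  from this eq_Lt[of T "Var 0" "Var 0" "Var 4" "num d"] proves.eq1[of T "Var 0"]
  have "T \<turnstile> Imp ?D (Imp (Lt (Var 0) (Var 4)) ?body)" by (rule taut3) auto
  then have K: "T \<turnstile> Imp ?D (pattern B P)"
    unfolding pattern_def by (rule proves_gen_imp) simp
  have "gn (refutation B P d) \<in> gn ` {\<phi>. T \<turnstile> \<phi>}"
    using du(2) ev[of d q] unfolding P_def refutation_code by blast
  then have "T \<turnstile> refutation B P d" by auto
  then have "T \<turnstile> Imp ?D (Neg (pattern B P))"
    unfolding refutation_def by (rule proves.mp[OF proves_all_elim])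
  from this K have "T \<turnstile> Imp ?D (Neg (Eq Zero Zero))" by (rule taut2) auto
  then have "T \<turnstile> Neg (Eq Zero Zero)" by (rule proves_elim_eq) simp
  then show False using cons proves.eq1[of T Zero] unfolding consistent_def by blast
qed

lemma P_iff: "sat e P \<longleftrightarrow> e 0 \<in> gn ` {\<phi>. T \<turnstile> \<phi>}"
  unfolding sat_P w accept_def using no_stop by blast

text \<open>A witness \<open>u\<close> of a refutation would make the pair of \<open>d\<close> and
  \<open>u\<close> a stop, since non-theorems are recognized at no stage at all.\<close>

lemma pattern_consistent:
  assumes "finite Y" "Y \<inter> gn ` {\<phi>. T \<turnstile> \<phi>} = {}"
  obtains d where "n \<le> d" "\<And>x. memb d x \<longleftrightarrow> x \<in> Y" "\<not> T \<turnstile> refutation B P d"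
proof -
  obtain d where d: "n \<le> d" "\<And>x. memb d x \<longleftrightarrow> x \<in> Y" using memb_surj[OF assms(1)] by metis
  have "\<not> T \<turnstile> refutation B P d"
  proof
    assume "T \<turnstile> refutation B P d"
    then have "gn (refutation B P d) \<in> gn ` {\<phi>. T \<turnstile> \<phi>}" by blast
    then obtain u where u: "ev u d q" using ev[of d q] unfolding P_def refutation_code by blast
    have "\<not> w t y" if "memb d y" for t y using that d(2) w[of y] assms(2) by blast
    then have "stop w ev (prod_encode (d, u)) q"
      unfolding stop_def using u le_prod_encode_1[of d u] le_prod_encode_2[of u d]
      by (metis le_imp_less_Suc)
    then show False using no_stop by blast
  qed
  with d show ?thesis by (rule that)
qed

lemma pattern_literal:
  assumes "x < d"
  shows "T \<turnstile> Imp (And (Eq (Var 4) (num d)) (pattern B P))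
    (if memb d x then Neg (subst 0 (num x) P) else subst 0 (num x) P)"
proof -
  let ?D = "Eq (Var 4) (num d)" and ?s = "subst 0 (num x)"
  have 1: "T \<turnstile> Imp (pattern B P) (Imp (Lt (num x) (Var 4))
      (And (Imp (?s B) (Neg (?s P))) (Imp (Neg (?s B)) (?s P))))"
    unfolding pattern_def
    using proves.all1[of 0 "num x" "Imp (Lt (Var 0) (Var 4)) (And (Imp B (Neg P)) (Imp (Neg B) P))" T]
    by simp
  have "T \<turnstile> Lt (num x) (num d)" using num_Lt[of x d] assms by simp
  from this eq_Lt[of T "num x" "num x" "num d" "Var 4"] proves.eq1[of T "num x"]
    eq_sym[of T "Var 4" "num d"]
  have 2: "T \<turnstile> Imp ?D (Lt (num x) (Var 4))" by (rule taut4) auto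
  have 3: "T \<turnstile> Imp ?D (if memb d x then ?s B else Neg (?s B))"
    using proves_inst_eq[OF decides_memb[of x d]] by (simp split: if_splits)
  from 1 2 3 show ?thesis by (rule taut3) (auto split: if_splits)
qed

text \<open>Forward by \<Sigma>1-completeness of PA, backward by the truth of PA in the standard
  model.\<close>

lemma at_code_P: "T \<turnstile> \<phi> \<longleftrightarrow> PA \<turnstile> at_code P \<phi>"
proof
  assume "T \<turnstile> \<phi>"
  then have "sat (\<lambda>_. gn \<phi>) P" unfolding P_iff by blast
  interpret PA: arith PA by unfold_locales (simp add: extends_def)
  have "PA \<turnstile> Imp (hyps (\<lambda>_. gn \<phi>) [0]) P"
    using fv_P \<open>sat _ P\<close> by (intro PA.Sigma1_complete Sigma1_P) auto
  from this proves.eq1[of PA Zero] have "PA \<turnstile> Imp (Eq (Var 0) (num (gn \<phi>))) P"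
    by (rule taut2) simp
  then show "PA \<turnstile> at_code P \<phi>" unfolding at_code_def by (rule proves_inst_eq)
next
  assume "PA \<turnstile> at_code P \<phi>"
  from PA_sound[OF this, of "\<lambda>_. 0"] have "sat ((\<lambda>_. 0)(0 := gn \<phi>)) P"
    unfolding at_code_def by (simp add: sat_subst)
  then show "T \<turnstile> \<phi>" unfolding P_iff by auto
qed

lemma provability_predicate_P: "provability_predicate T P"
  unfolding provability_predicate_def using fv_P at_code_P by blast

text \<open>Otherwise the truth value of \<open>P\<close> would be the same at all codes, although
  by consistency there are both theorems and non-theorems.\<close>

lemma in_fv_P: "0 \<in> fv P"
proof (rule ccontr)
  assume "0 \<notin> fv P"
  then have "sat (\<lambda>_. gn (Eq Zero Zero)) P = sat (\<lambda>_. gn (Neg (Eq Zero Zero))) P"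
    using fv_P by (intro sat_cong) auto
  moreover have "gn \<phi> \<in> gn ` {\<phi>. T \<turnstile> \<phi>} \<longleftrightarrow> T \<turnstile> \<phi>" for \<phi> by auto
  ultimately have "T \<turnstile> Eq Zero Zero \<longleftrightarrow> T \<turnstile> Neg (Eq Zero Zero)" unfolding P_iff by metis
  then show False using cons proves.eq1[of T Zero] unfolding consistent_def by blast
qed

end

section \<open>The logic \<open>N\<close>\<close>

fun boxes :: "mfm \<Rightarrow> mfm set" where
  "boxes (PVar p) = {}"
| "boxes MBot = {}"
| "boxes (MNeg A) = boxes A"
| "boxes (MAnd A B) = boxes A \<union> boxes B"
| "boxes (MOr A B) = boxes A \<union> boxes B"
| "boxes (MImp A B) = boxes A \<union> boxes B"
| "boxes (Box A) = {A}"

fun pvars :: "mfm \<Rightarrow> nat set" where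
  "pvars (PVar p) = {p}"
| "pvars MBot = {}"
| "pvars (MNeg A) = pvars A"
| "pvars (MAnd A B) = pvars A \<union> pvars B"
| "pvars (MOr A B) = pvars A \<union> pvars B"
| "pvars (MImp A B) = pvars A \<union> pvars B"
| "pvars (Box A) = {}"

lemma finite_boxes [simp]: "finite (boxes A)"
  by (induction A) auto

lemma finite_pvars [simp]: "finite (pvars A)"
  by (induction A) auto

lemma size_boxes: "B \<in> boxes A \<Longrightarrow> size B < size A"
  by (induction A) auto

lemma peval_cong: "(\<And>B. B \<in> boxes A \<Longrightarrow> b B = b' B) \<Longrightarrow> peval v b A = peval v b' A"
  by (induction A) auto

text \<open>Only the finitely many outermost boxes of \<open>A\<close> matter. Prefixing those that
  are theorems of \<open>N\<close> as premises turns \<open>A\<close> into a tautology, and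
  necessitation with modus ponens removes the premises again.\<close>

lemma N_complete:
  assumes "\<And>v b. (\<And>B. N_proves B \<Longrightarrow> b B) \<Longrightarrow> peval v b A"
  shows "N_proves A"
proof -
  have "finite {B \<in> boxes A. N_proves B}" by simp
  then obtain L where L: "set L = {B \<in> boxes A. N_proves B}" using finite_list by blast
  let ?C = "\<lambda>L. foldr (\<lambda>B. MImp (Box B)) L A"
  have C: "peval v b (?C L) \<longleftrightarrow> ((\<forall>B\<in>set L. b B) \<longrightarrow> peval v b A)" for v b L
    by (induction L) auto
  have "peval v b (?C L)" for v b
    unfolding C
  proof
    assume *: "\<forall>B\<in>set L. b B"
    \<comment> \<open>\<open>b\<close> is raised to hold at all theorems of \<open>N\<close>; by the
      premises this changes nothing on the boxes that occur in \<open>A\<close>.\<close>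
    have "peval v (\<lambda>B. b B \<or> N_proves B) A" by (rule assms) simp
    then show "peval v b A" using peval_cong[of A "\<lambda>B. b B \<or> N_proves B" b v] * L by blast
  qed
  then have "N_proves (?C L)" by (intro N_proves.taut) (simp add: tautology_def)
  moreover have "N_proves (?C L) \<Longrightarrow> (\<forall>B\<in>set L. N_proves B) \<Longrightarrow> N_proves A" for L
  proof (induction L)
    case (Cons B L)
    then have "N_proves (MImp (Box B) (?C L))" "N_proves (Box B)" by (simp_all add: N_proves.nec)
    then have "N_proves (?C L)" by (rule N_proves.mp)
    with Cons show ?case by simp
  qed simp
  ultimately show ?thesis using L by blast
qed

lemma N_sound:
  assumes "provability_predicate T P" "extends T PA" "arith_interpretation P f" "N_proves A"
  shows "PA \<turnstile> f A"
  using assms(4)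
proof (induction rule: N_proves.induct)
  case (taut A)
  have f: "f MBot = Eq Zero (num 1)" "f (MNeg A) = Neg (f A)" "f (MAnd A B) = And (f A) (f B)"
    "f (MOr A B) = Or (f A) (f B)" "f (MImp A B) = Imp (f A) (f B)" for A B
    using assms(3) unfolding arith_interpretation_def by blast+
  interpret PA: arith PA by unfold_locales (simp add: extends_def)
  have "PA \<turnstile> Neg (f MBot)"
    unfolding f using PA.num_neq[of 0 1] by simp
  then show ?case
  proof (rule taut1)
    fix v
    assume "fm_peval v (Neg (f MBot))"
    \<comment> \<open>The sentence chosen for a modal variable may be compound, so each modal atom
      receives the value of its whole interpretation.\<close>
    then have "fm_peval v (f A) = peval (\<lambda>p. fm_peval v (f (PVar p))) (\<lambda>B. fm_peval v (f (Box B))) A" for A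
      by (induction A) (simp_all add: f)
    from this[of A] taut show "fm_peval v (f A)" unfolding tautology_def by blast
  qed
next
  case (mp A B)
  moreover have "f (MImp A B) = Imp (f A) (f B)"
    using assms(3) unfolding arith_interpretation_def by blast
  ultimately have "PA \<turnstile> Imp (f A) (f B)" by simp
  then show ?case using mp.IH(2) by (rule proves.mp)
next
  case (nec A)
  \<comment> \<open>Provability passes from PA up to \<open>T\<close>; the defining property of the
    provability predicate then brings the boxed sentence back down to PA.\<close>
  then have "T \<turnstile> f A" using assms(2) unfolding extends_def by blast
  moreover have "f (Box A) = at_code P (f A)"
    using assms(3) unfolding arith_interpretation_def by blast
  ultimately show ?case using assms(1) unfolding provability_predicate_def by simp
qed

text \<open>The tags of \<open>gn\<close> are below 8, so variables are interpreted by instances of \<open>P\<close> at numbers that are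
  not codes of formulas, and the interpretation is injective.\<close>

fun interp :: "fm \<Rightarrow> mfm \<Rightarrow> fm" where
  "interp P (PVar p) = subst 0 (num (prod_encode (8 + p, 0))) P"
| "interp P MBot = Eq Zero (num 1)"
| "interp P (MNeg A) = Neg (interp P A)"
| "interp P (MAnd A B) = And (interp P A) (interp P B)"
| "interp P (MOr A B) = Or (interp P A) (interp P B)"
| "interp P (MImp A B) = Imp (interp P A) (interp P B)"
| "interp P (Box A) = at_code P (interp P A)"

lemma gn_neq_var_code: "gn \<phi> \<noteq> prod_encode (8 + p, n)"
  by (cases \<phi>) auto

lemma arith_interpretation_interp: "fv P \<subseteq> {0} \<Longrightarrow> arith_interpretation P (interp P)"
  by (auto simp: arith_interpretation_def sentence_def fv_subst_num)

lemma interp_inject: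
  assumes "0 \<in> fv P" "P = Ex 1 Q"
  shows "interp P A = interp P A' \<Longrightarrow> A = A'"
proof (induction A arbitrary: A')
  case (PVar p)
  show ?case
  proof (cases A')
    case (PVar p')
    with PVar.prems subst_num_inject[OF assms(1)] have "prod_encode (8 + p, 0) = prod_encode (8 + p', 0)"
      by (simp del: prod_encode_eq)
    with PVar show ?thesis by simp
  next
    case (Box C)
    with PVar.prems subst_num_inject[OF assms(1)] have "prod_encode (8 + p, 0) = gn (interp P C)"
      by (simp add: at_code_def)
    with gn_neq_var_code show ?thesis by metis
  qed (use PVar.prems assms(2) in auto)
next
  case MBot
  then show ?case by (cases A') (auto simp: at_code_def assms(2))
next
  case (MNeg A)
  then show ?case by (cases A') (auto simp: at_code_def assms(2))
next
  case (MAnd A1 A2)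
  then show ?case by (cases A') (auto simp: at_code_def assms(2))
next
  case (MOr A1 A2)
  then show ?case by (cases A') (auto simp: at_code_def assms(2))
next
  case (MImp A1 A2)
  then show ?case by (cases A') (auto simp: at_code_def assms(2))
next
  case (Box A)
  show ?case
  proof (cases A')
    case (PVar p)
    with Box.prems subst_num_inject[OF assms(1)] have "gn (interp P A) = prod_encode (8 + p, 0)"
      by (simp add: at_code_def)
    with gn_neq_var_code show ?thesis by metis
  next
    case (Box C)
    with Box.prems have "subst 0 (num (gn (interp P A))) P = subst 0 (num (gn (interp P C))) P"
      by (simp add: at_code_def)
    from subst_num_inject[OF assms(1) this] Box.IH Box show ?thesis by simp
  qed (use Box.prems assms(2) in \<open>auto simp: at_code_def\<close>)
qed

text \<open>Injectivity of the interpretation lets a pattern prescribe the value of each atom of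
  \<open>A\<close> separately. The induction on size serves to show that the boxes made false are
  non-theorems of \<open>T\<close>, as the pattern may exclude only these.\<close>

lemma (in flexible) interp_complete: "T \<turnstile> interp P A \<Longrightarrow> N_proves A"
proof (induction A rule: measure_induct_rule[of size])
  case (less A)
  let ?c = "\<lambda>B. gn (interp P B)" and ?n = "\<lambda>p. prod_encode (8 + p, 0)"
  show ?case
  proof (rule ccontr)
    assume "\<not> N_proves A"
    then obtain v b where vb: "\<And>B. N_proves B \<Longrightarrow> b B" "\<not> peval v b A"
      using N_complete[of A] by blast
    \<comment> \<open>The numbers at which \<open>P\<close> has to fail. False boxes are unprovable
      in \<open>N\<close> since \<open>b\<close> holds at all its theorems; numbers used for
      variables code no formula.\<close>
    define Y where "Y = ?c ` {B \<in> boxes A. \<not> b B} \<union> ?n ` {p \<in> pvars A. \<not> v p}"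
    have inj: "B = C" if "?c B = ?c C" for B C
      using interp_inject[OF in_fv_P P_eq, of B C] that by simp
    have ne: "?c B \<noteq> ?n p" for B p by (rule gn_neq_var_code)
    have Y1: "?c B \<in> Y \<longleftrightarrow> \<not> b B" if "B \<in> boxes A" for B
      unfolding Y_def using that inj[of B] ne[of B] by blast
    have Y2: "?n p \<in> Y \<longleftrightarrow> \<not> v p" if "p \<in> pvars A" for p
      unfolding Y_def using that ne[of _ p, symmetric] by auto
    have "\<not> T \<turnstile> interp P B" if "B \<in> boxes A" "\<not> b B" for B
      using less.IH[OF size_boxes[OF that(1)]] vb(1)[of B] that(2) by blast
    then have "Y \<inter> gn ` {\<phi>. T \<turnstile> \<phi>} = {}"
      unfolding Y_def using gn_neq_var_code by auto
    moreover have "finite Y" unfolding Y_def by simp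
    \<comment> \<open>The code \<open>d\<close> must exceed the numbers of the true atoms as well,
      for the pattern forces \<open>P\<close> to hold only below \<open>d\<close>.\<close>
    moreover have "finite (?c ` boxes A \<union> ?n ` pvars A)" by simp
    then obtain n where n: "\<And>x. x \<in> ?c ` boxes A \<union> ?n ` pvars A \<Longrightarrow> x < n"
      unfolding finite_nat_set_iff_bounded by blast
    ultimately obtain d where d: "n \<le> d" "\<And>x. memb d x \<longleftrightarrow> x \<in> Y" "\<not> T \<turnstile> refutation B P d"
      using pattern_consistent by metis
    let ?G = "And (Eq (Var 4) (num d)) (pattern B P)"
    have "T \<turnstile> Imp ?G (if peval v b C then interp P C else Neg (interp P C))"
      if "boxes C \<subseteq> boxes A" "pvars C \<subseteq> pvars A" for C
      using that
    proof (induction C)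
      case (PVar p)
      then have "?n p < d" using n[of "?n p"] d(1) by auto
      from pattern_literal[OF this] show ?case using Y2[of p] PVar d(2)[of "?n p"] by (simp split: if_splits)
    next
      case (Box C)
      then have "?c C < d" using n[of "?c C"] d(1) by auto
      from pattern_literal[OF this] show ?case
        using Y1[of C] Box d(2)[of "?c C"] by (simp add: at_code_def split: if_splits)
    next
      case MBot
      have "T \<turnstile> Neg (interp P MBot)" using num_neq[of 0 1] by simp
      then show ?case by (rule taut1) simp
    next
      case (MNeg C)
      then have "T \<turnstile> Imp ?G (if peval v b C then interp P C else Neg (interp P C))" by simp
      then show ?case by (rule taut1) auto
    next
      case (MAnd C D)
      then have "T \<turnstile> Imp ?G (if peval v b C then interp P C else Neg (interp P C))"
        "T \<turnstile> Imp ?G (if peval v b D then interp P D else Neg (interp P D))" by simp_all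
      then show ?case by (rule taut2) auto
    next
      case (MOr C D)
      then have "T \<turnstile> Imp ?G (if peval v b C then interp P C else Neg (interp P C))"
        "T \<turnstile> Imp ?G (if peval v b D then interp P D else Neg (interp P D))" by simp_all
      then show ?case by (rule taut2) auto
    next
      case (MImp C D)
      then have "T \<turnstile> Imp ?G (if peval v b C then interp P C else Neg (interp P C))"
        "T \<turnstile> Imp ?G (if peval v b D then interp P D else Neg (interp P D))" by simp_all
      then show ?case by (rule taut2) auto
    qed
    \<comment> \<open>The pattern implies the negation of a theorem of \<open>T\<close>, so
      \<open>T\<close> refutes the pattern, contrary to the choice of \<open>d\<close>.\<close>
    from this[of A] vb(2) have "T \<turnstile> Imp ?G (Neg (interp P A))" by simp
    from this less.prems have "T \<turnstile> Imp (Eq (Var 4) (num d)) (Neg (pattern B P))"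
      by (rule taut2) auto
    then have "T \<turnstile> refutation B P d" unfolding refutation_def by (rule proves.gen)
    with d(3) show False by blast
  qed
qed

text \<open>The environment is padded with a constant value beyond the argument that
  \<open>Q\<close> reads, which turns the matrix into a relation between two numbers.\<close>

lemma sigma1_witness1:
  assumes "sigma1 (\<lambda>e. Q (e 0))"
  obtains w where "\<And>i j. delta0 (\<lambda>e. w (e i) (e j))" "\<And>x. Q x \<longleftrightarrow> (\<exists>u. w u x)"
proof -
  from assms obtain M where M: "delta0 M" "\<And>e. Q (e 0) \<longleftrightarrow> (\<exists>u. M (case_nat u e))" by (rule sigma1E) blast
  have "delta0 (\<lambda>e. M (case_nat (e i) (\<lambda>_. e j)))" for i j
  proof -
    have "delta0 (\<lambda>e. M (\<lambda>k. e (case_nat i (\<lambda>_. j) k)))" using M(1) by (rule delta0_ren)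
    moreover have "(\<lambda>k. e (case_nat i (\<lambda>_. j) k)) = case_nat (e i) (\<lambda>_. e j)" for e :: "nat \<Rightarrow> nat"
      by (rule ext) (simp split: nat.split)
    ultimately show ?thesis by simp
  qed
  then show ?thesis using M(2)[of "\<lambda>_. x" for x] by (rule that[of "\<lambda>u x. M (case_nat u (\<lambda>_. x))"])
qed

lemma sigma1_witness2:
  assumes "sigma1 (\<lambda>e. Q (e 0) (e 1))"
  obtains w where "\<And>i j k. delta0 (\<lambda>e. w (e i) (e j) (e k))" "\<And>x y. Q x y \<longleftrightarrow> (\<exists>u. w u x y)"
proof -
  from assms obtain M where M: "delta0 M" "\<And>e. Q (e 0) (e 1) \<longleftrightarrow> (\<exists>u. M (case_nat u e))"
    by (rule sigma1E) blast
  have "delta0 (\<lambda>e. M (case_nat (e i) (case_nat (e j) (\<lambda>_. e k))))" for i j k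
  proof -
    have "delta0 (\<lambda>e. M (\<lambda>n. e (case_nat i (case_nat j (\<lambda>_. k)) n)))" using M(1) by (rule delta0_ren)
    moreover have "(\<lambda>n. e (case_nat i (case_nat j (\<lambda>_. k)) n)) = case_nat (e i) (case_nat (e j) (\<lambda>_. e k))"
      for e :: "nat \<Rightarrow> nat"
      by (rule ext) (simp split: nat.split)
    ultimately show ?thesis by simp
  qed
  moreover have "Q x y \<longleftrightarrow> (\<exists>u. M (case_nat u (case_nat x (\<lambda>_. y))))" for x y
    using M(2)[of "case_nat x (\<lambda>_. y)"] by simp
  ultimately show ?thesis by (rule that[of "\<lambda>u x y. M (case_nat u (case_nat x (\<lambda>_. y)))"])
qed

lemma flexible_exists:
  assumes "consistent T" "primrec_axiomatized T" "extends T PA"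
  obtains w ev th st B where "flexible T w ev th st B"
proof -
  have inf: "infinite (- range (\<rho> :: nat \<Rightarrow> nat))" if "finite (range \<rho>)" for \<rho>
    using that by (simp add: finite_compl)
  let ?Thm = "gn ` {\<phi>. T \<turnstile> \<phi>}"
  \<comment> \<open>Index 0, the set code, becomes \<open>Var 4\<close>, and all other indices share
    \<open>Var 0\<close>, so that the range is finite. \<open>B\<close> has to be built first
    because its code enters \<open>refutation_code\<close> and thereby \<open>ev\<close>.\<close>
  let ?\<rho>B = "case_nat 4 (\<lambda>_. 0) :: nat \<Rightarrow> nat"
  have rB: "range ?\<rho>B \<subseteq> {0, 4}" by (auto split: nat.splits)
  have "finite (range ?\<rho>B)" using rB by (rule finite_subset) simp
  from delta0_fm[OF delta0_memb[of 0 1] inf[OF this]] obtain B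
    where B: "Delta0 B" "fv B \<subseteq> range ?\<rho>B" "\<And>e. sat e B = memb (e 4) (e 0)" by auto
  obtain w where w: "\<And>i j. delta0 (\<lambda>e. w (e i) (e j))" "\<And>x. x \<in> ?Thm \<longleftrightarrow> (\<exists>u. w u x)"
    using sigma1_witness1[of "\<lambda>x. x \<in> ?Thm", OF sigma1_provable[OF assms(2)]] by blast
  have "sigma1 (\<lambda>e. refutation_code (gn B) (e 0) (e 1) \<in> ?Thm)"
    by (rule sigma1_comp1[of "\<lambda>x. x \<in> ?Thm", OF sigma1_provable[OF assms(2)] sigma1_fun_refutation_code])
  then obtain ev where ev: "\<And>i j k. delta0 (\<lambda>e. ev (e i) (e j) (e k))"
    "\<And>d q. refutation_code (gn B) d q \<in> ?Thm \<longleftrightarrow> (\<exists>u. ev u d q)"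
    using sigma1_witness2[of "\<lambda>d q. refutation_code (gn B) d q \<in> ?Thm"] by blast
  let ?\<rho>t = "case_nat 0 (case_nat 1 (\<lambda>_. 2)) :: nat \<Rightarrow> nat"
  have rt: "range ?\<rho>t \<subseteq> {0, 1, 2}" by (auto split: nat.splits)
  have "finite (range ?\<rho>t)" using rt by (rule finite_subset) simp
  from delta0_fm[OF delta0_accept[of w ev 0 1 2, OF w(1) ev(1)] inf[OF this]] obtain th
    where th: "Delta0 th" "fv th \<subseteq> range ?\<rho>t" "\<And>e. sat e th = accept w ev (e 0) (e 1) (e 2)"
    by (auto simp: numeral_2_eq_2)
  let ?\<rho>s = "case_nat 3 (\<lambda>_. 1) :: nat \<Rightarrow> nat"
  have rs: "range ?\<rho>s \<subseteq> {1, 3}" by (auto split: nat.splits)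
  have "finite (range ?\<rho>s)" using rs by (rule finite_subset) simp
  from delta0_fm[OF delta0_stop[of w ev 0 1, OF w(1) ev(1)] inf[OF this]] obtain st
    where st: "Delta0 st" "fv st \<subseteq> range ?\<rho>s" "\<And>e. sat e st = stop w ev (e 3) (e 1)" by auto
  have "flexible T w ev th st B"
    by unfold_locales (fact assms w(2) ev(2) B(1,3) th(1,3) st(1,3)
      order_trans[OF B(2) rB] order_trans[OF th(2) rt] order_trans[OF st(2) rs])+
  then show ?thesis by (rule that)
qed

theorem theorem4p1:
  fixes T :: "fm set"
  assumes "consistent T"
    and "primrec_axiomatized T"
    and "extends T PA"
  shows "\<exists>P. Sigma1 P \<and> provability_predicate T P \<and>
    (\<forall>A f. arith_interpretation P f \<longrightarrow> N_proves A \<longrightarrow> PA \<turnstile> f A) \<and>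
    (\<exists>f. arith_interpretation P f \<and> (\<forall>A. N_proves A \<longleftrightarrow> T \<turnstile> f A))"
proof -
  obtain w ev th st B where "flexible T w ev th st B" using flexible_exists[OF assms] .
  then interpret flexible T w ev th st B .
  have sound: "PA \<turnstile> f A" if "arith_interpretation P f" "N_proves A" for A f
    using N_sound[OF provability_predicate_P assms(3) that] .
  have f: "arith_interpretation P (interp P)" using fv_P by (rule arith_interpretation_interp)
  have "N_proves A \<longleftrightarrow> T \<turnstile> interp P A" for A
    using sound[OF f, of A] assms(3) interp_complete[of A] unfolding extends_def by blast
  with Sigma1_P provability_predicate_P sound f show ?thesis by blast
qed

end
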